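(* Let $\zeta\colon\mathcal{A}_0\to\mathcal{Z}$ be a fully faithful exact functor of abelian categories. Let $\mathcal{E}x^{\mathcal{Z}}(\mathcal{A}_0)$ be the extension closure in $\mathcal{Z}$ of the essential image $\zeta(\mathcal{A}_0)$, and let $\zeta_0\colon\mathcal{A}_0\to\mathcal{E}x^{\mathcal{Z}}(\mathcal{A}_0)$ be the functor through which $\zeta$ factors. Then $(\mathcal{E}x^{\mathcal{Z}}(\mathcal{A}_0),\zeta_0)\in\widetilde{\mathrm{Fin}}_{\mathcal{A}_0}$ ind-represents the non-commutative deformation functor $\mathrm{ncDef}_\zeta\colon\mathrm{Fin}_{\mathcal{A}_0}^{\mathrm{op}}\to\mathrm{Sets}$.
   Context: For strictly full subcategories $\mathcal{A},\mathcal{B}$ of an abelian category $\mathcal{Z}$, $\mathcal{A}\ast\mathcal{B}$ is the full subcategory of objects $C$ fitting into a short exact sequence $0\to A\to C\to B\to0$ with $A\in\mathcal{A}$, $B\in\mathcal{B}$; this operation is associative. Put $\mathcal{E}x^{\mathcal{Z}}_k(\mathcal{A})=\mathcal{A}\ast\cdots\ast\mathcal{A}$ ($k+1$ factors), $\mathcal{E}x_0^{\mathcal{Z}}(\mathcal{A})=\mathcal{A}$. The extension closure of $\mathcal{A}$ is $\mathcal{E}x^{\mathcal{Z}}(\mathcal{A})=\bigcup_k\mathcal{E}x^{\mathcal{Z}}_k(\mathcal{A})$. A fully faithful functor $F\colon\mathcal{A}\to\mathcal{Z}$ is extension generating if the extension closure of its essential image is $\mathcal{Z}$. For an abelian category $\mathcal{A}_0$,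 the category $\widetilde{\mathrm{Fin}}_{\mathcal{A}_0}$ has as objects pairs $(\mathcal{A},Q_{\mathcal{A}})$ with $\mathcal{A}$ an abelian category and $Q_{\mathcal{A}}\colon\mathcal{A}_0\to\mathcal{A}$ a fully faithful, extension generating exact functor. Morphisms $(\mathcal{A},Q_{\mathcal{A}})\to(\mathcal{B},Q_{\mathcal{B}})$ are classes of pairs $(F,\varphi)$ with $F\colon\mathcal{A}\to\mathcal{B}$ exact and $\varphi\colon F\circ Q_{\mathcal{A}}\xrightarrow{\simeq}Q_{\mathcal{B}}$, where $(F,\varphi)\sim(F',\varphi')$ if there is an isomorphism $\psi\colon F\xrightarrow{\simeq}F'$ with $\varphi'\circ(\psi Q_{\mathcal{A}})=\varphi$. $\mathrm{Fin}_{\mathcal{A}_0}\subset\widetilde{\mathrm{Fin}}_{\mathcal{A}_0}$ is the full subcategory of those $(\mathcal{A},Q_{\mathcal{A}})$ for which $\mathcal{E}x_k^{\mathcal{A}}(Q_{\mathcal{A}}(\mathcal{A}_0))=\mathcal{A}$ for some $k\in\mathbb{N}$. For an exact functor $\zeta\colon\mathcal{A}_0\to\mathcal{Z}$, the functor $\mathrm{ncDef}_\zeta\colon\mathrm{Fin}_{\mathcal{A}_0}^{\mathrm{op}}\to\mathrm{Sets}$ assigns to $(\mathcal{A},Q_{\mathcal{A}})$ the set of pairs $(T,\tau)$ with $T\colon\mathcal{A}\to\mathcal{Z}$ exact and $\tau\colon T\circ Q_{\mathcal{A}}\xrightarrow{\simeq}\zeta$, modulo $(T,\tau)\sim(T',\tau')$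 if there is $\psi\colon T\xrightarrow{\simeq}T'$ with $\tau'\circ(\psi Q_{\mathcal{A}})=\tau$; to $(F,\varphi)\colon\mathcal{A}\to\mathcal{B}$ it assigns $(T,\tau)\mapsto(T\circ F,\ \tau\circ T\varphi)$. An object $\mathcal{C}\in\widetilde{\mathrm{Fin}}_{\mathcal{A}_0}$ ind-represents $G\colon\mathrm{Fin}_{\mathcal{A}_0}^{\mathrm{op}}\to\mathrm{Sets}$ if $G$ is isomorphic to the restriction of $\operatorname{Hom}_{\widetilde{\mathrm{Fin}}_{\mathcal{A}_0}}(-,\mathcal{C})$ to $\mathrm{Fin}_{\mathcal{A}_0}^{\mathrm{op}}$. *)

theory Defs
  imports "HOL-Algebra.Group"
begin

section \<open>Categories\<close>

record ('o, 'm) cat =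
  Ob :: "'o set"
  Arr :: "'m set"
  Dom :: "'m \<Rightarrow> 'o"
  Cod :: "'m \<Rightarrow> 'o"
  Ident :: "'o \<Rightarrow> 'm"
  Comp :: "'m \<Rightarrow> 'm \<Rightarrow> 'm"  (infixr "\<bullet>\<index>" 70)

definition homset :: "('o, 'm, 'z) cat_scheme \<Rightarrow> 'o \<Rightarrow> 'o \<Rightarrow> 'm set" where
  "homset C X Y = {f \<in> Arr C. Dom C f = X \<and> Cod C f = Y}"

locale category =
  fixes C :: "('o, 'm, 'z) cat_scheme" (structure)
  assumes Dom_Ob: "f \<in> Arr C \<Longrightarrow> Dom C f \<in> Ob C"
    and Cod_Ob: "f \<in> Arr C \<Longrightarrow> Cod C f \<in> Ob C"
    and Ident_hom: "X \<in> Ob C \<Longrightarrow> Ident C X \<in> homset C X X"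
    and Comp_hom: "\<lbrakk>f \<in> homset C X Y; g \<in> homset C Y W\<rbrakk> \<Longrightarrow> g \<bullet> f \<in> homset C X W"
    and Comp_Ident: "f \<in> homset C X Y \<Longrightarrow> f \<bullet> Ident C X = f"
    and Ident_Comp: "f \<in> homset C X Y \<Longrightarrow> Ident C Y \<bullet> f = f"
    and Comp_assoc: "\<lbrakk>f \<in> homset C X Y; g \<in> homset C Y W; h \<in> homset C W V\<rbrakk>
                      \<Longrightarrow> (h \<bullet> g) \<bullet> f = h \<bullet> (g \<bullet> f)"

definition is_isomorphism :: "('o, 'm, 'z) cat_scheme \<Rightarrow> 'm \<Rightarrow> bool" where
  "is_isomorphism C f \<longleftrightarrow> f \<in> Arr C \<and> (\<exists>g \<in> homset C (Cod C f) (Dom C f).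
      g \<bullet>\<^bsub>C\<^esub> f = Ident C (Dom C f) \<and> f \<bullet>\<^bsub>C\<^esub> g = Ident C (Cod C f))"

definition isomorphic :: "('o, 'm, 'z) cat_scheme \<Rightarrow> 'o \<Rightarrow> 'o \<Rightarrow> bool" where
  "isomorphic C X Y \<longleftrightarrow> (\<exists>f \<in> homset C X Y. is_isomorphism C f)"

definition is_mono :: "('o, 'm, 'z) cat_scheme \<Rightarrow> 'm \<Rightarrow> bool" where
  "is_mono C f \<longleftrightarrow> f \<in> Arr C \<and> (\<forall>W. \<forall>g \<in> homset C W (Dom C f). \<forall>h \<in> homset C W (Dom C f).
      f \<bullet>\<^bsub>C\<^esub> g = f \<bullet>\<^bsub>C\<^esub> h \<longrightarrow> g = h)"

definition is_epi :: "('o, 'm, 'z) cat_scheme \<Rightarrow> 'm \<Rightarrow> bool" where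
  "is_epi C f \<longleftrightarrow> f \<in> Arr C \<and> (\<forall>W. \<forall>g \<in> homset C (Cod C f) W. \<forall>h \<in> homset C (Cod C f) W.
      g \<bullet>\<^bsub>C\<^esub> f = h \<bullet>\<^bsub>C\<^esub> f \<longrightarrow> g = h)"

definition is_zero_object :: "('o, 'm, 'z) cat_scheme \<Rightarrow> 'o \<Rightarrow> bool" where
  "is_zero_object C Z \<longleftrightarrow> Z \<in> Ob C \<and>
     (\<forall>X \<in> Ob C. (\<exists>!f. f \<in> homset C X Z) \<and> (\<exists>!f. f \<in> homset C Z X))"

definition full_subcat :: "('o, 'm, 'z) cat_scheme \<Rightarrow> 'o set \<Rightarrow> ('o, 'm, 'z) cat_scheme" where
  "full_subcat C S = C\<lparr>Ob := Ob C \<inter> S, Arr := {f \<in> Arr C. Dom C f \<in> S \<and> Cod C f \<in> S}\<rparr>"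


section \<open>Abelian categories\<close>

record ('o, 'm) abcat = "('o, 'm) cat" +
  Add :: "'m \<Rightarrow> 'm \<Rightarrow> 'm"  (infixl "\<oplus>\<index>" 65)
  Zero :: "'o \<Rightarrow> 'o \<Rightarrow> 'm"

definition hom_group :: "('o, 'm, 'z) abcat_scheme \<Rightarrow> 'o \<Rightarrow> 'o \<Rightarrow> 'm monoid" where
  "hom_group C X Y = \<lparr>carrier = homset C X Y, mult = Add C, one = Zero C X Y\<rparr>"

locale preadditive_category = category C
  for C :: "('o, 'm, 'z) abcat_scheme" (structure) +
  assumes hom_comm_group: "\<lbrakk>X \<in> Ob C; Y \<in> Ob C\<rbrakk> \<Longrightarrow> comm_group (hom_group C X Y)"
    and Comp_Add: "\<lbrakk>f \<in> homset C X Y; f' \<in> homset C X Y; g \<in> homset C Y W\<rbrakk>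
                    \<Longrightarrow> g \<bullet> (f \<oplus> f') = (g \<bullet> f) \<oplus> (g \<bullet> f')"
    and Add_Comp: "\<lbrakk>f \<in> homset C X Y; g \<in> homset C Y W; g' \<in> homset C Y W\<rbrakk>
                    \<Longrightarrow> (g \<oplus> g') \<bullet> f = (g \<bullet> f) \<oplus> (g' \<bullet> f)"

text \<open>\<open>is_kernel C f k\<close>: the arrow \<open>k\<close> is a kernel of \<open>f\<close>; dually for cokernels.\<close>

definition is_kernel :: "('o, 'm, 'z) abcat_scheme \<Rightarrow> 'm \<Rightarrow> 'm \<Rightarrow> bool" where
  "is_kernel C f k \<longleftrightarrow> f \<in> Arr C \<and> k \<in> Arr C \<and> Cod C k = Dom C f \<and>
     f \<bullet>\<^bsub>C\<^esub> k = Zero C (Dom C k) (Cod C f) \<and>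
     (\<forall>W. \<forall>h \<in> homset C W (Dom C f). f \<bullet>\<^bsub>C\<^esub> h = Zero C W (Cod C f) \<longrightarrow>
        (\<exists>!u. u \<in> homset C W (Dom C k) \<and> k \<bullet>\<^bsub>C\<^esub> u = h))"

definition is_cokernel :: "('o, 'm, 'z) abcat_scheme \<Rightarrow> 'm \<Rightarrow> 'm \<Rightarrow> bool" where
  "is_cokernel C f q \<longleftrightarrow> f \<in> Arr C \<and> q \<in> Arr C \<and> Dom C q = Cod C f \<and>
     q \<bullet>\<^bsub>C\<^esub> f = Zero C (Dom C f) (Cod C q) \<and>
     (\<forall>W. \<forall>h \<in> homset C (Cod C f) W. h \<bullet>\<^bsub>C\<^esub> f = Zero C (Dom C f) W \<longrightarrow>
        (\<exists>!u. u \<in> homset C (Cod C q) W \<and> u \<bullet>\<^bsub>C\<^esub> q = h))"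

definition has_biproduct :: "('o, 'm, 'z) abcat_scheme \<Rightarrow> 'o \<Rightarrow> 'o \<Rightarrow> bool" where
  "has_biproduct C X Y \<longleftrightarrow> (\<exists>P \<in> Ob C.
     \<exists>i \<in> homset C X P. \<exists>j \<in> homset C Y P. \<exists>p \<in> homset C P X. \<exists>q \<in> homset C P Y.
       p \<bullet>\<^bsub>C\<^esub> i = Ident C X \<and> q \<bullet>\<^bsub>C\<^esub> j = Ident C Y \<and>
       (i \<bullet>\<^bsub>C\<^esub> p) \<oplus>\<^bsub>C\<^esub> (j \<bullet>\<^bsub>C\<^esub> q) = Ident C P)"

locale abelian_category = preadditive_category C
  for C :: "('o, 'm, 'z) abcat_scheme" (structure) +
  assumes zero_object: "\<exists>Z. is_zero_object C Z"
    and biproducts: "\<lbrakk>X \<in> Ob C; Y \<in> Ob C\<rbrakk> \<Longrightarrow> has_biproduct C X Y"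
    and kernels: "f \<in> Arr C \<Longrightarrow> \<exists>k. is_kernel C f k"
    and cokernels: "f \<in> Arr C \<Longrightarrow> \<exists>q. is_cokernel C f q"
    and mono_normal: "is_mono C f \<Longrightarrow> \<exists>g. is_kernel C g f"
    and epi_normal: "is_epi C f \<Longrightarrow> \<exists>g. is_cokernel C g f"

text \<open>\<open>short_exact C i p\<close>: the sequence \<open>0 \<rightarrow> Dom i \<rightarrow> Cod i = Dom p \<rightarrow> Cod p \<rightarrow> 0\<close> is exact.\<close>

definition short_exact :: "('o, 'm, 'z) abcat_scheme \<Rightarrow> 'm \<Rightarrow> 'm \<Rightarrow> bool" where
  "short_exact C i p \<longleftrightarrow> is_kernel C p i \<and> is_cokernel C i p"


section \<open>Functors and natural isomorphisms\<close>

text \<open>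
  A functor is given by its two maps only; source and target category are arguments of the
  predicates below. In particular a functor and its corestriction to a full subcategory of
  the target are the same record. Values outside the source category are irrelevant: functors
  are only ever compared up to natural isomorphism.
\<close>

record ('o, 'm, 'p, 'n) fctr =
  obmap :: "'o \<Rightarrow> 'p"
  armap :: "'m \<Rightarrow> 'n"

definition id_fctr :: "('o, 'm, 'o, 'm) fctr" where
  "id_fctr = \<lparr>obmap = id, armap = id\<rparr>"

definition comp_fctr ::
  "('p, 'n, 'q, 'l) fctr \<Rightarrow> ('o, 'm, 'p, 'n) fctr \<Rightarrow> ('o, 'm, 'q, 'l) fctr"  (infixr "\<circ>\<^sub>F" 55) where
  "G \<circ>\<^sub>F F = \<lparr>obmap = obmap G \<circ> obmap F, armap = armap G \<circ> armap F\<rparr>"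

locale exact_functor =
  source: abelian_category A + target: abelian_category B
  for A :: "('o, 'm, 'y) abcat_scheme" and B :: "('p, 'n, 'z) abcat_scheme"
    and F :: "('o, 'm, 'p, 'n) fctr" +
  assumes obmap_Ob: "X \<in> Ob A \<Longrightarrow> obmap F X \<in> Ob B"
    and armap_hom: "f \<in> homset A X Y \<Longrightarrow> armap F f \<in> homset B (obmap F X) (obmap F Y)"
    and armap_Ident: "X \<in> Ob A \<Longrightarrow> armap F (Ident A X) = Ident B (obmap F X)"
    and armap_Comp: "\<lbrakk>f \<in> homset A X Y; g \<in> homset A Y W\<rbrakk>
                      \<Longrightarrow> armap F (g \<bullet>\<^bsub>A\<^esub> f) = armap F g \<bullet>\<^bsub>B\<^esub> armap F f"
    and armap_Add: "\<lbrakk>f \<in> homset A X Y; f' \<in> homset A X Y\<rbrakk>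
                      \<Longrightarrow> armap F (f \<oplus>\<^bsub>A\<^esub> f') = armap F f \<oplus>\<^bsub>B\<^esub> armap F f'"
    and preserves_short_exact: "short_exact A i p \<Longrightarrow> short_exact B (armap F i) (armap F p)"

definition fully_faithful ::
  "('o, 'm, 'y) cat_scheme \<Rightarrow> ('p, 'n, 'z) cat_scheme \<Rightarrow> ('o, 'm, 'p, 'n) fctr \<Rightarrow> bool" where
  "fully_faithful A B F \<longleftrightarrow>
     (\<forall>X \<in> Ob A. \<forall>Y \<in> Ob A. bij_betw (armap F) (homset A X Y) (homset B (obmap F X) (obmap F Y)))"

definition nat_iso ::
  "('o, 'm, 'y) cat_scheme \<Rightarrow> ('p, 'n, 'z) cat_scheme \<Rightarrow>
   ('o, 'm, 'p, 'n) fctr \<Rightarrow> ('o, 'm, 'p, 'n) fctr \<Rightarrow> ('o \<Rightarrow> 'n) \<Rightarrow> bool" where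
  "nat_iso A B F G \<psi> \<longleftrightarrow>
     (\<forall>X \<in> Ob A. \<psi> X \<in> homset B (obmap F X) (obmap G X) \<and> is_isomorphism B (\<psi> X)) \<and>
     (\<forall>f \<in> Arr A. armap G f \<bullet>\<^bsub>B\<^esub> \<psi> (Dom A f) = \<psi> (Cod A f) \<bullet>\<^bsub>B\<^esub> armap F f)"

definition ess_image ::
  "('o, 'm, 'y) cat_scheme \<Rightarrow> ('p, 'n, 'z) cat_scheme \<Rightarrow> ('o, 'm, 'p, 'n) fctr \<Rightarrow> 'p set" where
  "ess_image A B F = {Y \<in> Ob B. \<exists>X \<in> Ob A. isomorphic B Y (obmap F X)}"


section \<open>Extension closure\<close>

text \<open>A strictly full subcategory is represented by its (isomorphism-closed) set of objects.\<close>

definition ext_star :: "('o, 'm, 'z) abcat_scheme \<Rightarrow> 'o set \<Rightarrow> 'o set \<Rightarrow> 'o set" where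
  "ext_star C S T =
     {X \<in> Ob C. \<exists>i p. short_exact C i p \<and> Dom C i \<in> S \<and> Cod C i = X \<and> Cod C p \<in> T}"

primrec ext_pow :: "('o, 'm, 'z) abcat_scheme \<Rightarrow> 'o set \<Rightarrow> nat \<Rightarrow> 'o set" where
  "ext_pow C S 0 = S"
| "ext_pow C S (Suc k) = ext_star C (ext_pow C S k) S"

definition ext_closure :: "('o, 'm, 'z) abcat_scheme \<Rightarrow> 'o set \<Rightarrow> 'o set" where
  "ext_closure C S = (\<Union>k. ext_pow C S k)"

definition extension_generating ::
  "('o, 'm, 'y) abcat_scheme \<Rightarrow> ('p, 'n, 'z) abcat_scheme \<Rightarrow> ('o, 'm, 'p, 'n) fctr \<Rightarrow> bool" where
  "extension_generating A B F \<longleftrightarrow> fully_faithful A B F \<and> ext_closure B (ess_image A B F) = Ob B"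


section \<open>Pairs of a functor and an isomorphism\<close>

text \<open>
  For \<open>Q : A0 \<rightarrow> A\<close> and \<open>P : A0 \<rightarrow> B\<close>, the pairs \<open>(F, \<phi>)\<close> of an exact functor \<open>F : A \<rightarrow> B\<close> and a
  natural isomorphism \<open>\<phi> : F Q \<cong> P\<close>, and the equivalence relation on them. Morphisms
  \<open>(A, Q) \<rightarrow> (B, P)\<close> and deformations of \<open>P\<close> over \<open>(A, Q)\<close> are both instances.
\<close>

definition lifts ::
  "('o0, 'm0) abcat \<Rightarrow> ('o, 'm) abcat \<Rightarrow> ('o0, 'm0, 'o, 'm) fctr \<Rightarrow>
   ('p, 'n) abcat \<Rightarrow> ('o0, 'm0, 'p, 'n) fctr \<Rightarrow> (('o, 'm, 'p, 'n) fctr \<times> ('o0 \<Rightarrow> 'n)) set" where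
  "lifts A0 A Q B P = {(F, \<phi>). exact_functor A B F \<and> nat_iso A0 B (F \<circ>\<^sub>F Q) P \<phi>}"

definition lift_rel ::
  "('o0, 'm0) abcat \<Rightarrow> ('o, 'm) abcat \<Rightarrow> ('o0, 'm0, 'o, 'm) fctr \<Rightarrow>
   ('p, 'n) abcat \<Rightarrow> ('o0, 'm0, 'p, 'n) fctr \<Rightarrow> (('o, 'm, 'p, 'n) fctr \<times> ('o0 \<Rightarrow> 'n)) rel" where
  "lift_rel A0 A Q B P = {((F, \<phi>), (F', \<phi>')).
     (F, \<phi>) \<in> lifts A0 A Q B P \<and> (F', \<phi>') \<in> lifts A0 A Q B P \<and>
     (\<exists>\<psi>. nat_iso A B F F' \<psi> \<and> (\<forall>X \<in> Ob A0. \<phi>' X \<bullet>\<^bsub>B\<^esub> \<psi> (obmap Q X) = \<phi> X))}"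

definition lift_classes ::
  "('o0, 'm0) abcat \<Rightarrow> ('o, 'm) abcat \<Rightarrow> ('o0, 'm0, 'o, 'm) fctr \<Rightarrow>
   ('p, 'n) abcat \<Rightarrow> ('o0, 'm0, 'p, 'n) fctr \<Rightarrow> (('o, 'm, 'p, 'n) fctr \<times> ('o0 \<Rightarrow> 'n)) set set" where
  "lift_classes A0 A Q B P = lifts A0 A Q B P // lift_rel A0 A Q B P"

text \<open>\<open>(T, \<tau>), (F, \<phi>) \<mapsto> (T F, \<tau> \<circ> T \<phi>)\<close>, first on pairs, then on classes.\<close>

definition comp_lift ::
  "('q, 'l) abcat \<Rightarrow> ('p, 'n, 'q, 'l) fctr \<times> ('o0 \<Rightarrow> 'l) \<Rightarrow> ('o, 'm, 'p, 'n) fctr \<times> ('o0 \<Rightarrow> 'n) \<Rightarrow>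
   ('o, 'm, 'q, 'l) fctr \<times> ('o0 \<Rightarrow> 'l)" where
  "comp_lift Z t s = (fst t \<circ>\<^sub>F fst s, \<lambda>X. snd t X \<bullet>\<^bsub>Z\<^esub> armap (fst t) (snd s X))"

definition comp_class ::
  "('o0, 'm0) abcat \<Rightarrow> ('o, 'm) abcat \<Rightarrow> ('o0, 'm0, 'o, 'm) fctr \<Rightarrow>
   ('q, 'l) abcat \<Rightarrow> ('o0, 'm0, 'q, 'l) fctr \<Rightarrow>
   (('p, 'n, 'q, 'l) fctr \<times> ('o0 \<Rightarrow> 'l)) set \<Rightarrow> (('o, 'm, 'p, 'n) fctr \<times> ('o0 \<Rightarrow> 'n)) set \<Rightarrow>
   (('o, 'm, 'q, 'l) fctr \<times> ('o0 \<Rightarrow> 'l)) set" where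
  "comp_class A0 A Q Z P d c = (\<Union>t \<in> d. \<Union>s \<in> c. lift_rel A0 A Q Z P `` {comp_lift Z t s})"


section \<open>Abelian categories extension generated by a fixed one\<close>

text \<open>
  The types \<open>'o\<close> and \<open>'m\<close> play the role of a universe: the objects are categories whose objects and
  arrows form subsets of these types.
\<close>

type_synonym ('o0, 'm0, 'o, 'm) fin_ob = "('o, 'm) abcat \<times> ('o0, 'm0, 'o, 'm) fctr"

type_synonym ('o0, 'm0, 'o, 'm) fin_arr =
  "('o0, 'm0, 'o, 'm) fin_ob \<times> ('o0, 'm0, 'o, 'm) fin_ob \<times>
   (('o, 'm, 'o, 'm) fctr \<times> ('o0 \<Rightarrow> 'm)) set"

definition FinTilde ::
  "('o0, 'm0) abcat \<Rightarrow> (('o0, 'm0, 'o, 'm) fin_ob, ('o0, 'm0, 'o, 'm) fin_arr) cat" where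
  "FinTilde A0 = (let obs = {(A, Q). exact_functor A0 A Q \<and> extension_generating A0 A Q} in
     \<lparr>Ob = obs,
      Arr = {((A, Q), (B, P), c). (A, Q) \<in> obs \<and> (B, P) \<in> obs \<and> c \<in> lift_classes A0 A Q B P},
      Dom = (\<lambda>(a, b, c). a),
      Cod = (\<lambda>(a, b, c). b),
      Ident = (\<lambda>(A, Q). ((A, Q), (A, Q),
                 lift_rel A0 A Q A Q `` {(id_fctr, \<lambda>X. Ident A (obmap Q X))})),
      Comp = (\<lambda>(b', (D, R), d) ((A, Q), b, c). ((A, Q), (D, R), comp_class A0 A Q D R d c))\<rparr>)"

definition Fin ::
  "('o0, 'm0) abcat \<Rightarrow> (('o0, 'm0, 'o, 'm) fin_ob, ('o0, 'm0, 'o, 'm) fin_arr) cat" where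
  "Fin A0 = full_subcat (FinTilde A0) {(A, Q). \<exists>k. ext_pow A (ess_image A0 A Q) k = Ob A}"


section \<open>Set-valued presheaves and ind-representability\<close>

record ('o, 'm, 'x) psh =
  psh_ob :: "'o \<Rightarrow> 'x set"
  psh_ar :: "'m \<Rightarrow> 'x \<Rightarrow> 'x"

locale presheaf = category C
  for C :: "('o, 'm, 'z) cat_scheme" (structure) and G :: "('o, 'm, 'x) psh" +
  assumes psh_ar_closed: "\<lbrakk>f \<in> homset C X Y; x \<in> psh_ob G Y\<rbrakk> \<Longrightarrow> psh_ar G f x \<in> psh_ob G X"
    and psh_ar_Ident: "\<lbrakk>X \<in> Ob C; x \<in> psh_ob G X\<rbrakk> \<Longrightarrow> psh_ar G (Ident C X) x = x"
    and psh_ar_Comp: "\<lbrakk>f \<in> homset C X Y; g \<in> homset C Y W; x \<in> psh_ob G W\<rbrakk>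
                      \<Longrightarrow> psh_ar G (g \<bullet> f) x = psh_ar G f (psh_ar G g x)"

definition presheaves_isomorphic ::
  "('o, 'm, 'z) cat_scheme \<Rightarrow> ('o, 'm, 'x) psh \<Rightarrow> ('o, 'm, 'y) psh \<Rightarrow> bool" where
  "presheaves_isomorphic C G H \<longleftrightarrow> (\<exists>\<eta>.
     (\<forall>X \<in> Ob C. bij_betw (\<eta> X) (psh_ob G X) (psh_ob H X)) \<and>
     (\<forall>f \<in> Arr C. \<forall>x \<in> psh_ob G (Cod C f).
        \<eta> (Dom C f) (psh_ar G f x) = psh_ar H f (\<eta> (Cod C f) x)))"

definition hom_psh :: "('o, 'm, 'z) cat_scheme \<Rightarrow> 'o \<Rightarrow> ('o, 'm, 'm) psh" where
  "hom_psh C X = \<lparr>psh_ob = (\<lambda>W. homset C W X), psh_ar = (\<lambda>f g. g \<bullet>\<^bsub>C\<^esub> f)\<rparr>"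

definition ind_represents ::
  "('o0, 'm0) abcat \<Rightarrow> ('o0, 'm0, 'o, 'm) fin_ob \<Rightarrow>
   (('o0, 'm0, 'o, 'm) fin_ob, ('o0, 'm0, 'o, 'm) fin_arr, 'x) psh \<Rightarrow> bool" where
  "ind_represents A0 E G \<longleftrightarrow> E \<in> Ob (FinTilde A0) \<and> presheaf (Fin A0) G \<and>
     presheaves_isomorphic (Fin A0) G (hom_psh (FinTilde A0) E)"

definition ncDef ::
  "('o0, 'm0) abcat \<Rightarrow> ('p, 'n) abcat \<Rightarrow> ('o0, 'm0, 'p, 'n) fctr \<Rightarrow>
   (('o0, 'm0, 'o, 'm) fin_ob, ('o0, 'm0, 'o, 'm) fin_arr,
    (('o, 'm, 'p, 'n) fctr \<times> ('o0 \<Rightarrow> 'n)) set) psh" where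
  "ncDef A0 Z \<zeta> =
     \<lparr>psh_ob = (\<lambda>(A, Q). lift_classes A0 A Q Z \<zeta>),
      psh_ar = (\<lambda>((A, Q), b, c) d. comp_class A0 A Q Z \<zeta> d c)\<rparr>"

end

theory Submission
  imports Defs
begin

text \<open>
  Write \<open>S\<close> for the essential image of \<open>\<zeta>\<close> and \<open>E\<close> for its extension closure in \<open>Z\<close>. There are two
  things to see.

  First, \<open>E\<close> is an abelian category with exact inclusion into \<open>Z\<close>. It is closed under extensions
  because \<open>S \<star> (T \<star> U) \<subseteq> (S \<star> T) \<star> U\<close> (\<open>ext_star_assoc_subset\<close>), and it remains to see that kernels
  and cokernels, formed in \<open>Z\<close>, of arrows of \<open>E\<close> stay in \<open>E\<close> (\<open>ext_closure_ker_coker\<close>). For arrows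
  between objects of \<open>S\<close> this holds, images included, since \<open>\<zeta>\<close> is full and exact. In general one
  inducts on the number of extension steps of the target and then on that of the source. If \<open>Y\<close> is an
  extension of \<open>Y'' \<in> S\<close> by \<open>Y'\<close> and the source of \<open>f : X \<rightarrow> Y\<close> is in \<open>S\<close>, then \<open>X \<rightarrow> Y''\<close> has kernel
  \<open>K\<close> and cokernel in \<open>S\<close>; the kernel of \<open>f\<close> is that of the induced arrow \<open>K \<rightarrow> Y'\<close>, and the cokernel
  of \<open>f\<close> is an extension of the cokernel of \<open>X \<rightarrow> Y''\<close> by that of \<open>K \<rightarrow> Y'\<close>
  (\<open>ker_coker_into_extension\<close>). The source is treated similarly (\<open>ker_coker_from_extension\<close>). Both
  are instances of the snake lemma; diagrams are chased with generalized elements, for which epimorphisms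
  must be stable under base change (\<open>lift_along_epi\<close>). As short exact sequences in \<open>E\<close> are those
  of \<open>Z\<close>, the functor \<open>\<zeta>\<close> into \<open>E\<close> is exact, and each object of \<open>E\<close> is built by extensions inside \<open>E\<close>.

  Second, let \<open>(A, Q)\<close> be extension generating and \<open>T : A \<rightarrow> Z\<close> exact with \<open>T Q \<cong> \<zeta>\<close>. Exact functors
  preserve extensions and every object of \<open>A\<close> is an iterated extension of objects isomorphic to some
  \<open>Q X\<close>, so \<open>T\<close> takes values in \<open>E\<close> (\<open>lift_image_in_ext_closure\<close>). A functor is encoded without its
  target, so a deformation of \<open>\<zeta>\<close> over \<open>(A, Q)\<close> and a morphism \<open>(A, Q) \<rightarrow> (E, \<zeta>)\<close> are the same
  equivalence class of pairs, with the same composition. The natural bijection is therefore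
  the identity on classes. What remains is that composition of classes is well defined,
  associative and unital, which makes \<open>FinTilde\<close> a category and \<open>ncDef\<close> a presheaf.
\<close>


section \<open>Arrow calculus in preadditive categories\<close>

context category
begin

lemma homset_iff: "f \<in> homset C X Y \<longleftrightarrow> f \<in> Arr C \<and> Dom C f = X \<and> Cod C f = Y"
  by (simp add: homset_def)

lemma comp_arr [simp]:
  assumes "f \<in> Arr C" "g \<in> Arr C" "Dom C g = Cod C f"
  shows "g \<bullet> f \<in> Arr C" "Dom C (g \<bullet> f) = Dom C f" "Cod C (g \<bullet> f) = Cod C g"
  using Comp_hom[of f "Dom C f" "Cod C f" g "Cod C g"] assms by (auto simp: homset_iff)

lemma comp_assoc [simp]:
  assumes "f \<in> Arr C" "g \<in> Arr C" "h \<in> Arr C" "Dom C g = Cod C f" "Dom C h = Cod C g"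
  shows "(h \<bullet> g) \<bullet> f = h \<bullet> (g \<bullet> f)"
  using Comp_assoc[of f "Dom C f" "Cod C f" g "Cod C g" h "Cod C h"] assms
  by (auto simp: homset_iff)

lemma Dom_Cod_Ob [simp]: "f \<in> Arr C \<Longrightarrow> Dom C f \<in> Ob C" "f \<in> Arr C \<Longrightarrow> Cod C f \<in> Ob C"
  by (auto simp: Dom_Ob Cod_Ob)

lemma id_arr [simp]:
  assumes "X \<in> Ob C"
  shows "Ident C X \<in> Arr C" "Dom C (Ident C X) = X" "Cod C (Ident C X) = X"
  using Ident_hom[OF assms] by (auto simp: homset_iff)

lemma comp_id [simp]:
  assumes "f \<in> Arr C"
  shows "Dom C f = X \<Longrightarrow> f \<bullet> Ident C X = f" "Cod C f = Y \<Longrightarrow> Ident C Y \<bullet> f = f"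
  using Comp_Ident[of f X "Cod C f"] Ident_Comp[of f "Dom C f" Y] assms
  by (auto simp: homset_iff)

text \<open>
  Simplification normalizes composites to the right, which hides the two sides of a commutative square
  inside a longer composite; this rule lets a square be used there.
\<close>

lemma comp_cong_left:
  assumes "a \<bullet> b = c \<bullet> d"
    and "a \<in> Arr C" "b \<in> Arr C" "c \<in> Arr C" "d \<in> Arr C" "u \<in> Arr C"
    and "Dom C a = Cod C b" "Dom C c = Cod C d" "Dom C b = Cod C u" "Dom C d = Cod C u"
  shows "a \<bullet> (b \<bullet> u) = c \<bullet> (d \<bullet> u)"
  using comp_assoc[of u b a] comp_assoc[of u d c] assms by simp

lemma mono_arr: "is_mono C f \<Longrightarrow> f \<in> Arr C"
  and epi_arr: "is_epi C f \<Longrightarrow> f \<in> Arr C"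
  by (auto simp: is_mono_def is_epi_def)

lemma mono_cancel:
  assumes "is_mono C f" "f \<bullet> g = f \<bullet> h"
    and "g \<in> Arr C" "h \<in> Arr C" "Cod C g = Dom C f" "Cod C h = Dom C f" "Dom C g = Dom C h"
  shows "g = h"
  using assms by (auto simp: is_mono_def homset_iff)

lemma epi_cancel:
  assumes "is_epi C f" "g \<bullet> f = h \<bullet> f"
    and "g \<in> Arr C" "h \<in> Arr C" "Dom C g = Cod C f" "Dom C h = Cod C f" "Cod C g = Cod C h"
  shows "g = h"
  using assms by (auto simp: is_epi_def homset_iff)

lemma mono_comp:
  assumes "is_mono C f" "is_mono C g" "Dom C g = Cod C f"
  shows "is_mono C (g \<bullet> f)"
proof -
  have a: "f \<in> Arr C" "g \<in> Arr C" using assms mono_arr by auto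
  show ?thesis unfolding is_mono_def
  proof (intro conjI allI ballI impI)
    fix W u v
    assume u: "u \<in> homset C W (Dom C (g \<bullet> f))" and v: "v \<in> homset C W (Dom C (g \<bullet> f))"
      and e: "(g \<bullet> f) \<bullet> u = (g \<bullet> f) \<bullet> v"
    have "f \<bullet> u = f \<bullet> v"
      by (rule mono_cancel[OF assms(2)]) (use e a u v assms in \<open>auto simp: homset_iff\<close>)
    then show "u = v"
      using mono_cancel[OF assms(1), of u v] a u v assms by (auto simp: homset_iff)
  qed (use a assms in auto)
qed

lemma epi_comp:
  assumes "is_epi C f" "is_epi C g" "Dom C g = Cod C f"
  shows "is_epi C (g \<bullet> f)"
proof -
  have a: "f \<in> Arr C" "g \<in> Arr C" using assms epi_arr by auto
  show ?thesis unfolding is_epi_def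
  proof (intro conjI allI ballI impI)
    fix W u v
    assume u: "u \<in> homset C (Cod C (g \<bullet> f)) W" and v: "v \<in> homset C (Cod C (g \<bullet> f)) W"
      and e: "u \<bullet> (g \<bullet> f) = v \<bullet> (g \<bullet> f)"
    have "u \<bullet> g = v \<bullet> g"
      by (rule epi_cancel[OF assms(1)]) (use e a u v assms in \<open>auto simp: homset_iff\<close>)
    then show "u = v"
      using epi_cancel[OF assms(2), of u v] a u v assms by (auto simp: homset_iff)
  qed (use a assms in auto)
qed

lemma epi_cancel_left:
  assumes "is_epi C (g \<bullet> f)" "f \<in> Arr C" "g \<in> Arr C" "Dom C g = Cod C f"
  shows "is_epi C g"
  unfolding is_epi_def
proof (intro conjI allI ballI impI)
  fix W u v
  assume u: "u \<in> homset C (Cod C g) W" and v: "v \<in> homset C (Cod C g) W"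
    and e: "u \<bullet> g = v \<bullet> g"
  have "u \<bullet> (g \<bullet> f) = v \<bullet> (g \<bullet> f)"
    by (rule comp_cong_left[OF e]) (use u v assms in \<open>auto simp: homset_iff\<close>)
  then show "u = v"
    using epi_cancel[OF assms(1), of u v] u v assms by (auto simp: homset_iff)
qed (use assms in auto)

lemma iso_inverse:
  assumes "is_isomorphism C f"
  obtains g where "g \<in> Arr C" "Dom C g = Cod C f" "Cod C g = Dom C f"
    "g \<bullet> f = Ident C (Dom C f)" "f \<bullet> g = Ident C (Cod C f)" "is_isomorphism C g"
proof -
  obtain g where "f \<in> Arr C" "g \<in> homset C (Cod C f) (Dom C f)"
    "g \<bullet> f = Ident C (Dom C f)" "f \<bullet> g = Ident C (Cod C f)"
    using assms unfolding is_isomorphism_def by blast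
  moreover from this have "is_isomorphism C g"
    unfolding is_isomorphism_def by (intro conjI bexI[of _ f]) (auto simp: homset_iff)
  ultimately show thesis using that[of g] by (simp add: homset_iff)
qed

lemma iso_arr: "is_isomorphism C f \<Longrightarrow> f \<in> Arr C"
  by (simp add: is_isomorphism_def)

lemma iso_Ident: "X \<in> Ob C \<Longrightarrow> is_isomorphism C (Ident C X)"
  unfolding is_isomorphism_def using Ident_hom[of X] by (intro conjI bexI[of _ "Ident C X"]) auto

lemma iso_comp:
  assumes "is_isomorphism C f" "is_isomorphism C g" "Dom C g = Cod C f"
  shows "is_isomorphism C (g \<bullet> f)"
proof -
  obtain f' where f': "f' \<in> Arr C" "Dom C f' = Cod C f" "Cod C f' = Dom C f"
    "f' \<bullet> f = Ident C (Dom C f)" "f \<bullet> f' = Ident C (Cod C f)"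
    by (rule iso_inverse[OF assms(1)]) blast
  obtain g' where g': "g' \<in> Arr C" "Dom C g' = Cod C g" "Cod C g' = Dom C g"
    "g' \<bullet> g = Ident C (Dom C g)" "g \<bullet> g' = Ident C (Cod C g)"
    by (rule iso_inverse[OF assms(2)]) blast
  have a: "f \<in> Arr C" "g \<in> Arr C" using assms iso_arr by auto
  have "(f' \<bullet> g') \<bullet> (g \<bullet> f) = f' \<bullet> ((g' \<bullet> g) \<bullet> f)"
    using a f'(1-3) g'(1-3) assms(3) by simp
  moreover have "(g \<bullet> f) \<bullet> (f' \<bullet> g') = g \<bullet> ((f \<bullet> f') \<bullet> g')"
    using a f'(1-3) g'(1-3) assms(3) by simp
  ultimately show ?thesis
    unfolding is_isomorphism_def
    using a f' g' assms(3) by (intro conjI bexI[of _ "f' \<bullet> g'"]) (auto simp: homset_iff)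
qed

lemma iso_mono: 
  assumes "is_isomorphism C f" shows "is_mono C f"
proof -
  obtain f' where f': "f' \<in> Arr C" "Dom C f' = Cod C f" "Cod C f' = Dom C f"
    "f' \<bullet> f = Ident C (Dom C f)"
    by (rule iso_inverse[OF assms(1)]) blast
  have f: "f \<in> Arr C" using assms iso_arr by auto
  have r: "g = f' \<bullet> (f \<bullet> g)" if "g \<in> Arr C" "Cod C g = Dom C f" for g
    using comp_assoc[of g f f'] that f f' by simp
  have "g = h" if "g \<in> homset C W (Dom C f)" "h \<in> homset C W (Dom C f)" "f \<bullet> g = f \<bullet> h" for g h W
    using r[of g] r[of h] that by (simp add: homset_iff)
  then show ?thesis unfolding is_mono_def using f by blast
qed

lemma isomorphic_iff:
  "isomorphic C X Y \<longleftrightarrow> (\<exists>f. is_isomorphism C f \<and> Dom C f = X \<and> Cod C f = Y)"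
  by (auto simp: isomorphic_def homset_iff iso_arr)

lemma isomorphic_refl: "X \<in> Ob C \<Longrightarrow> isomorphic C X X"
  unfolding isomorphic_iff by (intro exI[of _ "Ident C X"]) (simp add: iso_Ident)

lemma isomorphic_trans: "isomorphic C X Y \<Longrightarrow> isomorphic C Y W \<Longrightarrow> isomorphic C X W"
  unfolding isomorphic_iff
proof (elim exE conjE)
  fix f g assume "is_isomorphism C f" "Dom C f = X" "Cod C f = Y" "is_isomorphism C g"
    "Dom C g = Y" "Cod C g = W"
  then show "\<exists>h. is_isomorphism C h \<and> Dom C h = X \<and> Cod C h = W"
    by (intro exI[of _ "g \<bullet> f"]) (simp add: iso_comp iso_arr)
qed

end

context preadditive_category
begin

lemma Zero_arr [simp]:
  assumes "X \<in> Ob C" "Y \<in> Ob C"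
  shows "Zero C X Y \<in> Arr C" "Dom C (Zero C X Y) = X" "Cod C (Zero C X Y) = Y"
proof -
  interpret G: comm_group "hom_group C X Y" using hom_comm_group assms .
  show "Zero C X Y \<in> Arr C" "Dom C (Zero C X Y) = X" "Cod C (Zero C X Y) = Y"
    using G.one_closed by (auto simp: hom_group_def homset_iff)
qed

lemma Add_arr [simp]:
  assumes "f \<in> Arr C" "g \<in> Arr C" "Dom C f = Dom C g" "Cod C f = Cod C g"
  shows "f \<oplus> g \<in> Arr C" "Dom C (f \<oplus> g) = Dom C g" "Cod C (f \<oplus> g) = Cod C g"
proof -
  interpret G: comm_group "hom_group C (Dom C g) (Cod C g)" using hom_comm_group assms by simp
  show "f \<oplus> g \<in> Arr C" "Dom C (f \<oplus> g) = Dom C g" "Cod C (f \<oplus> g) = Cod C g"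
    using G.m_closed[of f g] assms by (auto simp: hom_group_def homset_iff)
qed

lemma Add_Zero [simp]:
  assumes "f \<in> Arr C" "Dom C f = X" "Cod C f = Y"
  shows "f \<oplus> Zero C X Y = f" "Zero C X Y \<oplus> f = f"
proof -
  interpret G: comm_group "hom_group C X Y" using hom_comm_group assms by auto
  show "f \<oplus> Zero C X Y = f" "Zero C X Y \<oplus> f = f"
    using G.r_one[of f] G.l_one[of f] assms by (auto simp: hom_group_def homset_iff)
qed

lemma Add_right_cancel:
  assumes "f \<oplus> h = g \<oplus> h"
    and "f \<in> Arr C" "g \<in> Arr C" "h \<in> Arr C" "Dom C f = Dom C h" "Cod C f = Cod C h"
      "Dom C g = Dom C h" "Cod C g = Cod C h"
  shows "f = g"
proof -
  interpret G: comm_group "hom_group C (Dom C h) (Cod C h)" using hom_comm_group assms by auto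
  show ?thesis
    using G.right_cancel[of h f g] assms by (auto simp: hom_group_def homset_iff)
qed

lemma Add_assoc:
  assumes "f \<in> Arr C" "g \<in> Arr C" "h \<in> Arr C" "Dom C f = Dom C h" "Cod C f = Cod C h"
      "Dom C g = Dom C h" "Cod C g = Cod C h"
  shows "(f \<oplus> g) \<oplus> h = f \<oplus> (g \<oplus> h)"
proof -
  interpret G: comm_group "hom_group C (Dom C h) (Cod C h)" using hom_comm_group assms by auto
  show ?thesis
    using G.m_assoc[of f g h] assms by (auto simp: hom_group_def homset_iff)
qed

lemma Add_eq_right_imp_Zero:
  assumes "f \<oplus> h = h" "f \<in> Arr C" "h \<in> Arr C" "Dom C f = Dom C h" "Cod C f = Cod C h"
  shows "f = Zero C (Dom C h) (Cod C h)"
  by (rule Add_right_cancel[where h = h]) (use assms in auto)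

text \<open>
  Subtraction of parallel arrows. A chase writes \<open>g = d + h\<close> and reads off what kills \<open>d\<close>.
\<close>

lemma difference:
  assumes "g \<in> Arr C" "h \<in> Arr C" "Dom C g = Dom C h" "Cod C g = Cod C h"
  obtains d where "d \<in> Arr C" "Dom C d = Dom C h" "Cod C d = Cod C h" "g = d \<oplus> h"
proof -
  interpret G: comm_group "hom_group C (Dom C h) (Cod C h)" using hom_comm_group assms by auto
  let ?n = "inv\<^bsub>hom_group C (Dom C h) (Cod C h)\<^esub> h"
  have c: "h \<in> carrier (hom_group C (Dom C h) (Cod C h))"
    "g \<in> carrier (hom_group C (Dom C h) (Cod C h))"
    using assms by (auto simp: hom_group_def homset_iff)
  have n: "?n \<in> Arr C" "Dom C ?n = Dom C h" "Cod C ?n = Cod C h"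
    using G.inv_closed[OF c(1)] by (auto simp: hom_group_def homset_iff)
  have "(g \<oplus> ?n) \<oplus> h = g"
    using G.m_assoc[OF c(2) G.inv_closed[OF c(1)] c(1)] G.l_inv[OF c(1)] assms
    by (simp add: hom_group_def)
  then show thesis using that[of "g \<oplus> ?n"] n assms by simp
qed

lemma comp_Add_distrib [simp]:
  assumes "f \<in> Arr C" "f' \<in> Arr C" "Dom C f = Dom C f'" "Cod C f = Cod C f'"
  shows "\<lbrakk>g \<in> Arr C; Dom C g = Cod C f'\<rbrakk> \<Longrightarrow> g \<bullet> (f \<oplus> f') = (g \<bullet> f) \<oplus> (g \<bullet> f')"
    and "\<lbrakk>g \<in> Arr C; Cod C g = Dom C f'\<rbrakk> \<Longrightarrow> (f \<oplus> f') \<bullet> g = (f \<bullet> g) \<oplus> (f' \<bullet> g)"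
  using Comp_Add[of f _ _ f' g] Add_Comp[of g "Dom C g" "Dom C f'" f "Cod C f'" f'] assms
  by (auto simp: homset_iff)

lemma comp_Zero [simp]:
  assumes "f \<in> Arr C"
  shows "\<lbrakk>X \<in> Ob C; Dom C f = Y\<rbrakk> \<Longrightarrow> f \<bullet> Zero C X Y = Zero C X (Cod C f)"
    and "\<lbrakk>W \<in> Ob C; Cod C f = Y\<rbrakk> \<Longrightarrow> Zero C Y W \<bullet> f = Zero C (Dom C f) W"
proof -
  show "f \<bullet> Zero C X Y = Zero C X (Cod C f)" if X: "X \<in> Ob C" "Dom C f = Y"
  proof -
    have Y: "Y \<in> Ob C" using assms that by auto
    have "(f \<bullet> Zero C X Y) \<oplus> (f \<bullet> Zero C X Y) = f \<bullet> Zero C X Y"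
      using comp_Add_distrib(1)[of "Zero C X Y" "Zero C X Y" f] assms X Y by simp
    then show ?thesis
      using Add_eq_right_imp_Zero[of "f \<bullet> Zero C X Y" "f \<bullet> Zero C X Y"] assms X Y by simp
  qed
  show "Zero C Y W \<bullet> f = Zero C (Dom C f) W" if X: "W \<in> Ob C" "Cod C f = Y"
  proof -
    have Y: "Y \<in> Ob C" using assms that by auto
    have "(Zero C Y W \<bullet> f) \<oplus> (Zero C Y W \<bullet> f) = Zero C Y W \<bullet> f"
      using comp_Add_distrib(2)[of "Zero C Y W" "Zero C Y W" f] assms X Y by simp
    then show ?thesis
      using Add_eq_right_imp_Zero[of "Zero C Y W \<bullet> f" "Zero C Y W \<bullet> f"] assms X Y by simp
  qed
qed

lemma mono_zeroI:
  assumes "f \<in> Arr C"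
    and "\<And>g. \<lbrakk>g \<in> Arr C; Cod C g = Dom C f; f \<bullet> g = Zero C (Dom C g) (Cod C f)\<rbrakk>
           \<Longrightarrow> g = Zero C (Dom C g) (Dom C f)"
  shows "is_mono C f"
  unfolding is_mono_def
proof (intro conjI allI ballI impI)
  fix W g h
  assume gh: "g \<in> homset C W (Dom C f)" "h \<in> homset C W (Dom C f)" and e: "f \<bullet> g = f \<bullet> h"
  obtain d where d: "d \<in> Arr C" "Dom C d = Dom C h" "Cod C d = Cod C h" "g = d \<oplus> h"
    using difference[of g h] gh by (auto simp: homset_iff)
  have "f \<bullet> d = Zero C (Dom C d) (Cod C f)"
    using Add_eq_right_imp_Zero[of "f \<bullet> d" "f \<bullet> h"] e d gh assms(1) by (auto simp: homset_iff)
  then have "d = Zero C (Dom C d) (Dom C f)" using assms(2)[of d] d gh by (auto simp: homset_iff)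
  then show "g = h" using d gh Add_Zero(2)[of h W "Dom C f"] by (auto simp: homset_iff)
qed (fact assms)

lemma epi_zeroI:
  assumes "f \<in> Arr C"
    and "\<And>g. \<lbrakk>g \<in> Arr C; Dom C g = Cod C f; g \<bullet> f = Zero C (Dom C f) (Cod C g)\<rbrakk>
           \<Longrightarrow> g = Zero C (Cod C f) (Cod C g)"
  shows "is_epi C f"
  unfolding is_epi_def
proof (intro conjI allI ballI impI)
  fix W g h
  assume gh: "g \<in> homset C (Cod C f) W" "h \<in> homset C (Cod C f) W" and e: "g \<bullet> f = h \<bullet> f"
  obtain d where d: "d \<in> Arr C" "Dom C d = Dom C h" "Cod C d = Cod C h" "g = d \<oplus> h"
    using difference[of g h] gh by (auto simp: homset_iff)
  have "d \<bullet> f = Zero C (Dom C f) (Cod C d)"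
    using Add_eq_right_imp_Zero[of "d \<bullet> f" "h \<bullet> f"] e d gh assms(1) by (auto simp: homset_iff)
  then have "d = Zero C (Cod C f) (Cod C d)" using assms(2)[of d] d gh by (auto simp: homset_iff)
  then show "g = h" using d gh Add_Zero(2)[of h "Cod C f" W] by (auto simp: homset_iff)
qed (fact assms)

lemma mono_zeroD:
  assumes "is_mono C f" "g \<in> Arr C" "Cod C g = Dom C f" "f \<bullet> g = Zero C (Dom C g) (Cod C f)"
  shows "g = Zero C (Dom C g) (Dom C f)"
  by (rule mono_cancel[OF assms(1)]) (use assms mono_arr[OF assms(1)] in auto)

lemma epi_zeroD:
  assumes "is_epi C f" "g \<in> Arr C" "Dom C g = Cod C f" "g \<bullet> f = Zero C (Dom C f) (Cod C g)"
  shows "g = Zero C (Cod C f) (Cod C g)"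
  by (rule epi_cancel[OF assms(1)]) (use assms epi_arr[OF assms(1)] in auto)

lemma kernel_arr:
  assumes "is_kernel C f k"
  shows "f \<in> Arr C" "k \<in> Arr C" "Cod C k = Dom C f" "f \<bullet> k = Zero C (Dom C k) (Cod C f)"
  using assms by (auto simp: is_kernel_def)

lemma cokernel_arr:
  assumes "is_cokernel C f q"
  shows "f \<in> Arr C" "q \<in> Arr C" "Dom C q = Cod C f" "q \<bullet> f = Zero C (Dom C f) (Cod C q)"
  using assms by (auto simp: is_cokernel_def)

lemma kernel_factor:
  assumes "is_kernel C f k" "h \<in> Arr C" "Cod C h = Dom C f" "f \<bullet> h = Zero C (Dom C h) (Cod C f)"
  obtains u where "u \<in> Arr C" "Dom C u = Dom C h" "Cod C u = Dom C k" "k \<bullet> u = h"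
proof -
  have "h \<in> homset C (Dom C h) (Dom C f)" using assms by (simp add: homset_iff)
  then have "\<exists>u. u \<in> homset C (Dom C h) (Dom C k) \<and> k \<bullet> u = h"
    using assms unfolding is_kernel_def by blast
  then show thesis using that by (auto simp: homset_iff)
qed

lemma cokernel_factor:
  assumes "is_cokernel C f q" "h \<in> Arr C" "Dom C h = Cod C f" "h \<bullet> f = Zero C (Dom C f) (Cod C h)"
  obtains u where "u \<in> Arr C" "Dom C u = Cod C q" "Cod C u = Cod C h" "u \<bullet> q = h"
proof -
  have "h \<in> homset C (Cod C f) (Cod C h)" using assms by (simp add: homset_iff)
  then have "\<exists>u. u \<in> homset C (Cod C q) (Cod C h) \<and> u \<bullet> q = h"
    using assms unfolding is_cokernel_def by blast
  then show thesis using that by (auto simp: homset_iff)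
qed

lemma kernel_mono:
  assumes "is_kernel C f k" shows "is_mono C k"
proof (rule mono_zeroI)
  note k = kernel_arr[OF assms]
  show "k \<in> Arr C" by (fact k)
  fix g assume g: "g \<in> Arr C" "Cod C g = Dom C k" "k \<bullet> g = Zero C (Dom C g) (Cod C k)"
  have z: "Zero C (Dom C g) (Dom C f) \<in> homset C (Dom C g) (Dom C f)"
    "f \<bullet> Zero C (Dom C g) (Dom C f) = Zero C (Dom C g) (Cod C f)"
    using k g by (auto simp: homset_iff)
  then have "\<exists>!u. u \<in> homset C (Dom C g) (Dom C k) \<and> k \<bullet> u = Zero C (Dom C g) (Dom C f)"
    using assms unfolding is_kernel_def by blast
  moreover have "g \<in> homset C (Dom C g) (Dom C k)" "k \<bullet> g = Zero C (Dom C g) (Dom C f)"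
    "Zero C (Dom C g) (Dom C k) \<in> homset C (Dom C g) (Dom C k)"
    "k \<bullet> Zero C (Dom C g) (Dom C k) = Zero C (Dom C g) (Dom C f)"
    using k g by (auto simp: homset_iff)
  ultimately show "g = Zero C (Dom C g) (Dom C k)" by blast
qed

lemma cokernel_epi:
  assumes "is_cokernel C f q" shows "is_epi C q"
proof (rule epi_zeroI)
  note k = cokernel_arr[OF assms]
  show "q \<in> Arr C" by (fact k)
  fix g assume g: "g \<in> Arr C" "Dom C g = Cod C q" "g \<bullet> q = Zero C (Dom C q) (Cod C g)"
  have z: "Zero C (Cod C f) (Cod C g) \<in> homset C (Cod C f) (Cod C g)"
    "Zero C (Cod C f) (Cod C g) \<bullet> f = Zero C (Dom C f) (Cod C g)"
    using k g by (auto simp: homset_iff)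
  then have "\<exists>!u. u \<in> homset C (Cod C q) (Cod C g) \<and> u \<bullet> q = Zero C (Cod C f) (Cod C g)"
    using assms unfolding is_cokernel_def by blast
  moreover have "g \<in> homset C (Cod C q) (Cod C g)" "g \<bullet> q = Zero C (Cod C f) (Cod C g)"
    "Zero C (Cod C q) (Cod C g) \<in> homset C (Cod C q) (Cod C g)"
    "Zero C (Cod C q) (Cod C g) \<bullet> q = Zero C (Cod C f) (Cod C g)"
    using k g by (auto simp: homset_iff)
  ultimately show "g = Zero C (Cod C q) (Cod C g)" by blast
qed

lemma kernelI:
  assumes "is_mono C k" "f \<in> Arr C" "Cod C k = Dom C f" "f \<bullet> k = Zero C (Dom C k) (Cod C f)"
    and "\<And>h. \<lbrakk>h \<in> Arr C; Cod C h = Dom C f; f \<bullet> h = Zero C (Dom C h) (Cod C f)\<rbrakk>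
           \<Longrightarrow> \<exists>u. u \<in> Arr C \<and> Dom C u = Dom C h \<and> Cod C u = Dom C k \<and> k \<bullet> u = h"
  shows "is_kernel C f k"
  unfolding is_kernel_def
proof (intro conjI allI ballI impI)
  fix W h assume h: "h \<in> homset C W (Dom C f)" "f \<bullet> h = Zero C W (Cod C f)"
  then obtain u where u: "u \<in> Arr C" "Dom C u = W" "Cod C u = Dom C k" "k \<bullet> u = h"
    using assms(5)[of h] by (auto simp: homset_iff)
  show "\<exists>!u. u \<in> homset C W (Dom C k) \<and> k \<bullet> u = h"
  proof (rule ex1I[of _ u])
    fix v assume v: "v \<in> homset C W (Dom C k) \<and> k \<bullet> v = h"
    show "v = u" by (rule mono_cancel[OF assms(1)]) (use u v in \<open>auto simp: homset_iff\<close>)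
  qed (use u in \<open>auto simp: homset_iff\<close>)
qed (use assms mono_arr in auto)

lemma cokernelI:
  assumes "is_epi C q" "f \<in> Arr C" "Dom C q = Cod C f" "q \<bullet> f = Zero C (Dom C f) (Cod C q)"
    and "\<And>h. \<lbrakk>h \<in> Arr C; Dom C h = Cod C f; h \<bullet> f = Zero C (Dom C f) (Cod C h)\<rbrakk>
           \<Longrightarrow> \<exists>u. u \<in> Arr C \<and> Dom C u = Cod C q \<and> Cod C u = Cod C h \<and> u \<bullet> q = h"
  shows "is_cokernel C f q"
  unfolding is_cokernel_def
proof (intro conjI allI ballI impI)
  fix W h assume h: "h \<in> homset C (Cod C f) W" "h \<bullet> f = Zero C (Dom C f) W"
  then obtain u where u: "u \<in> Arr C" "Dom C u = Cod C q" "Cod C u = W" "u \<bullet> q = h"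
    using assms(5)[of h] by (auto simp: homset_iff)
  show "\<exists>!u. u \<in> homset C (Cod C q) W \<and> u \<bullet> q = h"
  proof (rule ex1I[of _ u])
    fix v assume v: "v \<in> homset C (Cod C q) W \<and> v \<bullet> q = h"
    show "v = u" by (rule epi_cancel[OF assms(1)]) (use u v in \<open>auto simp: homset_iff\<close>)
  qed (use u in \<open>auto simp: homset_iff\<close>)
qed (use assms epi_arr in auto)

lemma short_exact_arr:
  assumes "short_exact C i p"
  shows "i \<in> Arr C" "p \<in> Arr C" "Cod C i = Dom C p" "p \<bullet> i = Zero C (Dom C i) (Cod C p)"
  using assms kernel_arr unfolding short_exact_def by blast+

end

section \<open>Images and lifting in abelian categories\<close>

context abelian_category
begin

text \<open>
  An epimorphism is normal, say \<open>p\<close> is a cokernel of \<open>g\<close>. Then \<open>g\<close> factors through the kernel \<open>i\<close> of \<open>p\<close>,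
  so whatever kills \<open>i\<close> kills \<open>g\<close> and factors through \<open>p\<close>.
\<close>

lemma epi_kernel_short_exact:
  assumes "is_kernel C p i" "is_epi C p"
  shows "short_exact C i p"
proof -
  note k = kernel_arr[OF assms(1)]
  obtain g where g: "is_cokernel C g p" using epi_normal[OF assms(2)] ..
  note g' = cokernel_arr[OF g]
  obtain u where u: "u \<in> Arr C" "Dom C u = Dom C g" "Cod C u = Dom C i" "i \<bullet> u = g"
    by (rule kernel_factor[OF assms(1), of g]) (use g' in auto)
  have "is_cokernel C i p"
  proof (rule cokernelI[OF assms(2)])
    fix h assume h: "h \<in> Arr C" "Dom C h = Cod C i" "h \<bullet> i = Zero C (Dom C i) (Cod C h)"
    have "h \<bullet> g = (h \<bullet> i) \<bullet> u" unfolding u(4)[symmetric] using h(1,2) u(1-3) k by simp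
    also have "\<dots> = Zero C (Dom C g) (Cod C h)" unfolding h(3) using h(1) u k by simp
    finally show "\<exists>u. u \<in> Arr C \<and> Dom C u = Cod C p \<and> Cod C u = Cod C h \<and> u \<bullet> p = h"
      using cokernel_factor[OF g, of h] h g' k by metis
  qed (use k in auto)
  then show ?thesis using assms by (simp add: short_exact_def)
qed

lemma mono_cokernel_short_exact:
  assumes "is_cokernel C i p" "is_mono C i"
  shows "short_exact C i p"
proof -
  note k = cokernel_arr[OF assms(1)]
  obtain g where g: "is_kernel C g i" using mono_normal[OF assms(2)] ..
  note g' = kernel_arr[OF g]
  obtain u where u: "u \<in> Arr C" "Dom C u = Cod C p" "Cod C u = Cod C g" "u \<bullet> p = g"
    by (rule cokernel_factor[OF assms(1), of g]) (use g' in auto)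
  have "is_kernel C p i"
  proof (rule kernelI[OF assms(2)])
    fix h assume h: "h \<in> Arr C" "Cod C h = Dom C p" "p \<bullet> h = Zero C (Dom C h) (Cod C p)"
    have "g \<bullet> h = u \<bullet> (p \<bullet> h)" unfolding u(4)[symmetric] using h(1,2) u(1-3) k by simp
    also have "\<dots> = Zero C (Dom C h) (Cod C g)" unfolding h(3) using h(1) u k by simp
    finally show "\<exists>u. u \<in> Arr C \<and> Dom C u = Dom C h \<and> Cod C u = Dom C i \<and> i \<bullet> u = h"
      using kernel_factor[OF g, of h] h g' k by metis
  qed (use k in auto)
  then show ?thesis using assms by (simp add: short_exact_def)
qed

lemma cokernel_kernel_short_exact:
  assumes "is_cokernel C f q" "is_kernel C q m"
  shows "short_exact C m q"
  using epi_kernel_short_exact assms cokernel_epi by blast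

text \<open>
  The image of \<open>f\<close> is the kernel \<open>m\<close> of its cokernel. The point is that \<open>e\<close> is epi: if \<open>h\<close> kills \<open>e\<close>,
  then \<open>f\<close> factors through the subobject \<open>m k\<close>, where \<open>k\<close> is the kernel of \<open>h\<close>. Normality of \<open>m k\<close> and
  minimality of the image force \<open>k\<close> to be a split epimorphism, hence \<open>h = 0\<close>.
\<close>

lemma image_factorization:
  assumes q: "is_cokernel C f q" and m: "is_kernel C q m"
  obtains e where "is_epi C e" "Dom C e = Dom C f" "Cod C e = Dom C m" "m \<bullet> e = f"
proof -
  note q' = cokernel_arr[OF q] and m' = kernel_arr[OF m]
  obtain e where e: "e \<in> Arr C" "Dom C e = Dom C f" "Cod C e = Dom C m" "m \<bullet> e = f"
    by (rule kernel_factor[OF m, of f]) (use q' in auto)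
  have "is_epi C e"
  proof (rule epi_zeroI[OF e(1)])
    fix h assume h: "h \<in> Arr C" "Dom C h = Cod C e" "h \<bullet> e = Zero C (Dom C e) (Cod C h)"
    obtain k where k: "is_kernel C h k" using kernels[OF h(1)] ..
    note k' = kernel_arr[OF k]
    obtain v where v: "v \<in> Arr C" "Dom C v = Dom C e" "Cod C v = Dom C k" "k \<bullet> v = e"
      by (rule kernel_factor[OF k, of e]) (use h e in auto)
    have mk: "is_mono C (m \<bullet> k)"
      by (rule mono_comp) (use kernel_mono[OF k] kernel_mono[OF m] k' h e in auto)
    obtain g where g: "is_kernel C g (m \<bullet> k)" using mono_normal[OF mk] ..
    note g' = kernel_arr[OF g]
    \<comment> \<open>\<open>g\<close> kills \<open>f = m k v\<close>, so it factors through \<open>q\<close> and kills \<open>m\<close>; hence \<open>k\<close> splits.\<close>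
    have "g \<bullet> f = (g \<bullet> (m \<bullet> k)) \<bullet> v"
      unfolding e(4)[symmetric] v(4)[symmetric]
      using g'(1-3) m'(1-3) k'(1-3) v(1-3) h(1,2) e(1-3) by simp
    also have "\<dots> = Zero C (Dom C f) (Cod C g)"
      unfolding g'(4) using g' m' k' v h(1,2) e(1-3) by simp
    finally obtain u where u: "u \<in> Arr C" "Dom C u = Cod C q" "Cod C u = Cod C g" "u \<bullet> q = g"
      using cokernel_factor[OF q, of g] g' m' k' q' h(1,2) e(1-3) by auto
    have "g \<bullet> m = u \<bullet> (q \<bullet> m)"
      unfolding u(4)[symmetric] using u(1-3) m'(1-3) by simp
    also have "\<dots> = Zero C (Dom C m) (Cod C g)" unfolding m'(4) using u m' by simp
    finally obtain w where w: "w \<in> Arr C" "Dom C w = Dom C m" "Cod C w = Dom C k" "(m \<bullet> k) \<bullet> w = m"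
      using kernel_factor[OF g, of m] g' m' k' h(1,2) e(1-3) by auto
    have "k \<bullet> w = Ident C (Dom C m)"
      by (rule mono_cancel[OF kernel_mono[OF m]]) (use w m' k' h(1,2) e(1-3) in auto)
    then have "h = h \<bullet> (k \<bullet> w)" using h(1,2) e by simp
    also have "\<dots> = (h \<bullet> k) \<bullet> w" using h(1,2) k'(1-3) w(1-3) by simp
    also have "\<dots> = Zero C (Cod C e) (Cod C h)" unfolding k'(4) using h(1) k' w(1-3) e(3) by simp
    finally show "h = Zero C (Cod C e) (Cod C h)" .
  qed
  then show thesis using that e by blast
qed

lemma biproduct:
  assumes "X \<in> Ob C" "Y \<in> Ob C"
  obtains i j p q where "short_exact C i q" "j \<in> Arr C" "p \<in> Arr C"
    "Dom C i = X" "Cod C q = Y" "Dom C j = Y" "Cod C j = Cod C i" "Dom C p = Cod C i" "Cod C p = X"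
    "p \<bullet> i = Ident C X" "q \<bullet> j = Ident C Y" "(i \<bullet> p) \<oplus> (j \<bullet> q) = Ident C (Cod C i)"
proof -
  obtain P i j p q where h: "i \<in> homset C X P" "j \<in> homset C Y P" "p \<in> homset C P X"
      "q \<in> homset C P Y"
    and e: "p \<bullet> i = Ident C X" "q \<bullet> j = Ident C Y" "(i \<bullet> p) \<oplus> (j \<bullet> q) = Ident C P"
    using biproducts[OF assms] unfolding has_biproduct_def by blast
  have a: "i \<in> Arr C" "j \<in> Arr C" "p \<in> Arr C" "q \<in> Arr C"
    and d: "Dom C i = X" "Cod C i = P" "Dom C j = Y" "Cod C j = P" "Dom C p = P" "Cod C p = X"
      "Dom C q = P" "Cod C q = Y"
    using h by (auto simp: homset_iff)
  have "q \<bullet> i = q \<bullet> (((i \<bullet> p) \<oplus> (j \<bullet> q)) \<bullet> i)" unfolding e using a d by simp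
  also have "\<dots> = q \<bullet> (i \<bullet> (p \<bullet> i)) \<oplus> (q \<bullet> j) \<bullet> (q \<bullet> i)" using a d by simp
  also have "\<dots> = (q \<bullet> i) \<oplus> (q \<bullet> i)" unfolding e using a d by simp
  finally have qi: "q \<bullet> i = Zero C X Y"
    using Add_eq_right_imp_Zero[of "q \<bullet> i" "q \<bullet> i"] a d by simp
  have "is_mono C i"
  proof (rule mono_zeroI)
    fix g assume g: "g \<in> Arr C" "Cod C g = Dom C i" "i \<bullet> g = Zero C (Dom C g) (Cod C i)"
    have "g = (p \<bullet> i) \<bullet> g" unfolding e using g d by simp
    also have "\<dots> = p \<bullet> (i \<bullet> g)" using g(1,2) a d by simp
    finally show "g = Zero C (Dom C g) (Dom C i)" unfolding g(3) using g(1) a d by simp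
  qed (fact a)
  then have k: "is_kernel C q i"
  proof (rule kernelI)
    fix h assume h: "h \<in> Arr C" "Cod C h = Dom C q" "q \<bullet> h = Zero C (Dom C h) (Cod C q)"
    have "h = ((i \<bullet> p) \<oplus> (j \<bullet> q)) \<bullet> h" unfolding e using h d by simp
    also have "\<dots> = i \<bullet> (p \<bullet> h) \<oplus> j \<bullet> (q \<bullet> h)" using h(1,2) a d by simp
    also have "\<dots> = i \<bullet> (p \<bullet> h)" unfolding h(3) using h(1,2) a d assms by simp
    finally show "\<exists>u. u \<in> Arr C \<and> Dom C u = Dom C h \<and> Cod C u = Dom C i \<and> i \<bullet> u = h"
      using h a d by (intro exI[of _ "p \<bullet> h"]) auto
  qed (use a d qi in auto)
  have "is_epi C q"
  proof (rule epi_zeroI)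
    fix g assume g: "g \<in> Arr C" "Dom C g = Cod C q" "g \<bullet> q = Zero C (Dom C q) (Cod C g)"
    have "g = g \<bullet> (q \<bullet> j)" unfolding e using g d by simp
    also have "\<dots> = (g \<bullet> q) \<bullet> j" using g(1,2) a d by simp
    finally show "g = Zero C (Cod C q) (Cod C g)" unfolding g(3) using g(1) a d by simp
  qed (fact a)
  then have "short_exact C i q" using epi_kernel_short_exact[OF k] by simp
  then show thesis using that[of i q j p] a d e by blast
qed

text \<open>
  Epimorphisms are stable under base change, stated for generalized elements: an element \<open>w\<close> of the
  target of an epimorphism lifts to the source after passing to an epimorphic cover \<open>t\<close> of its domain.
\<close>

lemma lift_along_epi:
  assumes b: "is_epi C b" and w: "w \<in> Arr C" "Cod C w = Cod C b"
  obtains t y where "is_epi C t" "Cod C t = Dom C w" "y \<in> Arr C" "Dom C y = Dom C t"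
    "Cod C y = Dom C b" "b \<bullet> y = w \<bullet> t"
proof -
  have ba: "b \<in> Arr C" using epi_arr[OF b] .
  let ?M = "Cod C b"
  obtain i j p q where ij: "short_exact C i q" and a: "j \<in> Arr C" "p \<in> Arr C"
    and d: "Dom C i = Dom C b" "Cod C q = Dom C w" "Dom C j = Dom C w" "Cod C j = Cod C i"
    "Dom C p = Cod C i" "Cod C p = Dom C b"
    and e: "p \<bullet> i = Ident C (Dom C b)" "q \<bullet> j = Ident C (Dom C w)"
    "(i \<bullet> p) \<oplus> (j \<bullet> q) = Ident C (Cod C i)"
    using biproduct[OF Dom_Cod_Ob(1)[OF ba] Dom_Cod_Ob(1)[OF w(1)]] .
  note iq = short_exact_arr[OF ij]
  obtain n where n: "n \<in> Arr C" "Dom C n = Dom C w" "Cod C n = ?M" "Zero C (Dom C w) ?M = n \<oplus> w"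
    by (rule difference[of "Zero C (Dom C w) ?M" w]) (use ba w in \<open>simp_all (no_asm_simp)\<close>)
  \<comment> \<open>The pullback is the kernel of \<open>s = (b, - w)\<close> on the biproduct of the two sources.\<close>
  define s where "s = b \<bullet> p \<oplus> n \<bullet> q"
  have s: "s \<in> Arr C" "Dom C s = Cod C i" "Cod C s = ?M"
    unfolding s_def using ba w a d n iq by auto
  have si: "s \<bullet> i = b"
    unfolding s_def using ba w a d n e iq by simp
  have "is_epi C s"
    by (rule epi_cancel_left[of s i]) (use si b s iq in auto)
  obtain k where k: "is_kernel C s k" using kernels[OF s(1)] ..
  note k' = kernel_arr[OF k]
  have sk: "is_cokernel C k s"
    using epi_kernel_short_exact[OF k \<open>is_epi C s\<close>] by (simp add: short_exact_def)
  have "b \<bullet> (p \<bullet> k) \<oplus> n \<bullet> (q \<bullet> k) = Zero C (Dom C k) ?M"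
    using k'(4) s k'(1-3) ba a d n iq unfolding s_def by simp
  moreover have "n \<bullet> (q \<bullet> k) \<oplus> w \<bullet> (q \<bullet> k) = (n \<oplus> w) \<bullet> (q \<bullet> k)"
    using s k'(1-3) ba a d n(1-3) w iq by simp
  then have "n \<bullet> (q \<bullet> k) \<oplus> w \<bullet> (q \<bullet> k) = Zero C (Dom C k) ?M"
    unfolding n(4)[symmetric] using s k'(1-3) ba a d n(1-3) w iq by simp
  moreover have "(b \<bullet> (p \<bullet> k) \<oplus> n \<bullet> (q \<bullet> k)) \<oplus> w \<bullet> (q \<bullet> k) =
      b \<bullet> (p \<bullet> k) \<oplus> (n \<bullet> (q \<bullet> k) \<oplus> w \<bullet> (q \<bullet> k))"
    by (rule Add_assoc) (use s k'(1-3) ba a d n(1-3) w iq in auto)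
  ultimately have eq: "b \<bullet> (p \<bullet> k) = w \<bullet> (q \<bullet> k)"
    using s k'(1-3) ba a d n(1-3) w iq by simp
  have "is_epi C (q \<bullet> k)"
  proof (rule epi_zeroI)
    show qk: "q \<bullet> k \<in> Arr C" using s k' d iq by simp
    fix h assume h: "h \<in> Arr C" "Dom C h = Cod C (q \<bullet> k)"
      "h \<bullet> (q \<bullet> k) = Zero C (Dom C (q \<bullet> k)) (Cod C h)"
    then have hq: "h \<in> Arr C" "Dom C h = Cod C q" "(h \<bullet> q) \<bullet> k = Zero C (Dom C k) (Cod C h)"
      using s k'(1-3) d iq by auto
    obtain u where u: "u \<in> Arr C" "Dom C u = ?M" "Cod C u = Cod C h" "u \<bullet> s = h \<bullet> q"
      using cokernel_factor[OF sk, of "h \<bullet> q"] hq s k'(1-3) d iq by auto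
    have "u \<bullet> b = (u \<bullet> s) \<bullet> i" unfolding si[symmetric] using u(1-3) s iq by simp
    also have "\<dots> = h \<bullet> (q \<bullet> i)" unfolding u(4) using hq(1,2) iq(1-3) by simp
    also have "\<dots> = Zero C (Dom C b) (Cod C h)" unfolding iq(4) using hq(1,2) iq(1-3) d ba w by simp
    finally have "u = Zero C ?M (Cod C h)" using epi_zeroD[OF b, of u] u by simp
    then have hq0: "h \<bullet> q = Zero C (Dom C q) (Cod C h)" using u(4) s iq hq(1) by simp
    have "h = h \<bullet> (q \<bullet> j)" unfolding e using hq d by simp
    also have "\<dots> = (h \<bullet> q) \<bullet> j" using hq(1,2) a iq d by simp
    also have "\<dots> = Zero C (Cod C (q \<bullet> k)) (Cod C h)" unfolding hq0 using hq(1) a iq d k'(1-3) s by simp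
    finally show "h = Zero C (Cod C (q \<bullet> k)) (Cod C h)" .
  qed
  then show thesis by (rule that[of "q \<bullet> k" "p \<bullet> k"]) (use eq s k'(1-3) a d iq in auto)
qed

text \<open>
  Exactness for generalized elements: an element killed by the cokernel of \<open>f\<close> comes, on a cover, from
  the source of \<open>f\<close>.
\<close>

lemma lift_along_exact:
  assumes q: "is_cokernel C f q" and z: "z \<in> Arr C" "Cod C z = Cod C f" "q \<bullet> z = Zero C (Dom C z) (Cod C q)"
  obtains t x where "is_epi C t" "Cod C t = Dom C z" "x \<in> Arr C" "Dom C x = Dom C t"
    "Cod C x = Dom C f" "f \<bullet> x = z \<bullet> t"
proof -
  note q' = cokernel_arr[OF q]
  obtain m where m: "is_kernel C q m" using kernels q' by blast
  note m' = kernel_arr[OF m]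
  obtain e where e: "is_epi C e" "Dom C e = Dom C f" "Cod C e = Dom C m" "m \<bullet> e = f"
    using image_factorization[OF q m] .
  have ea: "e \<in> Arr C" using epi_arr e by auto
  obtain y where y: "y \<in> Arr C" "Dom C y = Dom C z" "Cod C y = Dom C m" "m \<bullet> y = z"
    using kernel_factor[OF m, of z] z q' by auto
  obtain t x where t: "is_epi C t" "Cod C t = Dom C y" "x \<in> Arr C" "Dom C x = Dom C t"
    "Cod C x = Dom C e" "e \<bullet> x = y \<bullet> t"
    using lift_along_epi[OF e(1), of y] y e by auto
  have "f \<bullet> x = z \<bullet> t"
    unfolding e(4)[symmetric] y(4)[symmetric]
    using t m' y(1-3) e(1-3) ea epi_arr[OF t(1)] by simp
  then show thesis using that[of t x] t y e by simp
qed

end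

section \<open>Kernels and cokernels in an extension closure\<close>

definition ker_coker_in :: "('o, 'm, 'z) abcat_scheme \<Rightarrow> 'o set \<Rightarrow> 'm \<Rightarrow> bool" where
  "ker_coker_in C E f \<longleftrightarrow>
     (\<exists>k. is_kernel C f k \<and> Dom C k \<in> E) \<and> (\<exists>q. is_cokernel C f q \<and> Cod C q \<in> E)"

text \<open>
  Stronger than \<open>ker_coker_in\<close>, as the image is required to be in \<open>S\<close> as well. The induction over the target
  of an arrow uses this: the cokernel of the composite to the top quotient is needed together
  with its image factorization.
\<close>

definition factors_in :: "('o, 'm, 'z) abcat_scheme \<Rightarrow> 'o set \<Rightarrow> 'm \<Rightarrow> bool" where
  "factors_in C S f \<longleftrightarrow> (\<exists>k e m q. short_exact C k e \<and> short_exact C m q \<and> Cod C e = Dom C m \<and>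
     f = m \<bullet>\<^bsub>C\<^esub> e \<and> Dom C k \<in> S \<and> Cod C e \<in> S \<and> Cod C q \<in> S)"

context abelian_category
begin

lemma ext_starI:
  "\<lbrakk>short_exact C i p; Dom C i \<in> S; Cod C p \<in> T; Cod C i = X\<rbrakk> \<Longrightarrow> X \<in> ext_star C S T"
  using short_exact_arr[of i p] unfolding ext_star_def by auto

lemma ext_starE:
  assumes "X \<in> ext_star C S T"
  obtains i p where "short_exact C i p" "Dom C i \<in> S" "Cod C i = X" "Dom C p = X" "Cod C p \<in> T"
  using assms short_exact_arr(3) unfolding ext_star_def by force

lemma ext_star_mono: "S \<subseteq> S' \<Longrightarrow> T \<subseteq> T' \<Longrightarrow> ext_star C S T \<subseteq> ext_star C S' T'"
  unfolding ext_star_def by blast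

text \<open>
  For \<open>X\<close> with subobject \<open>A \<in> S\<close> and quotient \<open>Y\<close>, where \<open>Y\<close> has subobject \<open>B \<in> T\<close> and quotient in \<open>U\<close>,
  the preimage \<open>K\<close> of \<open>B\<close> in \<open>X\<close> is the kernel of \<open>X \<rightarrow> Y \<rightarrow> Cod r\<close> and an extension of \<open>B\<close> by \<open>A\<close>.
\<close>

lemma ext_star_assoc_subset: "ext_star C S (ext_star C T U) \<subseteq> ext_star C (ext_star C S T) U"
proof
  fix X assume "X \<in> ext_star C S (ext_star C T U)"
  then obtain i p where ip: "short_exact C i p" and di: "Dom C i \<in> S" "Cod C i = X"
    and cp: "Dom C p = X" "Cod C p \<in> ext_star C T U"
    by (rule ext_starE)
  obtain j r where jr: "short_exact C j r" and dj: "Dom C j \<in> T" "Cod C j = Cod C p"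
    "Dom C r = Cod C p" and cr: "Cod C r \<in> U"
    using cp(2) by (rule ext_starE)
  note i' = short_exact_arr[OF ip] and j' = short_exact_arr[OF jr]
  have kp: "is_kernel C p i" "is_epi C p" "is_kernel C r j" "is_epi C r"
    using ip jr cokernel_epi unfolding short_exact_def by blast+
  have rp: "is_epi C (r \<bullet> p)" by (rule epi_comp) (use kp dj in auto)
  obtain k where k: "is_kernel C (r \<bullet> p) k" using kernels[OF epi_arr[OF rp]] ..
  note k' = kernel_arr[OF k]
  have kd: "Cod C k = X" using k' i' j' dj cp by simp
  obtain i2 where i2: "i2 \<in> Arr C" "Dom C i2 = Dom C i" "Cod C i2 = Dom C k" "k \<bullet> i2 = i"
    by (rule kernel_factor[OF k, of i]) (use i' j' dj in auto)
  have "r \<bullet> (p \<bullet> k) = Zero C (Dom C k) (Cod C r)" using k' i' j' dj cp by simp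
  then obtain p2 where p2: "p2 \<in> Arr C" "Dom C p2 = Dom C k" "Cod C p2 = Dom C j" "j \<bullet> p2 = p \<bullet> k"
    using kernel_factor[OF kp(3), of "p \<bullet> k"] k' i' j' dj cp kd by auto
  have "is_mono C i2"
  proof (rule mono_zeroI[OF i2(1)])
    fix g assume g: "g \<in> Arr C" "Cod C g = Dom C i2" "i2 \<bullet> g = Zero C (Dom C g) (Cod C i2)"
    have "i \<bullet> g = k \<bullet> (i2 \<bullet> g)" unfolding i2(4)[symmetric] using g(1,2) i2(1-3) k'(1-3) by simp
    also have "\<dots> = Zero C (Dom C g) (Cod C i)" unfolding g(3) using g(1) i2 k' di kd by simp
    finally show "g = Zero C (Dom C g) (Dom C i2)"
      using mono_zeroD[OF kernel_mono[OF kp(1)], of g] g i2 by simp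
  qed
  then have ker: "is_kernel C p2 i2"
  proof (rule kernelI)
    have "j \<bullet> (p2 \<bullet> i2) = p \<bullet> (k \<bullet> i2)"
      by (rule comp_cong_left[OF p2(4)]) (use p2 i2 j' k' dj cp kd i' in auto)
    then have "j \<bullet> (p2 \<bullet> i2) = Zero C (Dom C i) (Cod C j)" unfolding i2(4) i'(4) using dj by simp
    then show "p2 \<bullet> i2 = Zero C (Dom C i2) (Cod C p2)"
      using mono_zeroD[OF kernel_mono[OF kp(3)], of "p2 \<bullet> i2"] p2 i2 j' by simp
    fix h assume h: "h \<in> Arr C" "Cod C h = Dom C p2" "p2 \<bullet> h = Zero C (Dom C h) (Cod C p2)"
    have "p \<bullet> (k \<bullet> h) = j \<bullet> (p2 \<bullet> h)"
      by (rule comp_cong_left[OF p2(4)[symmetric]]) (use p2 i2 j' k' dj cp kd i' h in auto)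
    also have "\<dots> = Zero C (Dom C h) (Cod C p)" unfolding h(3) using h(1) p2 j' dj by simp
    finally obtain u where u: "u \<in> Arr C" "Dom C u = Dom C h" "Cod C u = Dom C i" "i \<bullet> u = k \<bullet> h"
      using kernel_factor[OF kp(1), of "k \<bullet> h"] k' h(1,2) p2 kd cp i' by auto
    have "i2 \<bullet> u = h"
    proof (rule mono_cancel[OF kernel_mono[OF k]])
      show "k \<bullet> (i2 \<bullet> u) = k \<bullet> h"
        unfolding u(4)[symmetric] i2(4)[symmetric] using u(1-3) i2(1-3) k' by simp
    qed (use u h i2 p2 in auto)
    then show "\<exists>u. u \<in> Arr C \<and> Dom C u = Dom C h \<and> Cod C u = Dom C i2 \<and> i2 \<bullet> u = h"
      using u i2 by (intro exI[of _ u]) simp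
  qed (use p2 i2 in auto)
  \<comment> \<open>\<open>p2\<close> is the pullback of the epimorphism \<open>p\<close> along \<open>j\<close>.\<close>
  obtain t y where t: "is_epi C t" "Cod C t = Dom C j" "y \<in> Arr C" "Dom C y = Dom C t"
    "Cod C y = Dom C p" "p \<bullet> y = j \<bullet> t"
    using lift_along_epi[OF kp(2), of j] j' dj by auto
  have ta: "t \<in> Arr C" using epi_arr t by auto
  have "(r \<bullet> p) \<bullet> y = (r \<bullet> j) \<bullet> t" using t i' j'(1-3) dj ta by simp
  also have "\<dots> = Zero C (Dom C y) (Cod C r)" unfolding j'(4) using t ta j' by simp
  finally obtain v where v: "v \<in> Arr C" "Dom C v = Dom C y" "Cod C v = Dom C k" "k \<bullet> v = y"
    using kernel_factor[OF k, of y] t i' j' dj by auto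
  have "p2 \<bullet> v = t"
  proof (rule mono_cancel[OF kernel_mono[OF kp(3)]])
    have "j \<bullet> (p2 \<bullet> v) = p \<bullet> (k \<bullet> v)"
      by (rule comp_cong_left[OF p2(4)]) (use p2 i2 j' k' dj cp kd i' v in auto)
    then show "j \<bullet> (p2 \<bullet> v) = j \<bullet> t" unfolding v(4) t(6) .
  qed (use v p2 t ta in auto)
  then have "is_epi C p2" using epi_cancel_left[of p2 v] t v p2 by simp
  then have "short_exact C i2 p2" using ker epi_kernel_short_exact by simp
  then have K: "Dom C k \<in> ext_star C S T"
    by (rule ext_starI) (use i2 p2 di dj in auto)
  have "short_exact C k (r \<bullet> p)" using epi_kernel_short_exact[OF k rp] .
  then show "X \<in> ext_star C (ext_star C S T) U"
    by (rule ext_starI) (use K cr kd dj i' j' in auto)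
qed

lemma ext_pow_star_subset:
  "ext_star C (ext_pow C S k) (ext_pow C S l) \<subseteq> ext_pow C S (Suc (k + l))"
proof (induction l)
  case (Suc l)
  have "ext_star C (ext_pow C S k) (ext_pow C S (Suc l))
      \<subseteq> ext_star C (ext_star C (ext_pow C S k) (ext_pow C S l)) S"
    using ext_star_assoc_subset by simp
  also have "\<dots> \<subseteq> ext_star C (ext_pow C S (Suc (k + l))) S"
    by (rule ext_star_mono[OF Suc.IH]) simp
  finally show ?case by simp
qed simp

lemma ext_closure_closed: "ext_star C (ext_closure C S) (ext_closure C S) \<subseteq> ext_closure C S"
proof
  fix X assume "X \<in> ext_star C (ext_closure C S) (ext_closure C S)"
  then obtain k l where "X \<in> ext_star C (ext_pow C S k) (ext_pow C S l)"
    unfolding ext_star_def ext_closure_def by blast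
  then show "X \<in> ext_closure C S" using ext_pow_star_subset unfolding ext_closure_def by blast
qed

lemma ext_pow_Ob: "S \<subseteq> Ob C \<Longrightarrow> ext_pow C S k \<subseteq> Ob C"
  by (cases k) (auto simp: ext_star_def)

lemma ext_pow_subset_closure: "ext_pow C S k \<subseteq> ext_closure C S"
  unfolding ext_closure_def by blast

lemma subset_ext_closure: "S \<subseteq> ext_closure C S"
  using ext_pow_subset_closure[of S 0] by simp

lemma factors_in_imp_ker_coker_in:
  assumes "factors_in C S f"
  shows "ker_coker_in C S f"
proof -
  obtain k e m q where a: "short_exact C k e" "short_exact C m q" "Cod C e = Dom C m"
    "f = m \<bullet> e" "Dom C k \<in> S" "Cod C e \<in> S" "Cod C q \<in> S"
    using assms unfolding factors_in_def by blast
  note k' = short_exact_arr[OF a(1)] and m' = short_exact_arr[OF a(2)]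
  have b: "is_kernel C e k" "is_epi C e" "is_mono C m" "is_cokernel C m q"
    using a kernel_mono cokernel_epi unfolding short_exact_def by blast+
  have "is_kernel C f k"
  proof (rule kernelI)
    show "is_mono C k" using kernel_mono b by blast
    show "f \<bullet> k = Zero C (Dom C k) (Cod C f)" unfolding a(4) using k' m' a(3) by simp
    fix h assume h: "h \<in> Arr C" "Cod C h = Dom C f" "f \<bullet> h = Zero C (Dom C h) (Cod C f)"
    then have "e \<bullet> h = Zero C (Dom C h) (Cod C e)"
      using mono_zeroD[OF b(3), of "e \<bullet> h"] k' m' a(3,4) by simp
    then show "\<exists>u. u \<in> Arr C \<and> Dom C u = Dom C h \<and> Cod C u = Dom C k \<and> k \<bullet> u = h"
      using kernel_factor[OF b(1), of h] h k' m' a(3,4) by auto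
  qed (use a(3,4) k' m' in auto)
  moreover have "is_cokernel C f q"
  proof (rule cokernelI)
    show "is_epi C q" using cokernel_epi b by blast
    have "(q \<bullet> m) \<bullet> e = Zero C (Dom C e) (Cod C q)" unfolding m'(4) using k' m' a(3) by simp
    then show "q \<bullet> f = Zero C (Dom C f) (Cod C q)" unfolding a(4) using k' m'(1-3) a(3) by simp
    fix h assume h: "h \<in> Arr C" "Dom C h = Cod C f" "h \<bullet> f = Zero C (Dom C f) (Cod C h)"
    then have "(h \<bullet> m) \<bullet> e = Zero C (Dom C e) (Cod C h)" using k' m' a(3,4) by simp
    then have "h \<bullet> m = Zero C (Cod C e) (Cod C h)"
      using epi_zeroD[OF b(2), of "h \<bullet> m"] k' m' a(3,4) h(1,2) by simp
    then show "\<exists>u. u \<in> Arr C \<and> Dom C u = Cod C q \<and> Cod C u = Cod C h \<and> u \<bullet> q = h"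
      using cokernel_factor[OF b(4), of h] h(1,2) k' m' a(3,4) by auto
  qed (use a(3,4) k' m' in auto)
  ultimately show ?thesis using a unfolding ker_coker_in_def by blast
qed

text \<open>
  The snake lemma for the rows \<open>0 \<rightarrow> Dom k \<rightarrow> Dom f \<rightarrow> Cod e \<rightarrow> 0\<close> and
  \<open>0 \<rightarrow> Dom i \<rightarrow> Cod f \<rightarrow> Cod p \<rightarrow> 0\<close>, whose right-hand vertical arrow \<open>m\<close> is mono: the kernel of \<open>f\<close>
  is that of the left-hand vertical arrow \<open>g\<close>, and the cokernel of \<open>f\<close> is an extension of \<open>Cod q\<close> by the
  cokernel of \<open>g\<close>.
\<close>

lemma ker_coker_into_extension:
  assumes closed: "ext_star C E E \<subseteq> E"
    and ip: "short_exact C i p" and f: "f \<in> Arr C" "Cod C f = Dom C p"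
    and ke: "short_exact C k e" and mq: "short_exact C m q"
    and em: "Cod C e = Dom C m" "p \<bullet> f = m \<bullet> e" and qE: "Cod C q \<in> E"
    and IH: "\<And>g. \<lbrakk>g \<in> Arr C; Dom C g = Dom C k; Cod C g = Dom C i\<rbrakk> \<Longrightarrow> ker_coker_in C E g"
  shows "ker_coker_in C E f"
proof -
  note i' = short_exact_arr[OF ip] and k' = short_exact_arr[OF ke] and m' = short_exact_arr[OF mq]
  have b: "is_kernel C p i" "is_cokernel C i p" "is_kernel C e k" "is_cokernel C k e"
    "is_mono C m" "is_cokernel C m q" "is_mono C i" "is_epi C p" "is_epi C e" "is_mono C k" "is_epi C q"
    using ip ke mq kernel_mono cokernel_epi unfolding short_exact_def by blast+
  have d: "Dom C f = Dom C e" "Cod C m = Cod C p"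
    using arg_cong[OF em(2), of "Dom C"] arg_cong[OF em(2), of "Cod C"] f i' k' m' em(1) by simp_all
  have "p \<bullet> (f \<bullet> k) = m \<bullet> (e \<bullet> k)"
    by (rule comp_cong_left[OF em(2)]) (use f i' k' m' em(1) d in auto)
  then have "p \<bullet> (f \<bullet> k) = Zero C (Dom C k) (Cod C p)" using k' m' em(1) d by simp
  then obtain g where g: "g \<in> Arr C" "Dom C g = Dom C k" "Cod C g = Dom C i" "i \<bullet> g = f \<bullet> k"
    using kernel_factor[OF b(1), of "f \<bullet> k"] f i' k' d by auto
  obtain a c where a: "is_kernel C g a" "Dom C a \<in> E" and c: "is_cokernel C g c" "Cod C c \<in> E"
    using IH[OF g(1-3)] unfolding ker_coker_in_def by blast
  note a' = kernel_arr[OF a(1)] and c' = cokernel_arr[OF c(1)]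

  have kill: "e \<bullet> h = Zero C (Dom C h) (Cod C e)"
    if h: "h \<in> Arr C" "Cod C h = Dom C f" "p \<bullet> (f \<bullet> h) = Zero C (Dom C h) (Cod C p)" for h
  proof -
    have "m \<bullet> (e \<bullet> h) = p \<bullet> (f \<bullet> h)"
      by (rule comp_cong_left[OF em(2)[symmetric]]) (use f i' k' m' em(1) d h in auto)
    then show ?thesis
      using mono_zeroD[OF b(5), of "e \<bullet> h"] h k' m' em(1) d by simp
  qed

  have ker: "is_kernel C f (k \<bullet> a)"
  proof (rule kernelI)
    show "is_mono C (k \<bullet> a)" using mono_comp kernel_mono a b a' g by simp
    have "f \<bullet> (k \<bullet> a) = i \<bullet> (g \<bullet> a)"
      by (rule comp_cong_left[OF g(4)[symmetric]]) (use f i' k' g(1-3) a' d in auto)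
    then show "f \<bullet> (k \<bullet> a) = Zero C (Dom C (k \<bullet> a)) (Cod C f)"
      using a' g i' k' f by simp
    fix h assume h: "h \<in> Arr C" "Cod C h = Dom C f" "f \<bullet> h = Zero C (Dom C h) (Cod C f)"
    have "e \<bullet> h = Zero C (Dom C h) (Cod C e)" by (rule kill) (use h f i' in auto)
    then obtain u where u: "u \<in> Arr C" "Dom C u = Dom C h" "Cod C u = Dom C k" "k \<bullet> u = h"
      using kernel_factor[OF b(3), of h] h(1,2) d by auto
    have "i \<bullet> (g \<bullet> u) = f \<bullet> (k \<bullet> u)"
      by (rule comp_cong_left[OF g(4)]) (use f i' k' g(1-3) u d in auto)
    then have "i \<bullet> (g \<bullet> u) = Zero C (Dom C u) (Cod C i)" unfolding u(4) h(3) using u f i' by simp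
    then have "g \<bullet> u = Zero C (Dom C u) (Cod C g)"
      using mono_zeroD[OF b(7), of "g \<bullet> u"] g(1-3) u(1-3) by simp
    then obtain v where v: "v \<in> Arr C" "Dom C v = Dom C u" "Cod C v = Dom C a" "a \<bullet> v = u"
      using kernel_factor[OF a(1), of u] g(1-3) u(1-3) by auto
    have "(k \<bullet> a) \<bullet> v = k \<bullet> (a \<bullet> v)" using v(1-3) a' g(1-3) k' by simp
    then show "\<exists>v. v \<in> Arr C \<and> Dom C v = Dom C h \<and> Cod C v = Dom C (k \<bullet> a) \<and> (k \<bullet> a) \<bullet> v = h"
      using v u a' g(1-3) k' by (intro exI[of _ v]) simp
  qed (use f k' a' g d in auto)
  have kerE: "Dom C (k \<bullet> a) \<in> E" using a' g k' a(2) by simp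

  obtain n where n: "is_cokernel C f n" using cokernels[OF f(1)] ..
  note n' = cokernel_arr[OF n]
  have nd: "Dom C n = Dom C p" using n' f by simp
  have "(n \<bullet> i) \<bullet> g = n \<bullet> (f \<bullet> k)" unfolding g(4)[symmetric] using n' nd i' g(1-3) by simp
  also have "\<dots> = (n \<bullet> f) \<bullet> k" using n'(1-3) k' d by simp
  also have "\<dots> = Zero C (Dom C g) (Cod C n)" unfolding n'(4) using n'(1-3) k' d g(1-3) by simp
  finally obtain i2 where i2: "i2 \<in> Arr C" "Dom C i2 = Cod C c" "Cod C i2 = Cod C n" "i2 \<bullet> c = n \<bullet> i"
    using cokernel_factor[OF c(1), of "n \<bullet> i"] n' nd i' g(1-3) by auto
  have "(q \<bullet> p) \<bullet> f = q \<bullet> (m \<bullet> e)" using m'(1-3) d i' f em by simp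
  also have "\<dots> = (q \<bullet> m) \<bullet> e" using m'(1-3) em k' by simp
  also have "\<dots> = Zero C (Dom C f) (Cod C q)" unfolding m'(4) using m'(1-3) em k' d by simp
  finally obtain p2 where p2: "p2 \<in> Arr C" "Dom C p2 = Cod C n" "Cod C p2 = Cod C q" "p2 \<bullet> n = q \<bullet> p"
    using cokernel_factor[OF n, of "q \<bullet> p"] m' i' f d by auto
  have "is_epi C (q \<bullet> p)" by (rule epi_comp) (use b m' d in auto)
  then have "is_epi C p2" using epi_cancel_left[of p2 n] p2 n' by simp
  then have i2p2: "is_cokernel C i2 p2"
  proof (rule cokernelI)
    have "(p2 \<bullet> i2) \<bullet> c = p2 \<bullet> (n \<bullet> i)" unfolding i2(4)[symmetric] using p2(1-3) i2(1-3) c' by simp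
    also have "\<dots> = q \<bullet> (p \<bullet> i)"
      by (rule comp_cong_left[OF p2(4)]) (use p2 n' m' i' d nd in auto)
    also have "\<dots> = Zero C (Dom C c) (Cod C p2)" unfolding i'(4) using m' i' d c' g p2 by simp
    finally show "p2 \<bullet> i2 = Zero C (Dom C i2) (Cod C p2)"
      using epi_zeroD[OF cokernel_epi[OF c(1)], of "p2 \<bullet> i2"] p2(1-3) i2(1-3) c' by simp
    fix h assume h: "h \<in> Arr C" "Dom C h = Cod C i2" "h \<bullet> i2 = Zero C (Dom C i2) (Cod C h)"
    have "h \<bullet> (n \<bullet> i) = (h \<bullet> i2) \<bullet> c" unfolding i2(4)[symmetric] using h(1,2) i2(1-3) c' by simp
    also have "\<dots> = Zero C (Dom C i) (Cod C h)" unfolding h(3) using h(1,2) i2(1-3) c' g by simp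
    finally obtain u where u: "u \<in> Arr C" "Dom C u = Cod C p" "Cod C u = Cod C h" "u \<bullet> p = h \<bullet> n"
      using cokernel_factor[OF b(2), of "h \<bullet> n"] h(1,2) i2(1-3) n'(1-3) nd i' by auto
    have "(u \<bullet> m) \<bullet> e = u \<bullet> (p \<bullet> f)" unfolding em(2) using u(1-3) m' d k' em(1) by simp
    also have "\<dots> = h \<bullet> (n \<bullet> f)"
      by (rule comp_cong_left[OF u(4)]) (use u h i2 n' i' nd f in auto)
    also have "\<dots> = Zero C (Dom C e) (Cod C (u \<bullet> m))"
      unfolding n'(4) using h(1,2) i2(1-3) n' d u(1-3) m' k' by simp
    finally have "u \<bullet> m = Zero C (Cod C e) (Cod C u)"
      using epi_zeroD[OF b(9), of "u \<bullet> m"] u(1-3) m' d k' em(1) by simp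
    then obtain v where v: "v \<in> Arr C" "Dom C v = Cod C q" "Cod C v = Cod C u" "v \<bullet> q = u"
      using cokernel_factor[OF b(6), of u] u(1-3) m' d em(1) by auto
    have "v \<bullet> p2 = h"
    proof (rule epi_cancel[OF cokernel_epi[OF n]])
      have "(v \<bullet> p2) \<bullet> n = v \<bullet> (q \<bullet> p)" unfolding p2(4)[symmetric] using v(1-3) p2(1-3) n' by simp
      also have "\<dots> = (v \<bullet> q) \<bullet> p" using v(1-3) m' i' d by simp
      finally show "(v \<bullet> p2) \<bullet> n = h \<bullet> n" unfolding v(4) u(4) .
    qed (use v p2 u h i2 in auto)
    then show "\<exists>v. v \<in> Arr C \<and> Dom C v = Cod C p2 \<and> Cod C v = Cod C h \<and> v \<bullet> p2 = h"
      using v p2 u by (intro exI[of _ v]) simp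
  qed (use p2 i2 in auto)
  have "is_mono C i2"
  proof (rule mono_zeroI[OF i2(1)])
    fix w assume w: "w \<in> Arr C" "Cod C w = Dom C i2" "i2 \<bullet> w = Zero C (Dom C w) (Cod C i2)"
    \<comment> \<open>The connecting map vanishes: on covers, an element of \<open>Cod c\<close> killed by \<open>i2\<close> lifts to \<open>y\<close> with
      \<open>i y = f x\<close>; then \<open>p f x = 0\<close>, so \<open>x\<close> lies in the kernel \<open>k\<close>, and \<open>y\<close> in the image of \<open>g\<close>.\<close>
    obtain s y where s: "is_epi C s" "Cod C s = Dom C w" "y \<in> Arr C" "Dom C y = Dom C s"
      "Cod C y = Dom C c" "c \<bullet> y = w \<bullet> s"
      using lift_along_epi[OF cokernel_epi[OF c(1)], of w] w i2 by auto
    have sa: "s \<in> Arr C" using epi_arr s by auto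
    have "n \<bullet> (i \<bullet> y) = i2 \<bullet> (c \<bullet> y)"
      by (rule comp_cong_left[OF i2(4)[symmetric]]) (use i2 n' nd i' c' s g in auto)
    also have "\<dots> = (i2 \<bullet> w) \<bullet> s" unfolding s(6) using i2(1-3) w(1,2) s sa by simp
    also have "\<dots> = Zero C (Dom C (i \<bullet> y)) (Cod C n)"
      unfolding w(3) using i2(1-3) w(1,2) s sa c' g i' n' by simp
    finally obtain s' x where s': "is_epi C s'" "Cod C s' = Dom C (i \<bullet> y)" "x \<in> Arr C"
      "Dom C x = Dom C s'" "Cod C x = Dom C f" "f \<bullet> x = (i \<bullet> y) \<bullet> s'"
      using lift_along_exact[OF n, of "i \<bullet> y"] i' s c' g(1-3) n' nd by auto
    have sa': "s' \<in> Arr C" "Cod C s' = Dom C y" using epi_arr s' s i' c' g by auto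
    have "p \<bullet> (f \<bullet> x) = (p \<bullet> i) \<bullet> (y \<bullet> s')" unfolding s'(6) using i'(1-3) s sa' c' g by simp
    also have "\<dots> = Zero C (Dom C x) (Cod C p)" unfolding i'(4) using i'(1-3) s sa' c' g s' by simp
    finally have "e \<bullet> x = Zero C (Dom C x) (Cod C e)" using kill[of x] s' by simp
    then obtain z where z: "z \<in> Arr C" "Dom C z = Dom C x" "Cod C z = Dom C k" "k \<bullet> z = x"
      using kernel_factor[OF b(3), of x] s' d by auto
    have "y \<bullet> s' = g \<bullet> z"
    proof (rule mono_cancel[OF b(7)])
      have "i \<bullet> (g \<bullet> z) = f \<bullet> (k \<bullet> z)"
        by (rule comp_cong_left[OF g(4)]) (use f i' k' g(1-3) z d in auto)
      then show "i \<bullet> (y \<bullet> s') = i \<bullet> (g \<bullet> z)" unfolding z(4) s'(6) using i' s sa' c' g(1-3) by simp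
    qed (use i' s sa' c' g z s' in auto)
    then have "c \<bullet> (y \<bullet> s') = (c \<bullet> g) \<bullet> z" using c'(1-3) g(1-3) z by simp
    also have "\<dots> = Zero C (Dom C s') (Cod C c)" unfolding c'(4) using c'(1-3) g(1-3) z s' by simp
    finally have "(c \<bullet> y) \<bullet> s' = Zero C (Dom C s') (Cod C c)" using c'(1-3) s(1-5) sa' g(1-3) by simp
    then have "c \<bullet> y = Zero C (Dom C y) (Cod C c)"
      using epi_zeroD[OF s'(1), of "c \<bullet> y"] c'(1-3) s(1-5) sa' g(1-3) by simp
    then have "w \<bullet> s = Zero C (Dom C s) (Cod C w)" using s(6) s(4) w i2 by simp
    then show "w = Zero C (Dom C w) (Dom C i2)" using epi_zeroD[OF s(1), of w] w s by simp
  qed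
  then have "short_exact C i2 p2" using mono_cokernel_short_exact i2p2 by blast
  then have "Cod C n \<in> ext_star C E E" by (rule ext_starI) (use i2 p2 c qE in auto)
  then have "Cod C n \<in> E" using closed by blast
  then show ?thesis using n ker kerE unfolding ker_coker_in_def by blast
qed

text \<open>
  The snake lemma for the rows \<open>0 \<rightarrow> Dom i \<rightarrow> Dom f \<rightarrow> Cod p \<rightarrow> 0\<close> and
  \<open>0 \<rightarrow> Im (f i) \<rightarrow> Cod f \<rightarrow> Cod c \<rightarrow> 0\<close>, where \<open>c\<close> is the cokernel of \<open>f i\<close> and the left-hand vertical
  arrow is epi: with \<open>g\<close> the right-hand vertical arrow, the cokernel of \<open>f\<close> is that of \<open>g\<close>, and the kernel
  of \<open>f\<close> is an extension of the kernel of \<open>g\<close> by that of \<open>f i\<close>.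
\<close>

lemma ker_coker_from_extension:
  assumes closed: "ext_star C E E \<subseteq> E"
    and ip: "short_exact C i p" and f: "f \<in> Arr C" "Dom C f = Dom C p"
    and fi: "ker_coker_in C E (f \<bullet> i)"
    and IH: "\<And>g. \<lbrakk>g \<in> Arr C; Dom C g = Cod C p; Cod C g \<in> E\<rbrakk> \<Longrightarrow> ker_coker_in C E g"
  shows "ker_coker_in C E f"
proof -
  note i' = short_exact_arr[OF ip]
  have b: "is_kernel C p i" "is_cokernel C i p" "is_mono C i" "is_epi C p"
    using ip kernel_mono cokernel_epi unfolding short_exact_def by blast+
  obtain a c where a: "is_kernel C (f \<bullet> i) a" "Dom C a \<in> E" and c: "is_cokernel C (f \<bullet> i) c" "Cod C c \<in> E"
    using fi unfolding ker_coker_in_def by blast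
  note a' = kernel_arr[OF a(1)] and c' = cokernel_arr[OF c(1)]
  have ad: "Cod C a = Dom C i" "Dom C c = Cod C f" using a' c' f i' by auto
  have "(c \<bullet> f) \<bullet> i = Zero C (Dom C i) (Cod C c)" using c' f i' by simp
  then obtain g where g: "g \<in> Arr C" "Dom C g = Cod C p" "Cod C g = Cod C c" "g \<bullet> p = c \<bullet> f"
    using cokernel_factor[OF b(2), of "c \<bullet> f"] c' f i' by auto
  obtain a2 c2 where a2: "is_kernel C g a2" "Dom C a2 \<in> E" and c2: "is_cokernel C g c2" "Cod C c2 \<in> E"
    using IH[OF g(1,2)] g(3) c(2) unfolding ker_coker_in_def by auto
  note a2' = kernel_arr[OF a2(1)] and c2' = cokernel_arr[OF c2(1)]

  have coker: "is_cokernel C f (c2 \<bullet> c)"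
  proof (rule cokernelI)
    show "is_epi C (c2 \<bullet> c)" by (rule epi_comp) (use cokernel_epi c c2 c2' g in auto)
    have "c2 \<bullet> (c \<bullet> f) = (c2 \<bullet> g) \<bullet> p" unfolding g(4)[symmetric] using c2'(1-3) g(1-3) i' by simp
    also have "\<dots> = Zero C (Dom C f) (Cod C c2)" unfolding c2'(4) using c2'(1-3) g(1-3) i' f by simp
    finally show "(c2 \<bullet> c) \<bullet> f = Zero C (Dom C f) (Cod C (c2 \<bullet> c))" using c2'(1-3) g(1-3) c' ad f by simp
    fix h assume h: "h \<in> Arr C" "Dom C h = Cod C f" "h \<bullet> f = Zero C (Dom C f) (Cod C h)"
    have "h \<bullet> (f \<bullet> i) = (h \<bullet> f) \<bullet> i" using h(1,2) f i' by simp
    also have "\<dots> = Zero C (Dom C i) (Cod C h)" unfolding h(3) using h(1,2) f i' by simp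
    finally obtain u where u: "u \<in> Arr C" "Dom C u = Cod C c" "Cod C u = Cod C h" "u \<bullet> c = h"
      using cokernel_factor[OF c(1), of h] h(1,2) f i' by auto
    have "(u \<bullet> g) \<bullet> p = u \<bullet> (c \<bullet> f)" unfolding g(4)[symmetric] using u(1-3) g(1-3) i' by simp
    also have "\<dots> = (u \<bullet> c) \<bullet> f" using u(1-3) c'(1-3) ad f by simp
    also have "\<dots> = Zero C (Dom C p) (Cod C u)" unfolding u(4) h(3) using f u by simp
    finally have "u \<bullet> g = Zero C (Dom C g) (Cod C u)"
      using epi_zeroD[OF b(4), of "u \<bullet> g"] u(1-3) g(1-3) by simp
    then obtain v where v: "v \<in> Arr C" "Dom C v = Cod C c2" "Cod C v = Cod C u" "v \<bullet> c2 = u"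
      using cokernel_factor[OF c2(1), of u] u(1-3) g(1-3) by auto
    have "v \<bullet> (c2 \<bullet> c) = (v \<bullet> c2) \<bullet> c" using v(1-3) c2'(1-3) g(1-3) c'(1-3) by simp
    then show "\<exists>v. v \<in> Arr C \<and> Dom C v = Cod C (c2 \<bullet> c) \<and> Cod C v = Cod C h \<and> v \<bullet> (c2 \<bullet> c) = h"
      using v u c2' g(1-3) c' by (intro exI[of _ v]) simp
  qed (use f c2' g(1-3) c' ad in auto)
  have cokerE: "Cod C (c2 \<bullet> c) \<in> E" using c2 c2' g(1-3) c' by simp

  obtain n where n: "is_kernel C f n" using kernels[OF f(1)] ..
  note n' = kernel_arr[OF n]
  have "g \<bullet> (p \<bullet> n) = c \<bullet> (f \<bullet> n)"
    by (rule comp_cong_left[OF g(4)]) (use f i' g(1-3) c' n' ad in auto)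
  also have "\<dots> = Zero C (Dom C n) (Cod C g)" unfolding n'(4) using f n' c' ad g(1-3) by simp
  finally obtain p2 where p2: "p2 \<in> Arr C" "Dom C p2 = Dom C n" "Cod C p2 = Dom C a2" "a2 \<bullet> p2 = p \<bullet> n"
    using kernel_factor[OF a2(1), of "p \<bullet> n"] n' f i' g(1-3) by auto
  have "f \<bullet> (i \<bullet> a) = Zero C (Dom C a) (Cod C f)" using a' f i' by simp
  then obtain i2 where i2: "i2 \<in> Arr C" "Dom C i2 = Dom C a" "Cod C i2 = Dom C n" "n \<bullet> i2 = i \<bullet> a"
    using kernel_factor[OF n, of "i \<bullet> a"] a' ad f i' by auto
  have ia: "is_mono C (i \<bullet> a)" by (rule mono_comp) (use kernel_mono a b ad in auto)
  have "is_mono C i2"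
  proof (rule mono_zeroI[OF i2(1)])
    fix w assume w: "w \<in> Arr C" "Cod C w = Dom C i2" "i2 \<bullet> w = Zero C (Dom C w) (Cod C i2)"
    have "(i \<bullet> a) \<bullet> w = n \<bullet> (i2 \<bullet> w)" unfolding i2(4)[symmetric] using w(1,2) i2(1-3) n' by simp
    also have "\<dots> = Zero C (Dom C w) (Cod C n)" unfolding w(3) using w(1) i2(1-3) n' by simp
    finally show "w = Zero C (Dom C w) (Dom C i2)"
      using mono_zeroD[OF ia, of w] w i2 n' f i' a' ad by simp
  qed
  then have i2p2: "is_kernel C p2 i2"
  proof (rule kernelI)
    have "a2 \<bullet> (p2 \<bullet> i2) = p \<bullet> (n \<bullet> i2)"
      by (rule comp_cong_left[OF p2(4)]) (use a2' p2 i2 n' i' f g in auto)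
    also have "\<dots> = (p \<bullet> i) \<bullet> a" unfolding i2(4) using i'(1-3) a' ad by simp
    also have "\<dots> = Zero C (Dom C i2) (Cod C a2)" unfolding i'(4) using i'(1-3) a' ad i2 a2' g by simp
    finally show "p2 \<bullet> i2 = Zero C (Dom C i2) (Cod C p2)"
      using mono_zeroD[OF kernel_mono[OF a2(1)], of "p2 \<bullet> i2"] p2 i2 by simp
    fix h assume h: "h \<in> Arr C" "Cod C h = Dom C p2" "p2 \<bullet> h = Zero C (Dom C h) (Cod C p2)"
    have "p \<bullet> (n \<bullet> h) = a2 \<bullet> (p2 \<bullet> h)"
      by (rule comp_cong_left[OF p2(4)[symmetric]]) (use a2' p2 i2 n' i' f g h in auto)
    also have "\<dots> = Zero C (Dom C h) (Cod C p)" unfolding h(3) using h(1) a2' p2 g by simp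
    finally obtain u where u: "u \<in> Arr C" "Dom C u = Dom C h" "Cod C u = Dom C i" "i \<bullet> u = n \<bullet> h"
      using kernel_factor[OF b(1), of "n \<bullet> h"] n' h(1,2) p2 f i' by auto
    have "(f \<bullet> i) \<bullet> u = f \<bullet> (n \<bullet> h)" unfolding u(4)[symmetric] using f i' u(1-3) by simp
    also have "\<dots> = (f \<bullet> n) \<bullet> h" using n'(1-3) h(1,2) p2 by simp
    also have "\<dots> = Zero C (Dom C u) (Cod C (f \<bullet> i))" unfolding n'(4) using n'(1-3) h(1,2) p2 u f i' by simp
    finally obtain v where v: "v \<in> Arr C" "Dom C v = Dom C u" "Cod C v = Dom C a" "a \<bullet> v = u"
      using kernel_factor[OF a(1), of u] u(1-3) f i' by auto
    have "i2 \<bullet> v = h"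
    proof (rule mono_cancel[OF kernel_mono[OF n]])
      have "n \<bullet> (i2 \<bullet> v) = i \<bullet> (a \<bullet> v)"
        by (rule comp_cong_left[OF i2(4)]) (use n' i2 v a' ad i' f in auto)
      then show "n \<bullet> (i2 \<bullet> v) = n \<bullet> h" unfolding v(4) u(4) .
    qed (use i2 v u h p2 in auto)
    then show "\<exists>v. v \<in> Arr C \<and> Dom C v = Dom C h \<and> Cod C v = Dom C i2 \<and> i2 \<bullet> v = h"
      using v u i2 by (intro exI[of _ v]) simp
  qed (use p2 i2 in auto)
  have "is_epi C p2"
  proof -
    obtain s x where s: "is_epi C s" "Cod C s = Dom C a2" "x \<in> Arr C" "Dom C x = Dom C s"
      "Cod C x = Dom C p" "p \<bullet> x = a2 \<bullet> s"
      using lift_along_epi[OF b(4), of a2] a2' g by auto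
    have sa: "s \<in> Arr C" using epi_arr s by auto
    have "c \<bullet> (f \<bullet> x) = g \<bullet> (p \<bullet> x)"
      by (rule comp_cong_left[OF g(4)[symmetric]]) (use f i' g(1-3) c' s ad in auto)
    also have "\<dots> = (g \<bullet> a2) \<bullet> s" unfolding s(6) using a2'(1-3) s sa by simp
    also have "\<dots> = Zero C (Dom C (f \<bullet> x)) (Cod C c)"
      unfolding a2'(4) using a2'(1-3) s sa f g(1-3) c' ad by simp
    finally obtain t y where t: "is_epi C t" "Cod C t = Dom C (f \<bullet> x)" "y \<in> Arr C" "Dom C y = Dom C t"
      "Cod C y = Dom C (f \<bullet> i)" "(f \<bullet> i) \<bullet> y = (f \<bullet> x) \<bullet> t"
      using lift_along_exact[OF c(1), of "f \<bullet> x"] f s i' by auto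
    have ta: "t \<in> Arr C" "Cod C t = Dom C s" "Cod C y = Dom C i" using epi_arr t f s i' by auto
    \<comment> \<open>\<open>c\<close> kills \<open>f x\<close>, so \<open>f x\<close> comes from \<open>Dom i\<close>; subtracting that element puts \<open>x\<close> into the kernel of \<open>f\<close>.\<close>
    obtain z where z: "z \<in> Arr C" "Dom C z = Dom C (i \<bullet> y)" "Cod C z = Cod C (i \<bullet> y)"
      "x \<bullet> t = z \<oplus> (i \<bullet> y)"
      by (rule difference[of "x \<bullet> t" "i \<bullet> y"]) (use s t ta i' in auto)
    have zd: "Dom C z = Dom C t" "Cod C z = Dom C f" using z t ta i' f by auto
    have "f \<bullet> (x \<bullet> t) = f \<bullet> z \<oplus> f \<bullet> (i \<bullet> y)" unfolding z(4) using z(1) zd f i' t ta by simp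
    moreover have "f \<bullet> (x \<bullet> t) = f \<bullet> (i \<bullet> y)" using t(6) f s i' t(1-5) ta by simp
    ultimately have "f \<bullet> z = Zero C (Dom C z) (Cod C f)"
      using Add_eq_right_imp_Zero[of "f \<bullet> z" "f \<bullet> (i \<bullet> y)"] z(1) zd f i' t ta by simp
    then obtain v where v: "v \<in> Arr C" "Dom C v = Dom C z" "Cod C v = Dom C n" "n \<bullet> v = z"
      using kernel_factor[OF n, of z] z(1) zd by auto
    have "p \<bullet> (i \<bullet> y) = (p \<bullet> i) \<bullet> y" using i'(1-3) t ta by simp
    also have "\<dots> = Zero C (Dom C t) (Cod C p)" unfolding i'(4) using i'(1-3) t ta by simp
    finally have piy: "p \<bullet> (i \<bullet> y) = Zero C (Dom C t) (Cod C p)" .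
    have "p \<bullet> (x \<bullet> t) = p \<bullet> z \<oplus> p \<bullet> (i \<bullet> y)" unfolding z(4) using z(1) zd f i' t ta by simp
    then have px: "p \<bullet> (x \<bullet> t) = p \<bullet> z" unfolding piy using z(1) zd f i' t ta by simp
    have "p2 \<bullet> v = s \<bullet> t"
    proof (rule mono_cancel[OF kernel_mono[OF a2(1)]])
      have "a2 \<bullet> (p2 \<bullet> v) = p \<bullet> (n \<bullet> v)"
        by (rule comp_cong_left[OF p2(4)]) (use a2' p2 v n' i' f g in auto)
      also have "\<dots> = p \<bullet> (x \<bullet> t)" unfolding v(4) px ..
      also have "\<dots> = a2 \<bullet> (s \<bullet> t)"
        by (rule comp_cong_left[OF s(6)]) (use a2' s sa ta t g i' in auto)
      finally show "a2 \<bullet> (p2 \<bullet> v) = a2 \<bullet> (s \<bullet> t)" .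
    qed (use p2 v sa s ta t zd in auto)
    moreover have "is_epi C (s \<bullet> t)" by (rule epi_comp) (use s t ta in auto)
    ultimately show ?thesis using epi_cancel_left[of p2 v] p2 v by simp
  qed
  then have "short_exact C i2 p2" using epi_kernel_short_exact i2p2 by blast
  then have "Dom C n \<in> ext_star C E E" by (rule ext_starI) (use i2 p2 a a2 in auto)
  then have "Dom C n \<in> E" using closed by blast
  then show ?thesis using n coker cokerE unfolding ker_coker_in_def by blast
qed

text \<open>
  Arrows out of \<open>S\<close> come first, by induction on the number of extension steps of the target; the source
  varies in this induction, as the kernel of the arrow to the top quotient takes its place. Arrows out of
  the \<open>k\<close>-th extension power follow by induction on \<open>k\<close>. There the first part is applied to an arrow into
  the cokernel of \<open>f i\<close>, which may lie anywhere in the closure.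
\<close>

lemma ext_closure_ker_coker:
  assumes S: "\<And>f. \<lbrakk>f \<in> Arr C; Dom C f \<in> S; Cod C f \<in> S\<rbrakk> \<Longrightarrow> factors_in C S f"
    and f: "f \<in> Arr C" "Dom C f \<in> ext_closure C S" "Cod C f \<in> ext_closure C S"
  shows "ker_coker_in C (ext_closure C S) f"
proof -
  let ?E = "ext_closure C S"
  have SE: "S \<subseteq> ?E" by (rule subset_ext_closure)
  have from_S: "ker_coker_in C ?E f"
    if "f \<in> Arr C" "Dom C f \<in> S" "Cod C f \<in> ext_pow C S k" for f k
    using that
  proof (induction k arbitrary: f)
    case 0
    then show ?case
      using factors_in_imp_ker_coker_in[OF S[of f]] SE unfolding ker_coker_in_def by auto
  next
    case (Suc l)
    then have "Cod C f \<in> ext_star C (ext_pow C S l) S" by simp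
    then obtain i p where ip: "short_exact C i p" "Dom C i \<in> ext_pow C S l" "Cod C i = Cod C f"
      "Dom C p = Cod C f" "Cod C p \<in> S"
      by (rule ext_starE)
    have "factors_in C S (p \<bullet> f)"
      by (rule S) (use Suc.prems ip short_exact_arr[OF ip(1)] in auto)
    then obtain k e m q where k: "short_exact C k e" "short_exact C m q" "Cod C e = Dom C m"
      "p \<bullet> f = m \<bullet> e" "Dom C k \<in> S" "Cod C q \<in> S"
      unfolding factors_in_def by blast
    show ?case
    proof (rule ker_coker_into_extension[OF ext_closure_closed ip(1) _ _ k(1-4)])
      show "ker_coker_in C ?E g" if "g \<in> Arr C" "Dom C g = Dom C k" "Cod C g = Dom C i" for g
        by (rule Suc.IH) (use that k ip in auto)
    qed (use Suc.prems k ip SE in auto)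
  qed
  have from_pow: "ker_coker_in C ?E f"
    if "f \<in> Arr C" "Dom C f \<in> ext_pow C S k" "Cod C f \<in> ?E" for f k
    using that
  proof (induction k arbitrary: f)
    case 0
    then show ?case using from_S unfolding ext_closure_def by auto
  next
    case (Suc l)
    then have "Dom C f \<in> ext_star C (ext_pow C S l) S" by simp
    then obtain i p where ip: "short_exact C i p" "Dom C i \<in> ext_pow C S l" "Cod C i = Dom C f"
      "Dom C p = Dom C f" "Cod C p \<in> S"
      by (rule ext_starE)
    show ?case
    proof (rule ker_coker_from_extension[OF ext_closure_closed ip(1)])
      show "ker_coker_in C ?E (f \<bullet> i)"
        by (rule Suc.IH) (use Suc.prems ip short_exact_arr[OF ip(1)] in auto)
      show "ker_coker_in C ?E g" if "g \<in> Arr C" "Dom C g = Cod C p" "Cod C g \<in> ?E" for g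
        using from_S[of g] that ip unfolding ext_closure_def by auto
    qed (use Suc.prems ip in auto)
  qed
  then show ?thesis using f unfolding ext_closure_def by blast
qed

end

section \<open>Full abelian subcategories\<close>

lemma full_subcat_simps [simp]:
  "Ob (full_subcat C S) = Ob C \<inter> S"
  "Arr (full_subcat C S) = {f \<in> Arr C. Dom C f \<in> S \<and> Cod C f \<in> S}"
  "Dom (full_subcat C S) = Dom C" "Cod (full_subcat C S) = Cod C"
  "Ident (full_subcat C S) = Ident C" "Comp (full_subcat C S) = Comp C"
  by (simp_all add: full_subcat_def)

lemma full_subcat_additive_simps [simp]:
  "Add (full_subcat C S) = Add C" "Zero (full_subcat C S) = Zero C"
  by (simp_all add: full_subcat_def)

lemma homset_full_subcat:
  "homset (full_subcat C S) X Y = (if X \<in> S \<and> Y \<in> S then homset C X Y else {})"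
  by (auto simp: homset_def)

lemma is_isomorphism_full_subcat [simp]:
  "is_isomorphism (full_subcat C S) f \<longleftrightarrow> is_isomorphism C f \<and> Dom C f \<in> S \<and> Cod C f \<in> S"
  by (auto simp: is_isomorphism_def homset_full_subcat)

lemma (in category) category_full_subcat: "category (full_subcat C S)"
proof
  fix X Y W V f g h
  show "f \<in> homset (full_subcat C S) X Y \<Longrightarrow> g \<in> homset (full_subcat C S) Y W \<Longrightarrow>
      h \<in> homset (full_subcat C S) W V \<Longrightarrow>
      Comp (full_subcat C S) (Comp (full_subcat C S) h g) f =
      Comp (full_subcat C S) h (Comp (full_subcat C S) g f)"
    by (auto simp: homset_iff homset_def)
qed (auto simp: homset_iff homset_def)

locale full_abelian_subcategory = abelian_category C
  for C :: "('o, 'm, 'z) abcat_scheme" (structure) +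
  fixes E :: "'o set"
  assumes sub_Ob: "E \<subseteq> Ob C"
    and sub_zero: "\<exists>X\<in>E. is_zero_object C X"
    and sub_ext: "ext_star C E E \<subseteq> E"
    and sub_ker_coker: "\<lbrakk>f \<in> Arr C; Dom C f \<in> E; Cod C f \<in> E\<rbrakk> \<Longrightarrow> ker_coker_in C E f"
begin

abbreviation sub where "sub \<equiv> full_subcat C E"

lemma Ob_sub [simp]: "Ob C \<inter> E = E"
  using sub_Ob by blast

lemma preadditive_sub: "preadditive_category sub"
proof (rule preadditive_category.intro)
  show "category sub" by (rule category_full_subcat)
  show "preadditive_category_axioms sub"
  proof (rule preadditive_category_axioms.intro)
    fix X Y assume "X \<in> Ob sub" "Y \<in> Ob sub"
    then have "hom_group sub X Y = hom_group C X Y" "X \<in> Ob C" "Y \<in> Ob C"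
      using sub_Ob by (auto simp: hom_group_def homset_full_subcat)
    then show "comm_group (hom_group sub X Y)" using hom_comm_group by simp
  qed (auto simp: homset_def)
qed

interpretation sub: preadditive_category sub by (rule preadditive_sub)

lemma kernel_sub:
  assumes "is_kernel C f k" "Dom C f \<in> E" "Cod C f \<in> E" "Dom C k \<in> E"
  shows "is_kernel sub f k"
  using assms unfolding is_kernel_def by (auto simp: homset_full_subcat)

lemma cokernel_sub:
  assumes "is_cokernel C f k" "Dom C f \<in> E" "Cod C f \<in> E" "Cod C k \<in> E"
  shows "is_cokernel sub f k"
  using assms unfolding is_cokernel_def by (auto simp: homset_full_subcat)

text \<open>
  The ambient kernel lies in the subcategory and is a kernel there too, so the two are isomorphic.
\<close>

lemma kernel_ambient:
  assumes k: "is_kernel sub f k"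
  shows "is_kernel C f k"
proof -
  have f: "f \<in> Arr C" "Dom C f \<in> E" "Cod C f \<in> E"
    and k': "k \<in> Arr C" "Cod C k = Dom C f" "Dom C k \<in> E" "f \<bullet> k = Zero C (Dom C k) (Cod C f)"
    using sub.kernel_arr[OF k] by auto
  obtain l where l: "is_kernel C f l" "Dom C l \<in> E"
    using sub_ker_coker[OF f] unfolding ker_coker_in_def by blast
  note l' = kernel_arr[OF l(1)]
  obtain u where u: "u \<in> Arr C" "Dom C u = Dom C l" "Cod C u = Dom C k" "k \<bullet> u = l"
    using sub.kernel_factor[OF k, of l] l' l(2) f by auto
  obtain w where w: "w \<in> Arr C" "Dom C w = Dom C k" "Cod C w = Dom C l" "l \<bullet> w = k"
    using kernel_factor[OF l(1), of k] k' by auto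
  have "k \<bullet> (u \<bullet> w) = (k \<bullet> u) \<bullet> w" using u(1-3) w(1-3) k' by simp
  also have "\<dots> = k" unfolding u(4) w(4) ..
  finally have uw: "u \<bullet> w = Ident C (Dom C k)"
    using sub.mono_cancel[OF sub.kernel_mono[OF k], of "u \<bullet> w" "Ident C (Dom C k)"]
      u(1-3) w(1-3) k' l' l(2) by simp
  show ?thesis
  proof (rule kernelI)
    show "is_mono C k"
    proof (rule mono_zeroI)
      fix g assume g: "g \<in> Arr C" "Cod C g = Dom C k" "k \<bullet> g = Zero C (Dom C g) (Cod C k)"
      have "l \<bullet> (w \<bullet> g) = (l \<bullet> w) \<bullet> g" using g(1,2) w(1-3) l' by simp
      also have "\<dots> = Zero C (Dom C g) (Cod C l)" unfolding w(4) g(3) using k' l' by simp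
      finally have "w \<bullet> g = Zero C (Dom C g) (Dom C l)"
        using mono_zeroD[OF kernel_mono[OF l(1)], of "w \<bullet> g"] g(1,2) w(1-3) by simp
      then have "u \<bullet> (w \<bullet> g) = Zero C (Dom C g) (Dom C k)" using g(1) u(1-3) by simp
      moreover have "u \<bullet> (w \<bullet> g) = (u \<bullet> w) \<bullet> g" using g(1,2) w(1-3) u(1-3) by simp
      ultimately show "g = Zero C (Dom C g) (Dom C k)" unfolding uw using g(1,2) by simp
    qed (fact k')
    fix h assume h: "h \<in> Arr C" "Cod C h = Dom C f" "f \<bullet> h = Zero C (Dom C h) (Cod C f)"
    then obtain v where v: "v \<in> Arr C" "Dom C v = Dom C h" "Cod C v = Dom C l" "l \<bullet> v = h"
      by (rule kernel_factor[OF l(1)]) blast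
    have "k \<bullet> (u \<bullet> v) = (k \<bullet> u) \<bullet> v" using u(1-3) v(1-3) k' by simp
    also have "\<dots> = h" unfolding u(4) v(4) ..
    finally show "\<exists>v. v \<in> Arr C \<and> Dom C v = Dom C h \<and> Cod C v = Dom C k \<and> k \<bullet> v = h"
      using u(1-3) v(1-3) by (intro exI[of _ "u \<bullet> v"]) simp
  qed (use f k' in auto)
qed

lemma cokernel_ambient:
  assumes k: "is_cokernel sub f k"
  shows "is_cokernel C f k"
proof -
  have f: "f \<in> Arr C" "Dom C f \<in> E" "Cod C f \<in> E"
    and k': "k \<in> Arr C" "Dom C k = Cod C f" "Cod C k \<in> E" "k \<bullet> f = Zero C (Dom C f) (Cod C k)"
    using sub.cokernel_arr[OF k] by auto
  obtain l where l: "is_cokernel C f l" "Cod C l \<in> E"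
    using sub_ker_coker[OF f] unfolding ker_coker_in_def by blast
  note l' = cokernel_arr[OF l(1)]
  obtain u where u: "u \<in> Arr C" "Dom C u = Cod C k" "Cod C u = Cod C l" "u \<bullet> k = l"
    using sub.cokernel_factor[OF k, of l] l' l(2) f by auto
  obtain w where w: "w \<in> Arr C" "Dom C w = Cod C l" "Cod C w = Cod C k" "w \<bullet> l = k"
    using cokernel_factor[OF l(1), of k] k' by auto
  have "(w \<bullet> u) \<bullet> k = w \<bullet> (u \<bullet> k)" using u(1-3) w(1-3) k' by simp
  also have "\<dots> = k" unfolding u(4) w(4) ..
  finally have wu: "w \<bullet> u = Ident C (Cod C k)"
    using sub.epi_cancel[OF sub.cokernel_epi[OF k], of "w \<bullet> u" "Ident C (Cod C k)"]
      u(1-3) w(1-3) k' l' l(2) by simp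
  show ?thesis
  proof (rule cokernelI)
    show "is_epi C k"
    proof (rule epi_zeroI)
      fix g assume g: "g \<in> Arr C" "Dom C g = Cod C k" "g \<bullet> k = Zero C (Dom C k) (Cod C g)"
      have "(g \<bullet> w) \<bullet> l = g \<bullet> (w \<bullet> l)" using g(1,2) w(1-3) l' by simp
      also have "\<dots> = Zero C (Dom C l) (Cod C g)" unfolding w(4) g(3) using k' l' by simp
      finally have "g \<bullet> w = Zero C (Cod C l) (Cod C g)"
        using epi_zeroD[OF cokernel_epi[OF l(1)], of "g \<bullet> w"] g(1,2) w(1-3) by simp
      then have "(g \<bullet> w) \<bullet> u = Zero C (Cod C k) (Cod C g)" using g(1) u(1-3) by simp
      moreover have "(g \<bullet> w) \<bullet> u = g \<bullet> (w \<bullet> u)" using g(1,2) w(1-3) u(1-3) by simp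
      ultimately show "g = Zero C (Cod C k) (Cod C g)" unfolding wu using g(1,2) by simp
    qed (fact k')
    fix h assume h: "h \<in> Arr C" "Dom C h = Cod C f" "h \<bullet> f = Zero C (Dom C f) (Cod C h)"
    then obtain v where v: "v \<in> Arr C" "Dom C v = Cod C l" "Cod C v = Cod C h" "v \<bullet> l = h"
      by (rule cokernel_factor[OF l(1)]) blast
    have "(v \<bullet> u) \<bullet> k = v \<bullet> (u \<bullet> k)" using u(1-3) v(1-3) k' by simp
    also have "\<dots> = h" unfolding u(4) v(4) ..
    finally show "\<exists>v. v \<in> Arr C \<and> Dom C v = Cod C k \<and> Cod C v = Cod C h \<and> v \<bullet> k = h"
      using u(1-3) v(1-3) by (intro exI[of _ "v \<bullet> u"]) simp
  qed (use f k' in auto)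
qed

lemma short_exact_sub_iff:
  "short_exact sub i p \<longleftrightarrow> short_exact C i p \<and> Dom C i \<in> E \<and> Cod C i \<in> E \<and> Cod C p \<in> E"
proof
  assume a: "short_exact sub i p"
  then have "short_exact C i p" using kernel_ambient cokernel_ambient unfolding short_exact_def by blast
  then show "short_exact C i p \<and> Dom C i \<in> E \<and> Cod C i \<in> E \<and> Cod C p \<in> E"
    using sub.short_exact_arr[OF a] by simp
next
  assume a: "short_exact C i p \<and> Dom C i \<in> E \<and> Cod C i \<in> E \<and> Cod C p \<in> E"
  then have "Cod C i = Dom C p" using short_exact_arr(3) by blast
  then show "short_exact sub i p"
    using a kernel_sub[of p i] cokernel_sub[of i p] unfolding short_exact_def by simp
qed

text \<open>
  The ambient kernel of \<open>f\<close> lies in the subcategory, where \<open>f\<close> is mono; so this kernel vanishes.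
\<close>

lemma mono_ambient:
  assumes "is_mono sub f" shows "is_mono C f"
proof -
  have f: "f \<in> Arr C" "Dom C f \<in> E" "Cod C f \<in> E" using sub.mono_arr[OF assms] by auto
  obtain k where k: "is_kernel C f k" "Dom C k \<in> E"
    using sub_ker_coker[OF f] unfolding ker_coker_in_def by blast
  note k' = kernel_arr[OF k(1)]
  have k0: "k = Zero C (Dom C k) (Dom C f)"
    using sub.mono_zeroD[OF assms, of k] k' k f by simp
  show ?thesis
  proof (rule mono_zeroI[OF f(1)])
    fix g assume g: "g \<in> Arr C" "Cod C g = Dom C f" "f \<bullet> g = Zero C (Dom C g) (Cod C f)"
    then obtain u where u: "u \<in> Arr C" "Dom C u = Dom C g" "Cod C u = Dom C k" "k \<bullet> u = g"
      by (rule kernel_factor[OF k(1)]) blast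
    have "g = Zero C (Dom C k) (Dom C f) \<bullet> u" using u(4) k0 by simp
    then show "g = Zero C (Dom C g) (Dom C f)" using u(1-3) f by simp
  qed
qed

lemma epi_ambient:
  assumes "is_epi sub f" shows "is_epi C f"
proof -
  have f: "f \<in> Arr C" "Dom C f \<in> E" "Cod C f \<in> E" using sub.epi_arr[OF assms] by auto
  obtain k where k: "is_cokernel C f k" "Cod C k \<in> E"
    using sub_ker_coker[OF f] unfolding ker_coker_in_def by blast
  note k' = cokernel_arr[OF k(1)]
  have k0: "k = Zero C (Cod C f) (Cod C k)"
    using sub.epi_zeroD[OF assms, of k] k' k f by simp
  show ?thesis
  proof (rule epi_zeroI[OF f(1)])
    fix g assume g: "g \<in> Arr C" "Dom C g = Cod C f" "g \<bullet> f = Zero C (Dom C f) (Cod C g)"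
    then obtain u where u: "u \<in> Arr C" "Dom C u = Cod C k" "Cod C u = Cod C g" "u \<bullet> k = g"
      by (rule cokernel_factor[OF k(1)]) blast
    have "g = u \<bullet> Zero C (Cod C f) (Cod C k)" using u(4) k0 by simp
    then show "g = Zero C (Cod C f) (Cod C g)" using u(1-3) f by simp
  qed
qed

text \<open>
  Kernels and cokernels are the ambient ones, biproducts are extensions, and normality is inherited
  because monomorphisms and epimorphisms of the subcategory are so in the ambient category.
\<close>

lemma abelian_sub: "abelian_category sub"
proof (rule abelian_category.intro[OF preadditive_sub])
  show "abelian_category_axioms sub"
  proof
    obtain X where X: "X \<in> E" "is_zero_object C X" using sub_zero by blast
    then show "\<exists>X. is_zero_object sub X"
      using sub_Ob unfolding is_zero_object_def
      by (intro exI[of _ X]) (simp add: homset_full_subcat subset_iff)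
  next
    fix X Y assume "X \<in> Ob sub" "Y \<in> Ob sub"
    then have XY: "X \<in> E" "Y \<in> E" "X \<in> Ob C" "Y \<in> Ob C" using sub_Ob by auto
    obtain i j p q where a: "short_exact C i q" "j \<in> Arr C" "p \<in> Arr C"
      "Dom C i = X" "Cod C q = Y" "Dom C j = Y" "Cod C j = Cod C i" "Dom C p = Cod C i" "Cod C p = X"
      "p \<bullet> i = Ident C X" "q \<bullet> j = Ident C Y" "(i \<bullet> p) \<oplus> (j \<bullet> q) = Ident C (Cod C i)"
      using biproduct[OF XY(3,4)] .
    have P: "Cod C i \<in> E" using ext_starI[OF a(1), of E E] XY a(4,5) sub_ext by blast
    have "i \<in> homset sub X (Cod C i)" "j \<in> homset sub Y (Cod C i)"
      "p \<in> homset sub (Cod C i) X" "q \<in> homset sub (Cod C i) Y"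
      using a(1-9) P XY short_exact_arr[OF a(1)] by (simp_all add: homset_full_subcat homset_iff)
    then show "has_biproduct sub X Y"
      unfolding has_biproduct_def using a(10-12) P
      by (intro bexI[of _ "Cod C i"] bexI[of _ i] bexI[of _ j] bexI[of _ p] bexI[of _ q]) simp_all
  next
    fix f assume f: "f \<in> Arr sub"
    then have "ker_coker_in C E f" using sub_ker_coker by simp
    then show "\<exists>k. is_kernel sub f k" "\<exists>q. is_cokernel sub f q"
      using kernel_sub[of f] cokernel_sub[of f] f unfolding ker_coker_in_def by auto
  next
    fix f assume "is_mono sub f"
    then have m: "is_mono C f" and f: "f \<in> Arr C" "Dom C f \<in> E" "Cod C f \<in> E"
      using mono_ambient sub.mono_arr by auto
    then obtain q where q: "is_cokernel C f q" "Cod C q \<in> E"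
      using sub_ker_coker[of f] unfolding ker_coker_in_def by blast
    then have "is_kernel C q f" using mono_cokernel_short_exact[OF q(1) m] by (simp add: short_exact_def)
    then show "\<exists>g. is_kernel sub g f"
      using kernel_sub[of q f] f q cokernel_arr[OF q(1)] by auto
  next
    fix f assume "is_epi sub f"
    then have m: "is_epi C f" and f: "f \<in> Arr C" "Dom C f \<in> E" "Cod C f \<in> E"
      using epi_ambient sub.epi_arr by auto
    then obtain k where k: "is_kernel C f k" "Dom C k \<in> E"
      using sub_ker_coker[of f] unfolding ker_coker_in_def by blast
    then have "is_cokernel C k f" using epi_kernel_short_exact[OF k(1) m] by (simp add: short_exact_def)
    then show "\<exists>g. is_cokernel sub g f"
      using cokernel_sub[of k f] f k kernel_arr[OF k(1)] by auto
  qed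
qed

lemma ext_pow_sub:
  assumes "S \<subseteq> E"
  shows "ext_pow sub S k = ext_pow C S k" "ext_pow C S k \<subseteq> E"
proof -
  have *: "ext_pow C S k \<subseteq> E" for k
  proof (induction k)
    case (Suc k)
    then show ?case using ext_star_mono[OF Suc assms] sub_ext by auto
  qed (simp add: assms)
  then show "ext_pow C S k \<subseteq> E" .
  show "ext_pow sub S k = ext_pow C S k"
  proof (induction k)
    case (Suc k)
    have "ext_star sub (ext_pow C S k) S = ext_star C (ext_pow C S k) S"
    proof
      show "ext_star sub (ext_pow C S k) S \<subseteq> ext_star C (ext_pow C S k) S"
        using sub_Ob unfolding ext_star_def short_exact_sub_iff by auto
      have "ext_star C (ext_pow C S k) S \<subseteq> E" using *[of "Suc k"] by simp
      then show "ext_star C (ext_pow C S k) S \<subseteq> ext_star sub (ext_pow C S k) S"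
        using *[of k] assms sub_Ob unfolding ext_star_def short_exact_sub_iff
        by (simp only: full_subcat_simps Ob_sub) blast
    qed
    then show ?case using Suc by simp
  qed simp
qed

lemma exact_functor_sub_iff:
  "exact_functor A sub T \<longleftrightarrow> exact_functor A C T \<and> obmap T ` Ob A \<subseteq> E"
proof
  assume "exact_functor A sub T"
  then interpret T: exact_functor A sub T .
  have "exact_functor A C T"
  proof
    show "obmap T X \<in> Ob C" if "X \<in> Ob A" for X
      using T.obmap_Ob[OF that] sub_Ob by auto
    show "armap T f \<in> homset C (obmap T X) (obmap T Y)" if "f \<in> homset A X Y" for f X Y
      using T.armap_hom[OF that] by (simp add: homset_def)
    show "short_exact C (armap T i) (armap T p)" if "short_exact A i p" for i p
      using T.preserves_short_exact[OF that] by (simp add: short_exact_sub_iff)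
  qed (use T.armap_Ident T.armap_Comp T.armap_Add in auto)
  then show "exact_functor A C T \<and> obmap T ` Ob A \<subseteq> E" using T.obmap_Ob by auto
next
  assume T: "exact_functor A C T \<and> obmap T ` Ob A \<subseteq> E"
  then interpret T: exact_functor A C T by simp
  have E: "obmap T X \<in> E" if "X \<in> Ob A" for X using T that by auto
  interpret subab: abelian_category sub by (rule abelian_sub)
  have hom: "armap T f \<in> homset sub (obmap T X) (obmap T Y)" if "f \<in> homset A X Y" for f X Y
    using T.armap_hom[OF that] E[of X] E[of Y] that by (auto simp: homset_def)
  show "exact_functor A sub T"
  proof
    show "obmap T X \<in> Ob sub" if "X \<in> Ob A" for X using E[OF that] by simp
    show "armap T f \<in> homset sub (obmap T X) (obmap T Y)" if "f \<in> homset A X Y" for f X Y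
      by (rule hom[OF that])
    show "short_exact sub (armap T i) (armap T p)" if "short_exact A i p" for i p
    proof -
      note ip = T.source.short_exact_arr[OF that]
      have "armap T i \<in> homset sub (obmap T (Dom A i)) (obmap T (Cod A i))"
        "armap T p \<in> homset sub (obmap T (Dom A p)) (obmap T (Cod A p))"
        using ip by (auto intro!: hom simp: T.source.homset_iff)
      then show ?thesis using T.preserves_short_exact[OF that]
        by (auto simp: short_exact_sub_iff homset_def)
    qed
  qed (use T.armap_Ident T.armap_Comp T.armap_Add in auto)
qed

end

section \<open>Exact functors and their essential images\<close>

context abelian_category
begin

text \<open>
  Replaces the middle term of a short exact sequence by an isomorphic object; \<open>a\<close> and \<open>b\<close> are
  mutually inverse.
\<close>

lemma short_exact_conjugate:
  assumes ip: "short_exact C i p"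
    and a: "a \<in> Arr C" "b \<in> Arr C" "Dom C b = Cod C i" "Cod C b = Dom C a" "Cod C a = Cod C i"
    and ab: "a \<bullet> b = Ident C (Cod C i)" "b \<bullet> a = Ident C (Dom C a)"
  shows "short_exact C (b \<bullet> i) (p \<bullet> a)"
proof -
  note i' = short_exact_arr[OF ip]
  have k: "is_kernel C p i" "is_epi C p" "is_mono C i"
    using ip cokernel_epi kernel_mono unfolding short_exact_def by blast+
  have iso: "is_isomorphism C b"
    unfolding is_isomorphism_def using a ab by (intro conjI bexI[of _ a]) (simp_all add: homset_iff)
  have "is_epi C a"
  proof (rule epi_zeroI[OF a(1)])
    fix g assume g: "g \<in> Arr C" "Dom C g = Cod C a" "g \<bullet> a = Zero C (Dom C a) (Cod C g)"
    have "g = g \<bullet> (a \<bullet> b)" unfolding ab using g(1,2) a by simp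
    also have "\<dots> = (g \<bullet> a) \<bullet> b" using g(1,2) a by simp
    also have "\<dots> = Zero C (Cod C a) (Cod C g)" unfolding g(3) using g(1) a by simp
    finally show "g = Zero C (Cod C a) (Cod C g)" .
  qed
  then have "is_epi C (p \<bullet> a)" by (rule epi_comp) (use k a i' in auto)
  moreover have "is_kernel C (p \<bullet> a) (b \<bullet> i)"
  proof (rule kernelI)
    show "is_mono C (b \<bullet> i)" by (rule mono_comp) (use k iso_mono iso a in auto)
    have "(p \<bullet> a) \<bullet> (b \<bullet> i) = p \<bullet> ((a \<bullet> b) \<bullet> i)" using a i' by simp
    also have "\<dots> = Zero C (Dom C i) (Cod C p)" unfolding ab using i' by simp
    finally show "(p \<bullet> a) \<bullet> (b \<bullet> i) = Zero C (Dom C (b \<bullet> i)) (Cod C (p \<bullet> a))" using a i' by simp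
    fix h assume h: "h \<in> Arr C" "Cod C h = Dom C (p \<bullet> a)"
      "(p \<bullet> a) \<bullet> h = Zero C (Dom C h) (Cod C (p \<bullet> a))"
    have hd: "Cod C h = Dom C a" using h(2) a i' by simp
    have "p \<bullet> (a \<bullet> h) = Zero C (Dom C h) (Cod C p)" using h(1,3) hd a i' by simp
    then obtain u where u: "u \<in> Arr C" "Dom C u = Dom C h" "Cod C u = Dom C i" "i \<bullet> u = a \<bullet> h"
      using kernel_factor[OF k(1), of "a \<bullet> h"] h(1) hd a i' by auto
    have "(b \<bullet> i) \<bullet> u = b \<bullet> (a \<bullet> h)" unfolding u(4)[symmetric] using a i' u(1-3) by simp
    also have "\<dots> = (b \<bullet> a) \<bullet> h" using a h(1) hd by simp
    also have "\<dots> = h" unfolding ab using h(1) hd by simp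
    finally show "\<exists>u. u \<in> Arr C \<and> Dom C u = Dom C h \<and> Cod C u = Dom C (b \<bullet> i) \<and> (b \<bullet> i) \<bullet> u = h"
      using u(1-3) a i' by (intro exI[of _ u]) simp
  qed (use a i' in auto)
  ultimately show ?thesis using epi_kernel_short_exact by blast
qed

lemma factors_in_Ob:
  assumes f: "f \<in> Arr C" shows "factors_in C (Ob C) f"
proof -
  obtain q where q: "is_cokernel C f q" using cokernels[OF f] ..
  note q' = cokernel_arr[OF q]
  obtain m where m: "is_kernel C q m" using kernels[OF q'(2)] ..
  note m' = kernel_arr[OF m]
  obtain e where e: "is_epi C e" "Dom C e = Dom C f" "Cod C e = Dom C m" "m \<bullet> e = f"
    using image_factorization[OF q m] .
  obtain k where k: "is_kernel C e k" using kernels[OF epi_arr[OF e(1)]] ..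
  have "short_exact C k e" "short_exact C m q"
    using epi_kernel_short_exact[OF k e(1)] cokernel_kernel_short_exact[OF q m] by auto
  then show ?thesis unfolding factors_in_def
    using e kernel_arr[OF k] m' by (metis Dom_Cod_Ob)
qed

end

context exact_functor
begin

lemma map_arr [simp]:
  assumes "f \<in> Arr A"
  shows "armap F f \<in> Arr B" "Dom B (armap F f) = obmap F (Dom A f)"
    "Cod B (armap F f) = obmap F (Cod A f)"
  using armap_hom[of f "Dom A f" "Cod A f"] assms
  by (auto simp: source.homset_iff target.homset_iff)

lemma map_Ident [simp]: "X \<in> Ob A \<Longrightarrow> armap F (Ident A X) = Ident B (obmap F X)"
  by (rule armap_Ident)

lemma map_Ob [simp]: "X \<in> Ob A \<Longrightarrow> obmap F X \<in> Ob B"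
  by (rule obmap_Ob)

lemma map_comp:
  assumes "f \<in> Arr A" "g \<in> Arr A" "Dom A g = Cod A f"
  shows "armap F (g \<bullet>\<^bsub>A\<^esub> f) = armap F g \<bullet>\<^bsub>B\<^esub> armap F f"
  using armap_Comp[of f "Dom A f" "Cod A f" g "Cod A g"] assms by (simp add: source.homset_iff)

lemma map_Zero:
  assumes "X \<in> Ob A" "Y \<in> Ob A"
  shows "armap F (Zero A X Y) = Zero B (obmap F X) (obmap F Y)"
proof -
  let ?z = "armap F (Zero A X Y)"
  have "?z \<oplus>\<^bsub>B\<^esub> ?z = ?z"
    using armap_Add[of "Zero A X Y" X Y "Zero A X Y"] assms by (simp add: source.homset_iff)
  then show ?thesis using target.Add_eq_right_imp_Zero[of ?z ?z] assms by simp
qed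

lemma map_isomorphism:
  assumes "is_isomorphism A f" shows "is_isomorphism B (armap F f)"
proof -
  have f: "f \<in> Arr A" using source.iso_arr[OF assms] .
  obtain g where g: "g \<in> Arr A" "Dom A g = Cod A f" "Cod A g = Dom A f"
    "g \<bullet>\<^bsub>A\<^esub> f = Ident A (Dom A f)" "f \<bullet>\<^bsub>A\<^esub> g = Ident A (Cod A f)"
    by (rule source.iso_inverse[OF assms]) blast
  show ?thesis unfolding is_isomorphism_def
    using f g map_comp[of f g] map_comp[of g f]
    by (intro conjI bexI[of _ "armap F g"]) (simp_all add: target.homset_iff)
qed

lemma map_isomorphic: "isomorphic A X Y \<Longrightarrow> isomorphic B (obmap F X) (obmap F Y)"
  using map_isomorphism source.iso_arr unfolding source.isomorphic_iff target.isomorphic_iff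
  by (metis map_arr(2,3))

lemma map_zero_object:
  assumes X: "is_zero_object A X" shows "is_zero_object B (obmap F X)"
proof -
  have Xo: "X \<in> Ob A" using X unfolding is_zero_object_def by blast
  let ?X = "obmap F X"
  have "Ident A X = Zero A X X"
    using X Xo source.Ident_hom[OF Xo] source.Zero_arr[OF Xo Xo]
    unfolding is_zero_object_def source.homset_iff by blast
  then have id: "Ident B ?X = Zero B ?X ?X" using map_Ident[OF Xo] map_Zero[OF Xo Xo] by simp
  have "f = Zero B W ?X" if "f \<in> homset B W ?X" for f W
  proof -
    have "f = Ident B ?X \<bullet>\<^bsub>B\<^esub> f" using that Xo by (simp add: target.homset_iff)
    then show ?thesis unfolding id using that Xo by (simp add: target.homset_iff)
  qed
  moreover have "f = Zero B ?X W" if "f \<in> homset B ?X W" for f W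
  proof -
    have "f = f \<bullet>\<^bsub>B\<^esub> Ident B ?X" using that Xo by (simp add: target.homset_iff)
    then show ?thesis unfolding id using that Xo by (auto simp: target.homset_iff)
  qed
  moreover have "Zero B W ?X \<in> homset B W ?X" "Zero B ?X W \<in> homset B ?X W" if "W \<in> Ob B" for W
    using that Xo by (simp_all add: target.homset_iff)
  ultimately show ?thesis unfolding is_zero_object_def using map_Ob[OF Xo] by blast
qed

lemma map_ext_pow:
  assumes "obmap F ` S \<subseteq> T"
  shows "obmap F ` ext_pow A S k \<subseteq> ext_pow B T k"
proof (induction k)
  case (Suc k)
  show ?case
  proof
    fix Y assume "Y \<in> obmap F ` ext_pow A S (Suc k)"
    then obtain X where X: "X \<in> ext_star A (ext_pow A S k) S" "Y = obmap F X" by auto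
    obtain i p where ip: "short_exact A i p" "Dom A i \<in> ext_pow A S k" "Cod A i = X" "Dom A p = X"
      "Cod A p \<in> S"
      using X(1) by (rule source.ext_starE)
    note ip' = source.short_exact_arr[OF ip(1)]
    have "Y \<in> ext_star B (ext_pow B T k) T"
      by (rule target.ext_starI[OF preserves_short_exact[OF ip(1)]])
        (use Suc assms ip X ip' in auto)
    then show "Y \<in> ext_pow B T (Suc k)" by simp
  qed
qed (simp add: assms)

text \<open>
  Up to isomorphism such an arrow is \<open>F g\<close> by fullness, and \<open>F\<close> carries the image factorization of \<open>g\<close>
  to one of \<open>F g\<close> by exactness.
\<close>

lemma ess_image_factors_in:
  assumes ff: "fully_faithful A B F"
    and f: "f \<in> Arr B" "Dom B f \<in> ess_image A B F" "Cod B f \<in> ess_image A B F"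
  shows "factors_in B (ess_image A B F) f"
proof -
  let ?S = "ess_image A B F"
  have FS: "obmap F X \<in> ?S" if "X \<in> Ob A" for X
    using that target.isomorphic_refl map_Ob unfolding ess_image_def by blast
  obtain X a where X: "X \<in> Ob A" "is_isomorphism B a" "Dom B a = Dom B f" "Cod B a = obmap F X"
    using f(2) unfolding ess_image_def target.isomorphic_iff by blast
  obtain Y b where Y: "Y \<in> Ob A" "is_isomorphism B b" "Dom B b = Cod B f" "Cod B b = obmap F Y"
    using f(3) unfolding ess_image_def target.isomorphic_iff by blast
  have ab: "a \<in> Arr B" "b \<in> Arr B" using X Y target.iso_arr by auto
  obtain a' where a': "a' \<in> Arr B" "Dom B a' = Cod B a" "Cod B a' = Dom B a"
    "a' \<bullet>\<^bsub>B\<^esub> a = Ident B (Dom B a)" "a \<bullet>\<^bsub>B\<^esub> a' = Ident B (Cod B a)"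
    by (rule target.iso_inverse[OF X(2)]) blast
  obtain b' where b': "b' \<in> Arr B" "Dom B b' = Cod B b" "Cod B b' = Dom B b"
    "b' \<bullet>\<^bsub>B\<^esub> b = Ident B (Dom B b)" "b \<bullet>\<^bsub>B\<^esub> b' = Ident B (Cod B b)"
    by (rule target.iso_inverse[OF Y(2)]) blast
  have "b \<bullet>\<^bsub>B\<^esub> (f \<bullet>\<^bsub>B\<^esub> a') \<in> homset B (obmap F X) (obmap F Y)"
    using ab a' X Y f by (simp add: target.homset_iff)
  then obtain g where "g \<in> homset A X Y" and Fg: "armap F g = b \<bullet>\<^bsub>B\<^esub> (f \<bullet>\<^bsub>B\<^esub> a')"
    using ff X(1) Y(1) unfolding fully_faithful_def bij_betw_def by (metis imageE)
  then have g: "g \<in> Arr A" "Dom A g = X" "Cod A g = Y" by (auto simp: source.homset_iff)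
  obtain k e m q where kq: "short_exact A k e" "short_exact A m q" "Cod A e = Dom A m"
    "g = m \<bullet>\<^bsub>A\<^esub> e"
    using source.factors_in_Ob[OF g(1)] unfolding factors_in_def by blast
  note k' = source.short_exact_arr[OF kq(1)] and m' = source.short_exact_arr[OF kq(2)]
  have d: "Dom A e = X" "Cod A m = Y" using g kq(3,4) k' m' by auto
  let ?k = "a' \<bullet>\<^bsub>B\<^esub> armap F k" and ?e = "armap F e \<bullet>\<^bsub>B\<^esub> a"
    and ?m = "b' \<bullet>\<^bsub>B\<^esub> armap F m" and ?q = "armap F q \<bullet>\<^bsub>B\<^esub> b"
  have "short_exact B ?k ?e"
    by (rule target.short_exact_conjugate[OF preserves_short_exact[OF kq(1)]])
      (use ab a' k' d X in simp_all)
  moreover have "short_exact B ?m ?q"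
    by (rule target.short_exact_conjugate[OF preserves_short_exact[OF kq(2)]])
      (use ab b' m' d Y in simp_all)
  moreover have "f = ?m \<bullet>\<^bsub>B\<^esub> ?e"
  proof -
    have "?m \<bullet>\<^bsub>B\<^esub> ?e = b' \<bullet>\<^bsub>B\<^esub> ((armap F m \<bullet>\<^bsub>B\<^esub> armap F e) \<bullet>\<^bsub>B\<^esub> a)"
      using ab a'(1-3) b'(1-3) k' m' d kq(3) X Y by simp
    also have "armap F m \<bullet>\<^bsub>B\<^esub> armap F e = b \<bullet>\<^bsub>B\<^esub> (f \<bullet>\<^bsub>B\<^esub> a')"
      using map_comp[of e m] Fg kq(3,4) k' m' by simp
    also have "b' \<bullet>\<^bsub>B\<^esub> ((b \<bullet>\<^bsub>B\<^esub> (f \<bullet>\<^bsub>B\<^esub> a')) \<bullet>\<^bsub>B\<^esub> a) =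
        (b' \<bullet>\<^bsub>B\<^esub> b) \<bullet>\<^bsub>B\<^esub> (f \<bullet>\<^bsub>B\<^esub> (a' \<bullet>\<^bsub>B\<^esub> a))"
      using ab a'(1-3) b'(1-3) f X Y by simp
    also have "\<dots> = f" unfolding a'(4) b'(4) using f X Y by simp
    finally show ?thesis ..
  qed
  moreover have "Dom B ?k \<in> ?S" "Cod B ?e \<in> ?S" "Cod B ?q \<in> ?S" "Cod B ?e = Dom B ?m"
    using FS ab a'(1-3) b'(1-3) k' m' d X Y kq(3) by simp_all
  ultimately show ?thesis unfolding factors_in_def by blast
qed

lemma full_abelian_subcategory_ext_closure:
  assumes ff: "fully_faithful A B F"
  shows "full_abelian_subcategory B (ext_closure B (ess_image A B F))"
proof (unfold_locales)
  let ?S = "ess_image A B F"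
  have "?S \<subseteq> Ob B" unfolding ess_image_def by blast
  then show "ext_closure B ?S \<subseteq> Ob B"
    using target.ext_pow_Ob[of ?S] unfolding ext_closure_def by blast
  obtain X where X: "is_zero_object A X" using source.zero_object ..
  then have "obmap F X \<in> ?S"
    using target.isomorphic_refl map_Ob unfolding ess_image_def is_zero_object_def by blast
  then show "\<exists>X\<in>ext_closure B ?S. is_zero_object B X"
    using map_zero_object[OF X] target.subset_ext_closure by blast
  show "ext_star B (ext_closure B ?S) (ext_closure B ?S) \<subseteq> ext_closure B ?S"
    by (rule target.ext_closure_closed)
  show "ker_coker_in B (ext_closure B ?S) f"
    if "f \<in> Arr B" "Dom B f \<in> ext_closure B ?S" "Cod B f \<in> ext_closure B ?S" for f
    using target.ext_closure_ker_coker[OF ess_image_factors_in[OF ff] that] .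
qed

end

section \<open>Natural isomorphisms\<close>

lemma comp_fctr_simps [simp]:
  "obmap (G \<circ>\<^sub>F F) X = obmap G (obmap F X)" "armap (G \<circ>\<^sub>F F) f = armap G (armap F f)"
  by (simp_all add: comp_fctr_def)

lemma id_fctr_simps [simp]: "obmap id_fctr X = X" "armap id_fctr f = f"
  by (simp_all add: id_fctr_def)

lemma comp_fctr_assoc: "(H \<circ>\<^sub>F G) \<circ>\<^sub>F F = H \<circ>\<^sub>F (G \<circ>\<^sub>F F)"
  by (simp add: comp_fctr_def comp_assoc)

lemma comp_fctr_id: "F \<circ>\<^sub>F id_fctr = F" "id_fctr \<circ>\<^sub>F F = F"
  by (simp_all add: comp_fctr_def id_fctr_def)

lemma exact_functor_id: "abelian_category A \<Longrightarrow> exact_functor A A id_fctr"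
  by (simp add: exact_functor_def exact_functor_axioms_def)

lemma exact_functor_comp:
  assumes "exact_functor A B F" "exact_functor B D G"
  shows "exact_functor A D (G \<circ>\<^sub>F F)"
proof -
  interpret F: exact_functor A B F by fact
  interpret G: exact_functor B D G by fact
  show ?thesis
  proof
    fix X Y W f g i p
    show "f \<in> homset A X Y \<Longrightarrow> armap (G \<circ>\<^sub>F F) f \<in> homset D (obmap (G \<circ>\<^sub>F F) X) (obmap (G \<circ>\<^sub>F F) Y)"
      using F.armap_hom G.armap_hom by simp
    show "f \<in> homset A X Y \<Longrightarrow> g \<in> homset A Y W \<Longrightarrow> armap (G \<circ>\<^sub>F F) (g \<bullet>\<^bsub>A\<^esub> f) =
        armap (G \<circ>\<^sub>F F) g \<bullet>\<^bsub>D\<^esub> armap (G \<circ>\<^sub>F F) f"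
      using F.armap_Comp G.armap_Comp[OF F.armap_hom F.armap_hom] by simp
    show "f \<in> homset A X Y \<Longrightarrow> g \<in> homset A X Y \<Longrightarrow> armap (G \<circ>\<^sub>F F) (f \<oplus>\<^bsub>A\<^esub> g) =
        armap (G \<circ>\<^sub>F F) f \<oplus>\<^bsub>D\<^esub> armap (G \<circ>\<^sub>F F) g"
      using F.armap_Add G.armap_Add[OF F.armap_hom F.armap_hom] by simp
    show "short_exact A i p \<Longrightarrow> short_exact D (armap (G \<circ>\<^sub>F F) i) (armap (G \<circ>\<^sub>F F) p)"
      using F.preserves_short_exact G.preserves_short_exact by simp
  qed simp_all
qed

lemma (in exact_functor) nat_iso_arr:
  assumes "nat_iso A B F G \<psi>" "X \<in> Ob A"
  shows "\<psi> X \<in> Arr B" "Dom B (\<psi> X) = obmap F X" "Cod B (\<psi> X) = obmap G X" "is_isomorphism B (\<psi> X)"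
  using assms by (auto simp: nat_iso_def target.homset_iff)

lemma nat_iso_natural:
  "\<lbrakk>nat_iso A B F G \<psi>; f \<in> Arr A\<rbrakk> \<Longrightarrow> armap G f \<bullet>\<^bsub>B\<^esub> \<psi> (Dom A f) = \<psi> (Cod A f) \<bullet>\<^bsub>B\<^esub> armap F f"
  by (simp add: nat_iso_def)

lemma (in exact_functor) nat_iso_refl: "nat_iso A B F F (\<lambda>X. Ident B (obmap F X))"
  using target.iso_Ident by (simp add: nat_iso_def target.homset_iff)

lemma nat_iso_trans:
  assumes "exact_functor A B F" "exact_functor A B G" "exact_functor A B H"
    and \<psi>: "nat_iso A B F G \<psi>" and \<chi>: "nat_iso A B G H \<chi>"
  shows "nat_iso A B F H (\<lambda>X. \<chi> X \<bullet>\<^bsub>B\<^esub> \<psi> X)"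
proof -
  interpret F: exact_functor A B F by fact
  interpret G: exact_functor A B G by fact
  interpret H: exact_functor A B H by fact
  note a = F.nat_iso_arr[OF \<psi>] and b = G.nat_iso_arr[OF \<chi>]
  show ?thesis unfolding nat_iso_def
  proof (intro conjI ballI)
    fix X assume "X \<in> Ob A"
    then show "\<chi> X \<bullet>\<^bsub>B\<^esub> \<psi> X \<in> homset B (obmap F X) (obmap H X)"
      "is_isomorphism B (\<chi> X \<bullet>\<^bsub>B\<^esub> \<psi> X)"
      using a b F.target.iso_comp by (simp_all add: F.target.homset_iff)
  next
    fix f assume f: "f \<in> Arr A"
    let ?X = "Dom A f" and ?Y = "Cod A f"
    have "armap H f \<bullet>\<^bsub>B\<^esub> (\<chi> ?X \<bullet>\<^bsub>B\<^esub> \<psi> ?X) = \<chi> ?Y \<bullet>\<^bsub>B\<^esub> (armap G f \<bullet>\<^bsub>B\<^esub> \<psi> ?X)"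
      by (rule F.target.comp_cong_left[OF nat_iso_natural[OF \<chi> f]]) (use a b f in simp_all)
    also have "\<dots> = (\<chi> ?Y \<bullet>\<^bsub>B\<^esub> \<psi> ?Y) \<bullet>\<^bsub>B\<^esub> armap F f"
      unfolding nat_iso_natural[OF \<psi> f] using a b f by simp
    finally show "armap H f \<bullet>\<^bsub>B\<^esub> (\<chi> ?X \<bullet>\<^bsub>B\<^esub> \<psi> ?X) = (\<chi> ?Y \<bullet>\<^bsub>B\<^esub> \<psi> ?Y) \<bullet>\<^bsub>B\<^esub> armap F f" .
  qed
qed

lemma nat_iso_sym:
  assumes "exact_functor A B F" "exact_functor A B G" and \<psi>: "nat_iso A B F G \<psi>"
  obtains \<psi>' where "nat_iso A B G F \<psi>'"
    "\<forall>X\<in>Ob A. \<psi> X \<bullet>\<^bsub>B\<^esub> \<psi>' X = Ident B (obmap G X)"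
proof -
  interpret F: exact_functor A B F by fact
  interpret G: exact_functor A B G by fact
  note a = F.nat_iso_arr[OF \<psi>]
  have "\<forall>X\<in>Ob A. \<exists>g. g \<in> Arr B \<and> Dom B g = obmap G X \<and> Cod B g = obmap F X \<and>
      g \<bullet>\<^bsub>B\<^esub> \<psi> X = Ident B (obmap F X) \<and> \<psi> X \<bullet>\<^bsub>B\<^esub> g = Ident B (obmap G X) \<and> is_isomorphism B g"
  proof
    fix X assume X: "X \<in> Ob A"
    show "\<exists>g. g \<in> Arr B \<and> Dom B g = obmap G X \<and> Cod B g = obmap F X \<and>
      g \<bullet>\<^bsub>B\<^esub> \<psi> X = Ident B (obmap F X) \<and> \<psi> X \<bullet>\<^bsub>B\<^esub> g = Ident B (obmap G X) \<and> is_isomorphism B g"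
      by (rule F.target.iso_inverse[OF a(4)[OF X]]) (use a(2,3)[OF X] in auto)
  qed
  from bchoice[OF this] obtain \<psi>' where b: "\<And>X. X \<in> Ob A \<Longrightarrow> \<psi>' X \<in> Arr B"
    "\<And>X. X \<in> Ob A \<Longrightarrow> Dom B (\<psi>' X) = obmap G X" "\<And>X. X \<in> Ob A \<Longrightarrow> Cod B (\<psi>' X) = obmap F X"
    "\<And>X. X \<in> Ob A \<Longrightarrow> \<psi>' X \<bullet>\<^bsub>B\<^esub> \<psi> X = Ident B (obmap F X)"
    "\<And>X. X \<in> Ob A \<Longrightarrow> \<psi> X \<bullet>\<^bsub>B\<^esub> \<psi>' X = Ident B (obmap G X)"
    "\<And>X. X \<in> Ob A \<Longrightarrow> is_isomorphism B (\<psi>' X)" by auto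
  have "nat_iso A B G F \<psi>'"
    unfolding nat_iso_def
  proof (intro conjI ballI)
    fix X assume "X \<in> Ob A"
    then show "\<psi>' X \<in> homset B (obmap G X) (obmap F X)" "is_isomorphism B (\<psi>' X)"
      using b by (simp_all add: F.target.homset_iff)
  next
    fix f assume f: "f \<in> Arr A"
    let ?X = "Dom A f" and ?Y = "Cod A f"
    have "armap F f \<bullet>\<^bsub>B\<^esub> \<psi>' ?X = (\<psi>' ?Y \<bullet>\<^bsub>B\<^esub> \<psi> ?Y) \<bullet>\<^bsub>B\<^esub> (armap F f \<bullet>\<^bsub>B\<^esub> \<psi>' ?X)"
      using b(1-4) f by simp
    also have "\<dots> = \<psi>' ?Y \<bullet>\<^bsub>B\<^esub> ((\<psi> ?Y \<bullet>\<^bsub>B\<^esub> armap F f) \<bullet>\<^bsub>B\<^esub> \<psi>' ?X)"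
      using a b(1-3) f by simp
    also have "\<dots> = \<psi>' ?Y \<bullet>\<^bsub>B\<^esub> (armap G f \<bullet>\<^bsub>B\<^esub> (\<psi> ?X \<bullet>\<^bsub>B\<^esub> \<psi>' ?X))"
      unfolding nat_iso_natural[OF \<psi> f, symmetric] using a b(1-3) f by simp
    also have "\<dots> = \<psi>' ?Y \<bullet>\<^bsub>B\<^esub> armap G f" using b(5) f by simp
    finally show "armap F f \<bullet>\<^bsub>B\<^esub> \<psi>' ?X = \<psi>' ?Y \<bullet>\<^bsub>B\<^esub> armap G f" .
  qed
  then show thesis by (rule that) (use b(5) in blast)
qed

lemma nat_iso_whisker_left:
  assumes "exact_functor A B F" "exact_functor A B G" "exact_functor B D H"
    and \<psi>: "nat_iso A B F G \<psi>"
  shows "nat_iso A D (H \<circ>\<^sub>F F) (H \<circ>\<^sub>F G) (\<lambda>X. armap H (\<psi> X))"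
proof -
  interpret F: exact_functor A B F by fact
  interpret G: exact_functor A B G by fact
  interpret H: exact_functor B D H by fact
  note a = F.nat_iso_arr[OF \<psi>]
  show ?thesis unfolding nat_iso_def
  proof (intro conjI ballI)
    fix X assume "X \<in> Ob A"
    then show "armap H (\<psi> X) \<in> homset D (obmap (H \<circ>\<^sub>F F) X) (obmap (H \<circ>\<^sub>F G) X)"
      "is_isomorphism D (armap H (\<psi> X))"
      using a H.map_isomorphism by (simp_all add: H.target.homset_iff)
  next
    fix f assume f: "f \<in> Arr A"
    show "armap (H \<circ>\<^sub>F G) f \<bullet>\<^bsub>D\<^esub> armap H (\<psi> (Dom A f)) = armap H (\<psi> (Cod A f)) \<bullet>\<^bsub>D\<^esub> armap (H \<circ>\<^sub>F F) f"
      using arg_cong[OF nat_iso_natural[OF \<psi> f], of "armap H"] a f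
        H.map_comp[of "\<psi> (Dom A f)" "armap G f"] H.map_comp[of "armap F f" "\<psi> (Cod A f)"]
      by simp
  qed
qed

lemma nat_iso_whisker_right:
  assumes "exact_functor A B F" and \<psi>: "nat_iso B D G H \<psi>"
  shows "nat_iso A D (G \<circ>\<^sub>F F) (H \<circ>\<^sub>F F) (\<lambda>X. \<psi> (obmap F X))"
proof -
  interpret F: exact_functor A B F by fact
  show ?thesis unfolding nat_iso_def
  proof (intro conjI ballI)
    fix X assume "X \<in> Ob A"
    then show "\<psi> (obmap F X) \<in> homset D (obmap (G \<circ>\<^sub>F F) X) (obmap (H \<circ>\<^sub>F F) X)"
      "is_isomorphism D (\<psi> (obmap F X))"
      using \<psi> unfolding nat_iso_def by simp_all
  next
    fix f assume f: "f \<in> Arr A"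
    show "armap (H \<circ>\<^sub>F F) f \<bullet>\<^bsub>D\<^esub> \<psi> (obmap F (Dom A f)) =
        \<psi> (obmap F (Cod A f)) \<bullet>\<^bsub>D\<^esub> armap (G \<circ>\<^sub>F F) f"
      using nat_iso_natural[OF \<psi>, of "armap F f"] f by simp
  qed
qed



section \<open>Lifts and their composition\<close>

text \<open>
  The data of a set \<open>lifts A0 A Q B P\<close>. Taking \<open>B\<close> to be \<open>Z\<close> and \<open>P\<close> to be \<open>\<zeta>\<close> gives deformations,
  other choices give morphisms, so that composition of morphisms and the action of morphisms on
  deformations are handled together.
\<close>

locale lifting_problem =
  Q: exact_functor A0 A Q + P: exact_functor A0 B P
  for A0 :: "('o0, 'm0) abcat" and A :: "('o, 'm) abcat" and Q :: "('o0, 'm0, 'o, 'm) fctr"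
    and B :: "('p, 'n) abcat" and P :: "('o0, 'm0, 'p, 'n) fctr"
begin

lemma liftsD:
  assumes "(F, \<phi>) \<in> lifts A0 A Q B P"
  shows "exact_functor A B F" "nat_iso A0 B (F \<circ>\<^sub>F Q) P \<phi>" "exact_functor A0 B (F \<circ>\<^sub>F Q)"
    "X \<in> Ob A0 \<Longrightarrow> \<phi> X \<in> Arr B" "X \<in> Ob A0 \<Longrightarrow> Dom B (\<phi> X) = obmap F (obmap Q X)"
    "X \<in> Ob A0 \<Longrightarrow> Cod B (\<phi> X) = obmap P X"
proof -
  show F: "exact_functor A B F" and n: "nat_iso A0 B (F \<circ>\<^sub>F Q) P \<phi>"
    using assms by (auto simp: lifts_def)
  then show FQ: "exact_functor A0 B (F \<circ>\<^sub>F Q)" using exact_functor_comp Q.exact_functor_axioms by blast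
  show "X \<in> Ob A0 \<Longrightarrow> \<phi> X \<in> Arr B" "X \<in> Ob A0 \<Longrightarrow> Dom B (\<phi> X) = obmap F (obmap Q X)"
    "X \<in> Ob A0 \<Longrightarrow> Cod B (\<phi> X) = obmap P X"
    using exact_functor.nat_iso_arr[OF FQ n] by auto
qed

lemma lift_relI:
  assumes "(F, \<phi>) \<in> lifts A0 A Q B P" "(F', \<phi>') \<in> lifts A0 A Q B P" "nat_iso A B F F' \<psi>"
    and "\<And>X. X \<in> Ob A0 \<Longrightarrow> \<phi>' X \<bullet>\<^bsub>B\<^esub> \<psi> (obmap Q X) = \<phi> X"
  shows "((F, \<phi>), (F', \<phi>')) \<in> lift_rel A0 A Q B P"
  using assms unfolding lift_rel_def by blast

lemma lift_relE:
  assumes "((F, \<phi>), (F', \<phi>')) \<in> lift_rel A0 A Q B P"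
  obtains \<psi> where "(F, \<phi>) \<in> lifts A0 A Q B P" "(F', \<phi>') \<in> lifts A0 A Q B P" "nat_iso A B F F' \<psi>"
    "\<forall>X\<in>Ob A0. \<phi>' X \<bullet>\<^bsub>B\<^esub> \<psi> (obmap Q X) = \<phi> X"
  using assms unfolding lift_rel_def by blast

text \<open>
  Values of a natural isomorphism outside the objects of \<open>A0\<close> are arbitrary, so pairs that are equal
  in the mathematical sense are related, but need not be equal.
\<close>

lemma lift_rel_if_eq:
  assumes "(F, \<phi>) \<in> lifts A0 A Q B P" "(F, \<phi>') \<in> lifts A0 A Q B P"
    and "\<And>X. X \<in> Ob A0 \<Longrightarrow> \<phi>' X = \<phi> X"
  shows "((F, \<phi>), (F, \<phi>')) \<in> lift_rel A0 A Q B P"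
proof -
  interpret F: exact_functor A B F using liftsD assms by blast
  show ?thesis
    by (rule lift_relI[OF assms(1,2) F.nat_iso_refl]) (use liftsD(4,5)[OF assms(1)] assms(3) in simp)
qed

lemma equiv_lift_rel: "equiv (lifts A0 A Q B P) (lift_rel A0 A Q B P)"
proof (rule equivI)
  show "lift_rel A0 A Q B P \<subseteq> lifts A0 A Q B P \<times> lifts A0 A Q B P"
    unfolding lift_rel_def by blast
  show "refl_on (lifts A0 A Q B P) (lift_rel A0 A Q B P)"
  proof (rule refl_onI)
    fix s assume "s \<in> lifts A0 A Q B P"
    then show "(s, s) \<in> lift_rel A0 A Q B P" using lift_rel_if_eq[of "fst s" "snd s" "snd s"] by simp
  qed
  show "sym (lift_rel A0 A Q B P)"
  proof (rule symI)
    fix s t assume st: "(s, t) \<in> lift_rel A0 A Q B P"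
    obtain F \<phi> G \<gamma> where s: "s = (F, \<phi>)" and t: "t = (G, \<gamma>)" by (cases s, cases t)
    obtain \<psi> where F: "(F, \<phi>) \<in> lifts A0 A Q B P" and G: "(G, \<gamma>) \<in> lifts A0 A Q B P"
      and \<psi>: "nat_iso A B F G \<psi>" "\<forall>X\<in>Ob A0. \<gamma> X \<bullet>\<^bsub>B\<^esub> \<psi> (obmap Q X) = \<phi> X"
      using st unfolding s t by (rule lift_relE)
    obtain \<psi>' where \<psi>': "nat_iso A B G F \<psi>'" "\<forall>X\<in>Ob A. \<psi> X \<bullet>\<^bsub>B\<^esub> \<psi>' X = Ident B (obmap G X)"
      by (rule nat_iso_sym[OF liftsD(1)[OF F] liftsD(1)[OF G] \<psi>(1)])
    note a = exact_functor.nat_iso_arr[OF liftsD(1)[OF F] \<psi>(1)]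
    note b = exact_functor.nat_iso_arr[OF liftsD(1)[OF G] \<psi>'(1)]
    show "(t, s) \<in> lift_rel A0 A Q B P" unfolding s t
    proof (rule lift_relI[OF G F \<psi>'(1)])
      fix X assume X: "X \<in> Ob A0"
      have "\<phi> X \<bullet>\<^bsub>B\<^esub> \<psi>' (obmap Q X) = \<gamma> X \<bullet>\<^bsub>B\<^esub> (\<psi> (obmap Q X) \<bullet>\<^bsub>B\<^esub> \<psi>' (obmap Q X))"
        unfolding bspec[OF \<psi>(2) X, symmetric] using a b liftsD(4-6)[OF G] X by simp
      then show "\<phi> X \<bullet>\<^bsub>B\<^esub> \<psi>' (obmap Q X) = \<gamma> X"
        using \<psi>'(2) liftsD(4-6)[OF G] X by simp
    qed
  qed
  show "trans (lift_rel A0 A Q B P)"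
  proof (rule transI)
    fix r s t assume rs: "(r, s) \<in> lift_rel A0 A Q B P" and st: "(s, t) \<in> lift_rel A0 A Q B P"
    obtain F \<phi> G \<gamma> H \<eta> where r: "r = (F, \<phi>)" and s: "s = (G, \<gamma>)" and t: "t = (H, \<eta>)"
      by (cases r, cases s, cases t)
    obtain \<psi> where F: "(F, \<phi>) \<in> lifts A0 A Q B P" and G: "(G, \<gamma>) \<in> lifts A0 A Q B P"
      and \<psi>: "nat_iso A B F G \<psi>" "\<forall>X\<in>Ob A0. \<gamma> X \<bullet>\<^bsub>B\<^esub> \<psi> (obmap Q X) = \<phi> X"
      using rs unfolding r s by (rule lift_relE)
    obtain \<chi> where H: "(H, \<eta>) \<in> lifts A0 A Q B P"
      and \<chi>: "nat_iso A B G H \<chi>" "\<forall>X\<in>Ob A0. \<eta> X \<bullet>\<^bsub>B\<^esub> \<chi> (obmap Q X) = \<gamma> X"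
      using st unfolding s t by (rule lift_relE)
    note a = exact_functor.nat_iso_arr[OF liftsD(1)[OF F] \<psi>(1)]
    note b = exact_functor.nat_iso_arr[OF liftsD(1)[OF G] \<chi>(1)]
    show "(r, t) \<in> lift_rel A0 A Q B P" unfolding r t
    proof (rule lift_relI[OF F H])
      show "nat_iso A B F H (\<lambda>X. \<chi> X \<bullet>\<^bsub>B\<^esub> \<psi> X)"
        by (rule nat_iso_trans[OF liftsD(1)[OF F] liftsD(1)[OF G] liftsD(1)[OF H] \<psi>(1) \<chi>(1)])
      fix X assume X: "X \<in> Ob A0"
      have "\<eta> X \<bullet>\<^bsub>B\<^esub> (\<chi> (obmap Q X) \<bullet>\<^bsub>B\<^esub> \<psi> (obmap Q X)) =
          (\<eta> X \<bullet>\<^bsub>B\<^esub> \<chi> (obmap Q X)) \<bullet>\<^bsub>B\<^esub> \<psi> (obmap Q X)"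
        using a b liftsD(4-6)[OF H] X by simp
      then show "\<eta> X \<bullet>\<^bsub>B\<^esub> (\<chi> (obmap Q X) \<bullet>\<^bsub>B\<^esub> \<psi> (obmap Q X)) = \<phi> X"
        unfolding bspec[OF \<chi>(2) X] bspec[OF \<psi>(2) X] .
    qed
  qed
qed

lemma class_in_lift_classes:
  "s \<in> lifts A0 A Q B P \<Longrightarrow> lift_rel A0 A Q B P `` {s} \<in> lift_classes A0 A Q B P"
  unfolding lift_classes_def by (rule quotientI)

lemma lift_classesE:
  assumes "c \<in> lift_classes A0 A Q B P"
  obtains s where "s \<in> lifts A0 A Q B P" "c = lift_rel A0 A Q B P `` {s}"
  using assms unfolding lift_classes_def by (rule quotientE)

lemma lift_classesE_pair:
  assumes "c \<in> lift_classes A0 A Q B P"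
  obtains F \<phi> where "(F, \<phi>) \<in> lifts A0 A Q B P" "c = lift_rel A0 A Q B P `` {(F, \<phi>)}"
  using assms unfolding lift_classes_def by (rule quotientE) (metis surj_pair)

lemma lift_class_eq: "(s, t) \<in> lift_rel A0 A Q B P \<Longrightarrow> lift_rel A0 A Q B P `` {s} = lift_rel A0 A Q B P `` {t}"
  by (rule equiv_class_eq[OF equiv_lift_rel])

end

lemma comp_lift_in_lifts:
  assumes "lifting_problem A0 A Q B P" "lifting_problem A0 B P D R"
    and "t \<in> lifts A0 B P D R" "s \<in> lifts A0 A Q B P"
  shows "comp_lift D t s \<in> lifts A0 A Q D R"
proof -
  interpret L: lifting_problem A0 A Q B P by fact
  interpret M: lifting_problem A0 B P D R by fact
  obtain F \<phi> T \<tau> where s: "s = (F, \<phi>)" and t: "t = (T, \<tau>)" by (cases s, cases t)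
  note F = L.liftsD[OF assms(4)[unfolded s]] and T = M.liftsD[OF assms(3)[unfolded t]]
  have "nat_iso A0 D ((T \<circ>\<^sub>F F) \<circ>\<^sub>F Q) R (\<lambda>X. \<tau> X \<bullet>\<^bsub>D\<^esub> armap T (\<phi> X))"
  proof (rule nat_iso_trans[OF _ T(3) M.P.exact_functor_axioms _ T(2)])
    show "exact_functor A0 D ((T \<circ>\<^sub>F F) \<circ>\<^sub>F Q)"
      unfolding comp_fctr_assoc using F(3) T(1) by (rule exact_functor_comp)
    show "nat_iso A0 D ((T \<circ>\<^sub>F F) \<circ>\<^sub>F Q) (T \<circ>\<^sub>F P) (\<lambda>X. armap T (\<phi> X))"
      unfolding comp_fctr_assoc by (rule nat_iso_whisker_left[OF F(3) L.P.exact_functor_axioms T(1) F(2)])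
  qed
  then show ?thesis
    using exact_functor_comp[OF F(1) T(1)] unfolding s t comp_lift_def lifts_def by simp
qed

text \<open>
  The isomorphism between the composites is the horizontal composite of the two given ones; its
  compatibility with the structure isomorphisms uses naturality of \<open>\<chi>\<close> at the arrow \<open>\<phi>' X\<close>.
\<close>

lemma comp_lift_cong:
  assumes "lifting_problem A0 A Q B P" "lifting_problem A0 B P D R"
    and tt: "(t, t') \<in> lift_rel A0 B P D R" and ss: "(s, s') \<in> lift_rel A0 A Q B P"
  shows "(comp_lift D t s, comp_lift D t' s') \<in> lift_rel A0 A Q D R"
proof -
  interpret L: lifting_problem A0 A Q B P by fact
  interpret M: lifting_problem A0 B P D R by fact
  interpret N: lifting_problem A0 A Q D R by unfold_locales
  obtain F \<phi> T \<tau> where s: "s = (F, \<phi>)" and t: "t = (T, \<tau>)" by (cases s, cases t)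
  obtain F' \<phi>' T' \<tau>' where s': "s' = (F', \<phi>')" and t': "t' = (T', \<tau>')" by (cases s', cases t')
  obtain \<psi> where l: "(F, \<phi>) \<in> lifts A0 A Q B P" "(F', \<phi>') \<in> lifts A0 A Q B P"
    and \<psi>: "nat_iso A B F F' \<psi>" "\<forall>X\<in>Ob A0. \<phi>' X \<bullet>\<^bsub>B\<^esub> \<psi> (obmap Q X) = \<phi> X"
    using ss unfolding s s' by (rule L.lift_relE)
  obtain \<chi> where m: "(T, \<tau>) \<in> lifts A0 B P D R" "(T', \<tau>') \<in> lifts A0 B P D R"
    and \<chi>: "nat_iso B D T T' \<chi>" "\<forall>X\<in>Ob A0. \<tau>' X \<bullet>\<^bsub>D\<^esub> \<chi> (obmap P X) = \<tau> X"
    using tt unfolding t t' by (rule M.lift_relE)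
  note F = L.liftsD[OF l(1)] and F' = L.liftsD[OF l(2)] and T = M.liftsD[OF m(1)] and T' = M.liftsD[OF m(2)]
  interpret F: exact_functor A B F by (rule F)
  interpret F': exact_functor A B F' by (rule F')
  interpret T: exact_functor B D T by (rule T)
  interpret T': exact_functor B D T' by (rule T')
  note a = F.nat_iso_arr[OF \<psi>(1)] and b = T.nat_iso_arr[OF \<chi>(1)]
  let ?\<theta> = "\<lambda>X. \<chi> (obmap F' X) \<bullet>\<^bsub>D\<^esub> armap T (\<psi> X)"
  have TF: "(T \<circ>\<^sub>F F, \<lambda>X. \<tau> X \<bullet>\<^bsub>D\<^esub> armap T (\<phi> X)) \<in> lifts A0 A Q D R"
    "(T' \<circ>\<^sub>F F', \<lambda>X. \<tau>' X \<bullet>\<^bsub>D\<^esub> armap T' (\<phi>' X)) \<in> lifts A0 A Q D R"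
    using comp_lift_in_lifts[OF assms(1,2) m(1) l(1)] comp_lift_in_lifts[OF assms(1,2) m(2) l(2)]
    by (simp_all add: comp_lift_def)
  have "nat_iso A D (T \<circ>\<^sub>F F) (T' \<circ>\<^sub>F F') ?\<theta>"
    using exact_functor_comp[OF F(1) T(1)] exact_functor_comp[OF F'(1) T(1)]
      exact_functor_comp[OF F'(1) T'(1)] nat_iso_whisker_left[OF F(1) F'(1) T(1) \<psi>(1)]
      nat_iso_whisker_right[OF F'(1) \<chi>(1)]
    by (rule nat_iso_trans)
  then have "((T \<circ>\<^sub>F F, \<lambda>X. \<tau> X \<bullet>\<^bsub>D\<^esub> armap T (\<phi> X)), (T' \<circ>\<^sub>F F', \<lambda>X. \<tau>' X \<bullet>\<^bsub>D\<^esub> armap T' (\<phi>' X)))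
      \<in> lift_rel A0 A Q D R"
  proof (rule N.lift_relI[OF TF])
    fix X assume X: "X \<in> Ob A0"
    let ?QX = "obmap Q X" and ?PX = "obmap P X"
    have nat: "armap T' (\<phi>' X) \<bullet>\<^bsub>D\<^esub> \<chi> (obmap F' ?QX) = \<chi> ?PX \<bullet>\<^bsub>D\<^esub> armap T (\<phi>' X)"
      using nat_iso_natural[OF \<chi>(1) F'(4)[OF X]] F'(5,6)[OF X] by simp
    have "(\<tau>' X \<bullet>\<^bsub>D\<^esub> armap T' (\<phi>' X)) \<bullet>\<^bsub>D\<^esub> ?\<theta> ?QX =
        \<tau>' X \<bullet>\<^bsub>D\<^esub> ((armap T' (\<phi>' X) \<bullet>\<^bsub>D\<^esub> \<chi> (obmap F' ?QX)) \<bullet>\<^bsub>D\<^esub> armap T (\<psi> ?QX))"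
      using a b X F'(4-6) T'(4-6) by simp
    also have "\<dots> = (\<tau>' X \<bullet>\<^bsub>D\<^esub> \<chi> ?PX) \<bullet>\<^bsub>D\<^esub> (armap T (\<phi>' X) \<bullet>\<^bsub>D\<^esub> armap T (\<psi> ?QX))"
      unfolding nat using a b X F'(4-6) T'(4-6) by simp
    also have "\<dots> = \<tau> X \<bullet>\<^bsub>D\<^esub> armap T (\<phi> X)"
      unfolding bspec[OF \<chi>(2) X] bspec[OF \<psi>(2) X, symmetric] using T.map_comp a X F'(4-6) by simp
    finally show "(\<tau>' X \<bullet>\<^bsub>D\<^esub> armap T' (\<phi>' X)) \<bullet>\<^bsub>D\<^esub> ?\<theta> ?QX = \<tau> X \<bullet>\<^bsub>D\<^esub> armap T (\<phi> X)" .
  qed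
  then show ?thesis unfolding s t s' t' comp_lift_def by simp
qed

lemma comp_class_eq:
  assumes "lifting_problem A0 A Q B P" "lifting_problem A0 B P D R"
    and t: "t \<in> lifts A0 B P D R" and s: "s \<in> lifts A0 A Q B P"
  shows "comp_class A0 A Q D R (lift_rel A0 B P D R `` {t}) (lift_rel A0 A Q B P `` {s}) =
    lift_rel A0 A Q D R `` {comp_lift D t s}"
proof -
  interpret L: lifting_problem A0 A Q B P by fact
  interpret M: lifting_problem A0 B P D R by fact
  interpret N: lifting_problem A0 A Q D R by unfold_locales
  have "lift_rel A0 A Q D R `` {comp_lift D t' s'} = lift_rel A0 A Q D R `` {comp_lift D t s}"
    if "t' \<in> lift_rel A0 B P D R `` {t}" "s' \<in> lift_rel A0 A Q B P `` {s}" for t' s'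
    using N.lift_class_eq[OF comp_lift_cong[OF assms(1,2)]] that by blast
  moreover have "t \<in> lift_rel A0 B P D R `` {t}" "s \<in> lift_rel A0 A Q B P `` {s}"
    using equiv_class_self[OF M.equiv_lift_rel t] equiv_class_self[OF L.equiv_lift_rel s] .
  ultimately show ?thesis unfolding comp_class_def by blast
qed

lemma comp_class_in_lift_classes:
  assumes "lifting_problem A0 A Q B P" "lifting_problem A0 B P D R"
    and "d \<in> lift_classes A0 B P D R" "c \<in> lift_classes A0 A Q B P"
  shows "comp_class A0 A Q D R d c \<in> lift_classes A0 A Q D R"
proof -
  interpret L: lifting_problem A0 A Q B P by fact
  interpret M: lifting_problem A0 B P D R by fact
  interpret N: lifting_problem A0 A Q D R by unfold_locales
  obtain s where s: "s \<in> lifts A0 A Q B P" "c = lift_rel A0 A Q B P `` {s}"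
    using assms(4) by (rule L.lift_classesE)
  obtain t where t: "t \<in> lifts A0 B P D R" "d = lift_rel A0 B P D R `` {t}"
    using assms(3) by (rule M.lift_classesE)
  show ?thesis
    unfolding s(2) t(2) comp_class_eq[OF assms(1,2) t(1) s(1)]
    by (rule N.class_in_lift_classes[OF comp_lift_in_lifts[OF assms(1,2) t(1) s(1)]])
qed

lemma comp_class_assoc:
  assumes AB: "lifting_problem A0 A Q B P" and BD: "lifting_problem A0 B P D R"
    and DW: "lifting_problem A0 D R W S"
    and c: "c \<in> lift_classes A0 A Q B P" and d: "d \<in> lift_classes A0 B P D R"
    and e: "e \<in> lift_classes A0 D R W S"
  shows "comp_class A0 A Q W S (comp_class A0 B P W S e d) c =
    comp_class A0 A Q W S e (comp_class A0 A Q D R d c)"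
proof -
  interpret L: lifting_problem A0 A Q B P by fact
  interpret M: lifting_problem A0 B P D R by fact
  interpret N: lifting_problem A0 D R W S by fact
  interpret AW: lifting_problem A0 A Q W S by unfold_locales
  have AD: "lifting_problem A0 A Q D R" and BW: "lifting_problem A0 B P W S" by unfold_locales
  obtain F \<phi> where s: "(F, \<phi>) \<in> lifts A0 A Q B P" "c = lift_rel A0 A Q B P `` {(F, \<phi>)}"
    using c by (rule L.lift_classesE_pair)
  obtain T \<tau> where t: "(T, \<tau>) \<in> lifts A0 B P D R" "d = lift_rel A0 B P D R `` {(T, \<tau>)}"
    using d by (rule M.lift_classesE_pair)
  obtain U \<upsilon> where u: "(U, \<upsilon>) \<in> lifts A0 D R W S" "e = lift_rel A0 D R W S `` {(U, \<upsilon>)}"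
    using e by (rule N.lift_classesE_pair)
  note ut = comp_lift_in_lifts[OF BD DW u(1) t(1)] and ts = comp_lift_in_lifts[OF AB BD t(1) s(1)]
  note ut_s = comp_lift_in_lifts[OF AB BW ut s(1)] and u_ts = comp_lift_in_lifts[OF AD DW u(1) ts]
  note F = L.liftsD[OF s(1)] and T = M.liftsD[OF t(1)] and U = N.liftsD[OF u(1)]
  interpret T: exact_functor B D T by (rule T)
  interpret U: exact_functor D W U by (rule U)
  have "(\<upsilon> X \<bullet>\<^bsub>W\<^esub> armap U (\<tau> X)) \<bullet>\<^bsub>W\<^esub> armap U (armap T (\<phi> X)) =
      \<upsilon> X \<bullet>\<^bsub>W\<^esub> armap U (\<tau> X \<bullet>\<^bsub>D\<^esub> armap T (\<phi> X))" if X: "X \<in> Ob A0" for X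
    using F(4-6)[OF X] T(4-6)[OF X] U(4-6)[OF X] U.map_comp by simp
  then have "(comp_lift W (comp_lift W (U, \<upsilon>) (T, \<tau>)) (F, \<phi>),
      comp_lift W (U, \<upsilon>) (comp_lift D (T, \<tau>) (F, \<phi>))) \<in> lift_rel A0 A Q W S"
    using AW.lift_rel_if_eq ut_s u_ts unfolding comp_lift_def by (simp add: comp_fctr_assoc)
  then show ?thesis
    unfolding s(2) t(2) u(2) comp_class_eq[OF BD DW u(1) t(1)] comp_class_eq[OF AB BD t(1) s(1)]
      comp_class_eq[OF AB BW ut s(1)] comp_class_eq[OF AD DW u(1) ts]
    by (rule AW.lift_class_eq)
qed

definition id_class ::
  "('o0, 'm0) abcat \<Rightarrow> ('o, 'm) abcat \<Rightarrow> ('o0, 'm0, 'o, 'm) fctr \<Rightarrow>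
   (('o, 'm, 'o, 'm) fctr \<times> ('o0 \<Rightarrow> 'm)) set" where
  "id_class A0 A Q = lift_rel A0 A Q A Q `` {(id_fctr, \<lambda>X. Ident A (obmap Q X))}"

lemma id_lift:
  assumes "exact_functor A0 A Q"
  shows "(id_fctr, \<lambda>X. Ident A (obmap Q X)) \<in> lifts A0 A Q A Q"
proof -
  interpret Q: exact_functor A0 A Q by fact
  show ?thesis unfolding lifts_def
    using exact_functor_id[OF Q.target.abelian_category_axioms] Q.nat_iso_refl
    by (simp add: comp_fctr_id)
qed

lemma id_class_in_lift_classes:
  assumes "exact_functor A0 A Q" shows "id_class A0 A Q \<in> lift_classes A0 A Q A Q"
proof -
  interpret Q: exact_functor A0 A Q by fact
  interpret lifting_problem A0 A Q A Q by unfold_locales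
  show ?thesis unfolding id_class_def by (rule class_in_lift_classes[OF id_lift[OF assms]])
qed

lemma comp_class_id:
  assumes AB: "lifting_problem A0 A Q B P" and c: "c \<in> lift_classes A0 A Q B P"
  shows "comp_class A0 A Q B P c (id_class A0 A Q) = c"
    and "comp_class A0 A Q B P (id_class A0 B P) c = c"
proof -
  interpret L: lifting_problem A0 A Q B P by fact
  have AA: "lifting_problem A0 A Q A Q" and BB: "lifting_problem A0 B P B P" by unfold_locales
  obtain F \<phi> where s: "(F, \<phi>) \<in> lifts A0 A Q B P" "c = lift_rel A0 A Q B P `` {(F, \<phi>)}"
    using c by (rule L.lift_classesE_pair)
  note F = L.liftsD[OF s(1)]
  interpret F: exact_functor A B F by (rule F)
  note idA = id_lift[OF L.Q.exact_functor_axioms] and idB = id_lift[OF L.P.exact_functor_axioms]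
  note r = comp_lift_in_lifts[OF AA AB s(1) idA] and l = comp_lift_in_lifts[OF AB BB idB s(1)]
  have "((F, \<phi>), comp_lift B (F, \<phi>) (id_fctr, \<lambda>X. Ident A (obmap Q X))) \<in> lift_rel A0 A Q B P"
    using r s(1) L.lift_rel_if_eq[of F \<phi>] F(4-6) unfolding comp_lift_def by (simp add: comp_fctr_id)
  then show "comp_class A0 A Q B P c (id_class A0 A Q) = c"
    unfolding s(2) id_class_def comp_class_eq[OF AA AB s(1) idA] by (rule L.lift_class_eq[symmetric])
  have "((F, \<phi>), comp_lift B (id_fctr, \<lambda>X. Ident B (obmap P X)) (F, \<phi>)) \<in> lift_rel A0 A Q B P"
    using l s(1) L.lift_rel_if_eq[of F \<phi>] F(4-6) unfolding comp_lift_def by (simp add: comp_fctr_id)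
  then show "comp_class A0 A Q B P (id_class A0 B P) c = c"
    unfolding s(2) id_class_def comp_class_eq[OF AB BB idB s(1)] by (rule L.lift_class_eq[symmetric])
qed

section \<open>The category of extension generating functors and its deformation functors\<close>

lemma FinTilde_Ob_iff:
  "(A, Q) \<in> Ob (FinTilde A0) \<longleftrightarrow> exact_functor A0 A Q \<and> extension_generating A0 A Q"
  by (simp add: FinTilde_def Let_def)

lemma FinTilde_homset_iff:
  "h \<in> homset (FinTilde A0) (A, Q) (B, P) \<longleftrightarrow>
    (A, Q) \<in> Ob (FinTilde A0) \<and> (B, P) \<in> Ob (FinTilde A0) \<and>
    (\<exists>c \<in> lift_classes A0 A Q B P. h = ((A, Q), (B, P), c))"
  by (auto simp: FinTilde_def Let_def homset_def)

lemma FinTilde_Ident: "Ident (FinTilde A0) (A, Q) = ((A, Q), (A, Q), id_class A0 A Q)"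
  by (simp add: FinTilde_def Let_def id_class_def)

lemma FinTilde_Comp:
  "Comp (FinTilde A0) (b, (D, R), d) ((A, Q), b', c) = ((A, Q), (D, R), comp_class A0 A Q D R d c)"
  by (simp add: FinTilde_def Let_def)

lemma FinTilde_lifting_problem:
  assumes "(A, Q) \<in> Ob (FinTilde A0)" "(B, P) \<in> Ob (FinTilde A0)"
  shows "lifting_problem A0 A Q B P"
  using assms unfolding FinTilde_Ob_iff lifting_problem_def by blast

lemma category_FinTilde:
  fixes A0 :: "('o0, 'm0) abcat"
  shows "category (FinTilde A0 :: (('o0, 'm0, 'o, 'm) fin_ob, ('o0, 'm0, 'o, 'm) fin_arr) cat)" (is "category ?C")
proof
  fix f X Y
  show "f \<in> Arr ?C \<Longrightarrow> Dom ?C f \<in> Ob ?C"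
    and "f \<in> Arr ?C \<Longrightarrow> Cod ?C f \<in> Ob ?C"
    by (auto simp: FinTilde_def Let_def)
  show "X \<in> Ob ?C \<Longrightarrow> Ident ?C X \<in> homset ?C X X"
  proof (cases X)
    fix A Q assume "X \<in> Ob ?C" and X: "X = (A, Q)"
    then have "exact_functor A0 A Q" "(A, Q) \<in> Ob ?C" by (simp_all add: FinTilde_Ob_iff)
    then show ?thesis unfolding X FinTilde_homset_iff FinTilde_Ident
      using id_class_in_lift_classes by blast
  qed
  fix g W
  show "Comp ?C g f \<in> homset ?C X W"
    if hyps: "f \<in> homset ?C X Y" "g \<in> homset ?C Y W"
  proof -
    obtain A Q B P D R where o: "X = (A, Q)" "Y = (B, P)" "W = (D, R)" by (cases X, cases Y, cases W)
    have ob: "(A, Q) \<in> Ob ?C" "(B, P) \<in> Ob ?C" "(D, R) \<in> Ob ?C"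
      using hyps unfolding o FinTilde_homset_iff by blast+
    obtain c where c: "c \<in> lift_classes A0 A Q B P" "f = ((A, Q), (B, P), c)"
      using hyps(1) unfolding o FinTilde_homset_iff by blast
    obtain d where d: "d \<in> lift_classes A0 B P D R" "g = ((B, P), (D, R), d)"
      using hyps(2) unfolding o FinTilde_homset_iff by blast
    show ?thesis unfolding o c(2) d(2) FinTilde_Comp FinTilde_homset_iff
      using ob comp_class_in_lift_classes[OF FinTilde_lifting_problem[OF ob(1,2)]
          FinTilde_lifting_problem[OF ob(2,3)] d(1) c(1)] by blast
  qed
  show "Comp ?C f (Ident ?C X) = f"
    and "Comp ?C (Ident ?C Y) f = f"
    if hyps: "f \<in> homset ?C X Y"
  proof -
    obtain A Q B P where o: "X = (A, Q)" "Y = (B, P)" by (cases X, cases Y)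
    have ob: "(A, Q) \<in> Ob ?C" "(B, P) \<in> Ob ?C"
      using hyps unfolding o FinTilde_homset_iff by blast+
    obtain c where c: "c \<in> lift_classes A0 A Q B P" "f = ((A, Q), (B, P), c)"
      using hyps(1) unfolding o FinTilde_homset_iff by blast
    show "Comp ?C f (Ident ?C X) = f"
      and "Comp ?C (Ident ?C Y) f = f"
      unfolding o c(2) FinTilde_Ident FinTilde_Comp
      using comp_class_id[OF FinTilde_lifting_problem[OF ob] c(1)] by simp_all
  qed
  fix h V
  show "Comp ?C (Comp ?C h g) f = Comp ?C h (Comp ?C g f)"
    if hyps: "f \<in> homset ?C X Y" "g \<in> homset ?C Y W" "h \<in> homset ?C W V"
  proof -
    obtain A Q B P D R E S where o: "X = (A, Q)" "Y = (B, P)" "W = (D, R)" "V = (E, S)"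
      by (cases X, cases Y, cases W, cases V)
    have ob: "(A, Q) \<in> Ob ?C" "(B, P) \<in> Ob ?C" "(D, R) \<in> Ob ?C"
      "(E, S) \<in> Ob ?C"
      using hyps unfolding o FinTilde_homset_iff by blast+
    obtain c where c: "c \<in> lift_classes A0 A Q B P" "f = ((A, Q), (B, P), c)"
      using hyps(1) unfolding o FinTilde_homset_iff by blast
    obtain d where d: "d \<in> lift_classes A0 B P D R" "g = ((B, P), (D, R), d)"
      using hyps(2) unfolding o FinTilde_homset_iff by blast
    obtain e where e: "e \<in> lift_classes A0 D R E S" "h = ((D, R), (E, S), e)"
      using hyps(3) unfolding o FinTilde_homset_iff by blast
    show ?thesis unfolding o c(2) d(2) e(2) FinTilde_Comp
      using comp_class_assoc[OF FinTilde_lifting_problem[OF ob(1,2)] FinTilde_lifting_problem[OF ob(2,3)]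
          FinTilde_lifting_problem[OF ob(3,4)] c(1) d(1) e(1)] by simp
  qed
qed

lemma category_Fin: "category (Fin A0)"
  unfolding Fin_def by (rule category.category_full_subcat[OF category_FinTilde])

lemma Fin_Ob_imp_FinTilde: "X \<in> Ob (Fin A0) \<Longrightarrow> X \<in> Ob (FinTilde A0)"
  by (simp add: Fin_def)

lemma Fin_homset_imp_FinTilde: "h \<in> homset (Fin A0) X Y \<Longrightarrow> h \<in> homset (FinTilde A0) X Y"
  by (auto simp: Fin_def homset_def)

lemma Fin_Ident: "Ident (Fin A0) = Ident (FinTilde A0)" and Fin_Comp: "Comp (Fin A0) = Comp (FinTilde A0)"
  by (simp_all add: Fin_def)

lemma Fin_homsetE:
  assumes "h \<in> homset (Fin A0) (A, Q) (B, P)"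
  obtains c where "c \<in> lift_classes A0 A Q B P" "h = ((A, Q), (B, P), c)"
    "(A, Q) \<in> Ob (FinTilde A0)" "(B, P) \<in> Ob (FinTilde A0)"
proof -
  obtain c where "c \<in> lift_classes A0 A Q B P" "h = ((A, Q), (B, P), c)"
    and "(A, Q) \<in> Ob (FinTilde A0)" "(B, P) \<in> Ob (FinTilde A0)"
    using Fin_homset_imp_FinTilde[OF assms] unfolding FinTilde_homset_iff by blast
  then show thesis by (rule that)
qed

lemma ncDef_simps:
  "psh_ob (ncDef A0 Z \<zeta>) (A, Q) = lift_classes A0 A Q Z \<zeta>"
  "psh_ar (ncDef A0 Z \<zeta>) ((A, Q), b, c) d = comp_class A0 A Q Z \<zeta> d c"
  by (simp_all add: ncDef_def)

lemma presheaf_ncDef: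
  fixes A0 :: "('o0, 'm0) abcat"
  assumes \<zeta>: "exact_functor A0 Z \<zeta>"
  shows "presheaf (Fin A0 :: (('o0, 'm0, 'o, 'm) fin_ob, ('o0, 'm0, 'o, 'm) fin_arr) cat) (ncDef A0 Z \<zeta>)"
    (is "presheaf ?C ?G")
proof (rule presheaf.intro[OF category_Fin], rule presheaf_axioms.intro)
  have lp: "lifting_problem A0 A Q Z \<zeta>" if "(A, Q) \<in> Ob (FinTilde A0)"
    for A :: "('o, 'm) abcat" and Q :: "('o0, 'm0, 'o, 'm) fctr"
    using that \<zeta> unfolding FinTilde_Ob_iff lifting_problem_def by blast
  fix f X Y x
  show "psh_ar ?G f x \<in> psh_ob ?G X"
    if hyps: "f \<in> homset ?C X Y" "x \<in> psh_ob ?G Y"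
  proof -
    obtain A Q B P where o: "X = (A, Q)" "Y = (B, P)" by (cases X, cases Y)
    obtain c where c: "c \<in> lift_classes A0 A Q B P" "f = ((A, Q), (B, P), c)"
      and ob: "(A, Q) \<in> Ob (FinTilde A0)" "(B, P) \<in> Ob (FinTilde A0)"
      using hyps(1) unfolding o by (rule Fin_homsetE)
    show ?thesis using hyps(2) unfolding o c(2) ncDef_simps
      using comp_class_in_lift_classes[OF FinTilde_lifting_problem[OF ob] lp[OF ob(2)] _ c(1)] by blast
  qed
  show "psh_ar ?G (Ident ?C X) x = x"
    if hyps: "X \<in> Ob ?C" "x \<in> psh_ob ?G X"
  proof -
    obtain A Q where o: "X = (A, Q)" by (cases X)
    have ob: "(A, Q) \<in> Ob (FinTilde A0)" using Fin_Ob_imp_FinTilde hyps(1) unfolding o by blast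
    show ?thesis using hyps(2) comp_class_id(1)[OF lp[OF ob]]
      unfolding o Fin_Ident FinTilde_Ident ncDef_simps by blast
  qed
  fix g W
  show "psh_ar ?G (Comp ?C g f) x =
      psh_ar ?G f (psh_ar ?G g x)"
    if hyps: "f \<in> homset ?C X Y" "g \<in> homset ?C Y W" "x \<in> psh_ob ?G W"
  proof -
    obtain A Q B P D R where o: "X = (A, Q)" "Y = (B, P)" "W = (D, R)" by (cases X, cases Y, cases W)
    obtain c where c: "c \<in> lift_classes A0 A Q B P" "f = ((A, Q), (B, P), c)"
      and ob: "(A, Q) \<in> Ob (FinTilde A0)" "(B, P) \<in> Ob (FinTilde A0)"
      using hyps(1) unfolding o by (rule Fin_homsetE)
    obtain d where d: "d \<in> lift_classes A0 B P D R" "g = ((B, P), (D, R), d)"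
      and ob': "(D, R) \<in> Ob (FinTilde A0)"
      using hyps(2) unfolding o by (rule Fin_homsetE)
    show ?thesis
      using hyps(3) comp_class_assoc[OF FinTilde_lifting_problem[OF ob]
          FinTilde_lifting_problem[OF ob(2) ob'] lp[OF ob'] c(1) d(1)]
      unfolding o c(2) d(2) Fin_Comp FinTilde_Comp ncDef_simps by simp
  qed
qed



section \<open>The extension closure ind-represents\<close>

lemma nat_iso_full_subcat_iff:
  assumes "obmap F ` Ob A \<subseteq> S" "obmap G ` Ob A \<subseteq> S"
  shows "nat_iso A (full_subcat C S) F G \<psi> \<longleftrightarrow> nat_iso A C F G \<psi>"
proof -
  have "obmap F X \<in> S" "obmap G X \<in> S" if "X \<in> Ob A" for X using assms that by auto
  then show ?thesis unfolding nat_iso_def by (auto simp: homset_def)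
qed

lemma ess_image_full_subcat:
  assumes "category B" "ess_image A B F \<subseteq> S" "obmap F ` Ob A \<subseteq> S"
  shows "ess_image A (full_subcat B S) F = ess_image A B F"
proof -
  have "isomorphic (full_subcat B S) Y (obmap F X) \<longleftrightarrow> isomorphic B Y (obmap F X)"
    if "Y \<in> S" "X \<in> Ob A" for X Y
    using that assms(3) by (auto simp: isomorphic_def homset_def)
  note iso = this
  have "Y \<in> ess_image A (full_subcat B S) F \<longleftrightarrow> Y \<in> ess_image A B F" for Y
  proof (cases "Y \<in> S")
    case True
    show ?thesis unfolding ess_image_def by (simp add: True iso cong: bex_cong)
  next
    case False
    then show ?thesis using assms(2) unfolding ess_image_def by auto
  qed
  then show ?thesis by blast
qed

locale fully_faithful_exact_functor = exact_functor A0 Z \<zeta>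
  for A0 :: "('o0, 'm0) abcat" and Z :: "('p, 'n) abcat" and \<zeta> :: "('o0, 'm0, 'p, 'n) fctr" +
  assumes ff: "fully_faithful A0 Z \<zeta>"
begin

abbreviation clos where "clos \<equiv> ext_closure Z (ess_image A0 Z \<zeta>)"

interpretation E: full_abelian_subcategory Z clos
  by (rule full_abelian_subcategory_ext_closure[OF ff])

lemma image_in_ess_image: "obmap \<zeta> ` Ob A0 \<subseteq> ess_image A0 Z \<zeta>"
  using target.isomorphic_refl map_Ob unfolding ess_image_def by blast

lemma image_in_ext_closure: "obmap \<zeta> ` Ob A0 \<subseteq> clos"
  using image_in_ess_image target.subset_ext_closure by blast

lemma exact_functor_ext_closure: "exact_functor A0 (full_subcat Z clos) \<zeta>"
  using E.exact_functor_sub_iff[of A0 \<zeta>] exact_functor_axioms image_in_ext_closure by blast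

lemma extension_generating_ext_closure: "extension_generating A0 (full_subcat Z clos) \<zeta>"
proof -
  have S: "ess_image A0 Z \<zeta> \<subseteq> clos" by (rule target.subset_ext_closure)
  have im: "obmap \<zeta> X \<in> clos" if "X \<in> Ob A0" for X using image_in_ext_closure that by blast
  then have "fully_faithful A0 (full_subcat Z clos) \<zeta>"
    using ff unfolding fully_faithful_def by (simp add: homset_full_subcat)
  moreover have "ext_closure (full_subcat Z clos) (ess_image A0 (full_subcat Z clos) \<zeta>) = Ob (full_subcat Z clos)"
    unfolding ess_image_full_subcat[OF target.category_axioms S image_in_ext_closure]
    unfolding full_subcat_simps E.Ob_sub ext_closure_def[of "full_subcat Z clos"] E.ext_pow_sub(1)[OF S]
    by (simp add: ext_closure_def)
  ultimately show ?thesis unfolding extension_generating_def by blast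
qed

text \<open>
  \<open>T\<close> sends objects isomorphic to \<open>Q X\<close> into the essential image of \<open>\<zeta>\<close>, and it preserves extensions; by
  extension generation these reach all of \<open>A\<close>.
\<close>

lemma lift_image_in_ext_closure:
  assumes Q: "exact_functor A0 A Q" "extension_generating A0 A Q"
    and T: "(T, \<tau>) \<in> lifts A0 A Q Z \<zeta>"
  shows "obmap T ` Ob A \<subseteq> clos"
proof -
  interpret L: lifting_problem A0 A Q Z \<zeta>
    using Q exact_functor_axioms by (intro lifting_problem.intro)
  note T' = L.liftsD[OF T]
  interpret T: exact_functor A Z T by (rule T')
  have "obmap T ` ess_image A0 A Q \<subseteq> ess_image A0 Z \<zeta>"
  proof
    fix W assume "W \<in> obmap T ` ess_image A0 A Q"
    then obtain Y X where Y: "Y \<in> Ob A" "X \<in> Ob A0" "isomorphic A Y (obmap Q X)" "W = obmap T Y"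
      unfolding ess_image_def by blast
    have "isomorphic Z (obmap T (obmap Q X)) (obmap \<zeta> X)"
      using T'(2) Y(2) unfolding nat_iso_def isomorphic_def comp_fctr_simps by blast
    then have "isomorphic Z W (obmap \<zeta> X)"
      unfolding Y(4) by (rule target.isomorphic_trans[OF T.map_isomorphic[OF Y(3)]])
    then show "W \<in> ess_image A0 Z \<zeta>" using Y(2) T.map_Ob[OF Y(1)] Y(4) unfolding ess_image_def by blast
  qed
  then have "obmap T ` ext_pow A (ess_image A0 A Q) k \<subseteq> clos" for k
    using target.ext_pow_subset_closure by (rule order_trans[OF T.map_ext_pow])
  moreover have "Ob A = (\<Union>k. ext_pow A (ess_image A0 A Q) k)"
    using Q(2) unfolding extension_generating_def ext_closure_def by (simp only:)
  ultimately show ?thesis by blast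
qed

text \<open>
  This equality of sets, with those that follow from it, is the representability: a lift to \<open>Z\<close> is
  already a lift to the extension closure.
\<close>

lemma lifts_ext_closure:
  assumes Q: "exact_functor A0 A Q" "extension_generating A0 A Q"
  shows "lifts A0 A Q (full_subcat Z clos) \<zeta> = lifts A0 A Q Z \<zeta>"
proof -
  interpret Q: exact_functor A0 A Q by (rule Q)
  have "(T, \<tau>) \<in> lifts A0 A Q (full_subcat Z clos) \<zeta> \<longleftrightarrow> (T, \<tau>) \<in> lifts A0 A Q Z \<zeta>" for T \<tau>
  proof (cases "obmap T ` Ob A \<subseteq> clos")
    case True
    then have "obmap (T \<circ>\<^sub>F Q) ` Ob A0 \<subseteq> clos" using Q.map_Ob by auto
    then have "nat_iso A0 (full_subcat Z clos) (T \<circ>\<^sub>F Q) \<zeta> \<tau> \<longleftrightarrow> nat_iso A0 Z (T \<circ>\<^sub>F Q) \<zeta> \<tau>"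
      using image_in_ext_closure by (rule nat_iso_full_subcat_iff)
    moreover have "exact_functor A (full_subcat Z clos) T \<longleftrightarrow> exact_functor A Z T"
      using True E.exact_functor_sub_iff[of A T] by blast
    ultimately show ?thesis unfolding lifts_def mem_Collect_eq prod.case by (simp only:)
  next
    case False
    then have "(T, \<tau>) \<notin> lifts A0 A Q Z \<zeta>" using lift_image_in_ext_closure[OF Q] by blast
    moreover have "\<not> exact_functor A (full_subcat Z clos) T"
      using False E.exact_functor_sub_iff[of A T] by blast
    ultimately show ?thesis unfolding lifts_def mem_Collect_eq prod.case by blast
  qed
  then show ?thesis unfolding set_eq_iff split_paired_All by blast
qed

lemma lift_rel_ext_closure:
  assumes Q: "exact_functor A0 A Q" "extension_generating A0 A Q"
  shows "lift_rel A0 A Q (full_subcat Z clos) \<zeta> = lift_rel A0 A Q Z \<zeta>"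
proof -
  have "x \<in> lift_rel A0 A Q (full_subcat Z clos) \<zeta> \<longleftrightarrow> x \<in> lift_rel A0 A Q Z \<zeta>" for x
  proof -
    obtain F \<phi> G \<gamma> where x: "x = ((F, \<phi>), (G, \<gamma>))" by (cases x) auto
    have iff: "nat_iso A (full_subcat Z clos) F G \<psi> \<longleftrightarrow> nat_iso A Z F G \<psi>"
      if "(F, \<phi>) \<in> lifts A0 A Q Z \<zeta>" "(G, \<gamma>) \<in> lifts A0 A Q Z \<zeta>" for \<psi>
      using lift_image_in_ext_closure[OF Q that(1)] lift_image_in_ext_closure[OF Q that(2)]
      by (rule nat_iso_full_subcat_iff)
    show ?thesis
      unfolding x lift_rel_def lifts_ext_closure[OF Q] by (simp add: iff cong: conj_cong)
  qed
  then show ?thesis by blast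
qed

lemma lift_classes_ext_closure:
  assumes Q: "exact_functor A0 A Q" "extension_generating A0 A Q"
  shows "lift_classes A0 A Q (full_subcat Z clos) \<zeta> = lift_classes A0 A Q Z \<zeta>"
  unfolding lift_classes_def lifts_ext_closure[OF Q] lift_rel_ext_closure[OF Q] ..

lemma comp_class_ext_closure:
  assumes Q: "exact_functor A0 A Q" "extension_generating A0 A Q"
  shows "comp_class A0 A Q (full_subcat Z clos) \<zeta> d c = comp_class A0 A Q Z \<zeta> d c"
  unfolding comp_class_def lift_rel_ext_closure[OF Q] comp_lift_def by simp

end

theorem theoremB:
  fixes A0 :: "('o0, 'm0) abcat"
    and Z :: "('o, 'm) abcat"
    and \<zeta> :: "('o0, 'm0, 'o, 'm) fctr"
  assumes "exact_functor A0 Z \<zeta>"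
    and "fully_faithful A0 Z \<zeta>"
  shows "ind_represents A0 (full_subcat Z (ext_closure Z (ess_image A0 Z \<zeta>)), \<zeta>) (ncDef A0 Z \<zeta>)"
proof -
  let ?E = "full_subcat Z (ext_closure Z (ess_image A0 Z \<zeta>))"
  interpret fully_faithful_exact_functor A0 Z \<zeta>
    using assms by (intro fully_faithful_exact_functor.intro fully_faithful_exact_functor_axioms.intro)
  have E: "(?E, \<zeta>) \<in> Ob (FinTilde A0)"
    unfolding FinTilde_Ob_iff
    using exact_functor_ext_closure extension_generating_ext_closure ..
  let ?Fin = "Fin A0 :: (('o0, 'm0, 'o, 'm) fin_ob, ('o0, 'm0, 'o, 'm) fin_arr) cat"
  \<comment> \<open>A morphism records its source and target; apart from them it is the class itself.\<close>
  let ?\<eta> = "\<lambda>X d. (X, (?E, \<zeta>), d)"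
  have "presheaves_isomorphic ?Fin (ncDef A0 Z \<zeta>) (hom_psh (FinTilde A0) (?E, \<zeta>))"
    unfolding presheaves_isomorphic_def
  proof (intro exI[of _ ?\<eta>] conjI ballI)
    fix X assume "X \<in> Ob ?Fin"
    then have X: "X \<in> Ob (FinTilde A0)" by (rule Fin_Ob_imp_FinTilde)
    obtain A Q where XQ: "X = (A, Q)" by (cases X)
    have Q: "exact_functor A0 A Q" "extension_generating A0 A Q"
      using X unfolding XQ FinTilde_Ob_iff by auto
    have "psh_ob (hom_psh (FinTilde A0) (?E, \<zeta>)) X = ?\<eta> X ` psh_ob (ncDef A0 Z \<zeta>) X"
      using X E unfolding XQ hom_psh_def ncDef_simps lift_classes_ext_closure[OF Q, symmetric]
      by (auto simp: FinTilde_homset_iff)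
    then show "bij_betw (?\<eta> X) (psh_ob (ncDef A0 Z \<zeta>) X) (psh_ob (hom_psh (FinTilde A0) (?E, \<zeta>)) X)"
      unfolding bij_betw_def by (auto intro: inj_onI)
  next
    fix f d assume f: "f \<in> Arr ?Fin"
    obtain A Q B P where XY: "Dom ?Fin f = (A, Q)" "Cod ?Fin f = (B, P)" by (metis surj_pair)
    have "f \<in> homset ?Fin (A, Q) (B, P)" using f XY unfolding homset_def by simp
    then obtain c where c: "f = ((A, Q), (B, P), c)" and ob: "(A, Q) \<in> Ob (FinTilde A0)"
      by (rule Fin_homsetE)
    have Q: "exact_functor A0 A Q" "extension_generating A0 A Q" using ob unfolding FinTilde_Ob_iff by auto
    show "?\<eta> (Dom ?Fin f) (psh_ar (ncDef A0 Z \<zeta>) f d) =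
        psh_ar (hom_psh (FinTilde A0) (?E, \<zeta>)) f (?\<eta> (Cod ?Fin f) d)"
      unfolding XY unfolding c hom_psh_def psh.simps ncDef_simps FinTilde_Comp
        comp_class_ext_closure[OF Q] ..
  qed
  then show ?thesis unfolding ind_represents_def using E presheaf_ncDef[OF assms(1)] by blast
qed

end
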